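(* If $U$ is a circulant biunitary matrix of order $7$, then $U$ is isolated among all biunitary matrices (up to equivalence): there exists $\varepsilon>0$ such that every biunitary $V\in M_7(\mathbb{C})$ with $\|V-U\|<\varepsilon$ is equivalent to $U$.
   Context: A biunitary (complex Hadamard) matrix of order $n$ is a unitary $U\in M_n(\mathbb{C})$ all of whose entries have absolute value $1/\sqrt n$. A matrix $S$ of order $n$ is circulant if $S=(s_{j-i})_{i,j\in\mathbb{Z}/n\mathbb{Z}}$ for some numbers $s_k$, $k\in\mathbb{Z}/n\mathbb{Z}$. Let $D\subset M_n(\mathbb{C})$ be the diagonal matrices and $\tau=\frac1n\mathrm{Tr}$. A unitary $U$ is biunitary exactly when the square with $P_0=M_n(\mathbb{C})$, $P_{-1}=D$, $Q_0=U^*DU$, $Q_{-1}=\mathbb{C}$ and trace $\tau$ is a commuting square ($E_DE_{U^*DU}=E_{\mathbb{C}}$). Two biunitaries $U,V$ of order $n$ are equivalent if the corresponding commuting squares are isomorphic, i.e. there is a ($\tau$-preserving) $*$-automorphism $\phi$ of $M_n(\mathbb{C})$ with $\phi(D)=D$ and $\phi(U^*DU)=V^*DV$. *)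

theory Defs
  imports "HOL-Analysis.Analysis" "HOL-Library.Numeral_Type"
begin

definition conj_transpose :: "complex^'n^'m \<Rightarrow> complex^'m^'n" where
  "conj_transpose A = (\<chi> i j. cnj (A $ j $ i))"

definition unitary_matrix :: "complex^'n^'n \<Rightarrow> bool" where
  "unitary_matrix U \<longleftrightarrow>
     U ** conj_transpose U = mat 1 \<and> conj_transpose U ** U = mat 1"

definition biunitary :: "complex^'n^'n \<Rightarrow> bool" where
  "biunitary U \<longleftrightarrow>
     unitary_matrix U \<and> (\<forall>i j. cmod (U $ i $ j) = 1 / sqrt (real CARD('n)))"

text \<open>The index type is meant to be a numeral type such as \<^typ>\<open>7\<close>, whose ring
  structure is that of the integers modulo its cardinality, so that the subtraction
  below is subtraction modulo the order of the matrix.\<close>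
definition circulant :: "'a^('n::{finite,comm_ring_1})^('n::{finite,comm_ring_1}) \<Rightarrow> bool" where
  "circulant S \<longleftrightarrow> (\<exists>s :: 'n \<Rightarrow> 'a. \<forall>i j. S $ i $ j = s (j - i))"

definition diagonal_matrices :: "(complex^'n^'n) set" where
  "diagonal_matrices = {A. \<forall>i j. i \<noteq> j \<longrightarrow> A $ i $ j = 0}"

definition rotated_diagonal :: "complex^'n^'n \<Rightarrow> (complex^'n^'n) set" where
  "rotated_diagonal U = (\<lambda>A. conj_transpose U ** A ** U) ` diagonal_matrices"

definition normalized_trace :: "complex^'n^'n \<Rightarrow> complex" where
  "normalized_trace A = trace A / of_nat CARD('n)"

text \<open>Complex scalar multiplication of matrices is written out entrywise, because
  \<open>(*\<^sub>R)\<close> is only the real one.\<close>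
definition star_automorphism :: "(complex^'n^'n \<Rightarrow> complex^'n^'n) \<Rightarrow> bool" where
  "star_automorphism \<phi> \<longleftrightarrow>
     bij \<phi> \<and>
     (\<forall>A B. \<phi> (A + B) = \<phi> A + \<phi> B) \<and>
     (\<forall>c A. \<phi> (\<chi> i j. c * A $ i $ j) = (\<chi> i j. c * \<phi> A $ i $ j)) \<and>
     (\<forall>A B. \<phi> (A ** B) = \<phi> A ** \<phi> B) \<and>
     \<phi> (mat 1) = mat 1 \<and>
     (\<forall>A. \<phi> (conj_transpose A) = conj_transpose (\<phi> A))"

text \<open>Isomorphism of the commuting squares attached to \<open>U\<close> and \<open>V\<close>.\<close>
definition biunitary_equivalent :: "complex^'n^'n \<Rightarrow> complex^'n^'n \<Rightarrow> bool" where
  "biunitary_equivalent U V \<longleftrightarrow>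
     (\<exists>\<phi>. star_automorphism \<phi> \<and>
        (\<forall>A. normalized_trace (\<phi> A) = normalized_trace A) \<and>
        \<phi> ` diagonal_matrices = diagonal_matrices \<and>
        \<phi> ` rotated_diagonal U = rotated_diagonal V)"

text \<open>The operator norm for the Euclidean norm on column vectors; the norm that the
  type \<^typ>\<open>complex^'n^'n\<close> carries by itself is the Hilbert--Schmidt norm.\<close>
definition operator_norm :: "complex^'n^'m \<Rightarrow> real" where
  "operator_norm A = onorm (\<lambda>x. A *v x)"

end

theory Submission
  imports Defs "HOL-Library.Function_Algebras"
begin

text \<open>An infinitesimally rigid biunitary matrix is isolated: for a nearby biunitary, dephased so that its first row
  and column agree with those of \<open>U\<close>, the unitarity equations bound the deviation by its own square. For a
  circulant \<open>U\<close> with entries \<open>x (j - i)\<close> rigidity splits along the characters of \<open>\<int>/7\<close> into seven small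
  linear systems in terms of the cyclic root \<open>x\<close>.

  The cyclic roots solve a bilinear system. Its Bezoutian at two solutions vanishes if they differ and is the
  Jacobian if they coincide, and it is a form of degree 6 in 7 variables; hence as soon as 924 nondegenerate
  solutions are known, there are no others. They are the 42 quadratic phases and the 49 translates of each of 18
  roots that are constant on the cosets of a nontrivial subgroup of the multiplicative group of \<open>\<int>/7\<close>. For the
  quadratic phases the linear systems are diagonalised by the Fourier transform; for the other unimodular roots,
  two up to symmetry, they are inverted numerically with an explicit error bound.\<close>

section \<open>Isolation of rigid biunitary matrices\<close>

text \<open>Unimodularity is a real condition, under which solutions are hard to count. Replacing
  conjugation by inversion turns orthogonality of the rows into an algebraic system over the complex
  numbers. The price is that the solutions coming from no biunitary matrix must be exhibited as
  well. For them only the trivial character matters, since it alone gives the Jacobian; unimodular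
  roots need all seven characters.

  There is no slack: 924 is the dimension of the space of forms and also 42 + 49 * 18, so one
  missing root or one coincidence would break the argument. This is why so much effort goes into
  showing that translates of different roots are distinct. The subgroups of order 6, 3 and 2
  contribute 2, 4 and 12 of the 18 roots.

  A symmetry of a root carries nondegeneracy from one character to another, so numerical
  certificates are needed only for representatives. They may be crude: a left inverse with two
  decimals suffices, because its product with the matrix only has to be within distance 1 of the
  identity.\<close>

lemma matrix_entry_le_operator_norm:
  fixes A :: "complex^'n^'m"
  shows "cmod (A $ i $ k) \<le> operator_norm A"
proof -
  have bl: "bounded_linear (\<lambda>x. A *v x)"
    by (rule matrix_vector_mul_bounded_linear)
  have "cmod (A $ i $ k) = cmod ((A *v axis k 1) $ i)"
    by (simp add: matrix_vector_mult_def axis_def if_distrib cong: if_cong)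
  also have "\<dots> \<le> norm (A *v axis k 1)"
    by (rule Finite_Cartesian_Product.norm_nth_le)
  also have "\<dots> \<le> onorm (\<lambda>x. A *v x) * norm (axis k 1 :: complex^'n)"
    by (rule onorm[OF bl])
  finally show ?thesis by (simp add: operator_norm_def)
qed

lemma biunitary_cmod:
  fixes U :: "complex^'n^'n"
  assumes "biunitary U"
  shows "cmod (U $ i $ k) = 1 / sqrt (real CARD('n))"
  using assms by (simp add: biunitary_def)

lemma biunitary_nonzero:
  fixes U :: "complex^'n^'n"
  assumes "biunitary U"
  shows "U $ i $ k \<noteq> 0"
  using biunitary_cmod[OF assms, of i k] by auto

lemma biunitary_mult_cnj:
  fixes U :: "complex^'n^'n"
  assumes "biunitary U"
  shows "U $ i $ k * cnj (U $ i $ k) = 1 / of_nat CARD('n)"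
proof -
  have "(cmod (U $ i $ k))\<^sup>2 = 1 / real CARD('n)"
    by (simp add: biunitary_cmod[OF assms] power_divide)
  then show ?thesis
    by (metis complex_norm_square of_real_1 of_real_divide of_real_of_nat_eq)
qed

lemma biunitary_rows:
  fixes U :: "complex^'n^'n"
  assumes "biunitary U"
  shows "(\<Sum>k\<in>UNIV. U $ i $ k * cnj (U $ j $ k)) = (if i = j then 1 else 0)"
proof -
  have "(U ** conj_transpose U) $ i $ j = (mat 1 :: complex^'n^'n) $ i $ j"
    using assms by (simp add: biunitary_def unitary_matrix_def)
  then show ?thesis
    by (simp add: matrix_matrix_mult_def conj_transpose_def mat_def)
qed

text \<open>The automorphism is conjugation by the diagonal unitary of \<open>\<beta>\<close>. The
  row phases \<open>\<alpha>\<close> cancel in \<open>V* A V\<close> because diagonal matrices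
  commute.\<close>

lemma biunitary_equivalentI_phases:
  fixes U V :: "complex^'n^'n"
  assumes V: "\<And>i k. V $ i $ k = \<alpha> i * U $ i $ k * \<beta> k"
    and \<alpha>: "\<And>i. \<alpha> i * cnj (\<alpha> i) = 1" and \<beta>: "\<And>k. \<beta> k * cnj (\<beta> k) = 1"
  shows "biunitary_equivalent V U"
proof -
  define \<phi> :: "complex^'n^'n \<Rightarrow> complex^'n^'n" where "\<phi> = (\<lambda>A. \<chi> i j. \<beta> i * A $ i $ j * cnj (\<beta> j))"
  define \<psi> :: "complex^'n^'n \<Rightarrow> complex^'n^'n" where "\<psi> = (\<lambda>A. \<chi> i j. cnj (\<beta> i) * A $ i $ j * \<beta> j)"
  have \<beta>': "cnj (\<beta> k) * \<beta> k = 1" for k using \<beta>[of k] by (simp add: mult.commute)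
  have \<alpha>': "cnj (\<alpha> k) * \<alpha> k = 1" for k using \<alpha>[of k] by (simp add: mult.commute)
  have c1: "\<beta> i * (cnj (\<beta> i) * x) = x" "cnj (\<beta> i) * (\<beta> i * x) = x" for i x
    using \<beta>[of i] \<beta>'[of i] by (simp_all flip: mult.assoc)
  have c2: "\<beta> i * (\<beta> j * (cnj (\<beta> i) * cnj (\<beta> j))) = 1" for i j
    using \<beta>[of i] \<beta>[of j] by (metis mult.assoc mult.commute mult_1)
  have pq: "\<phi> (\<psi> A) = A" "\<psi> (\<phi> A) = A" for A
    by (simp_all add: \<phi>_def \<psi>_def vec_eq_iff mult_ac c1 c2)
  have bij: "bij \<phi>"
    by (rule bij_betw_byWitness[where f'=\<psi>]) (auto simp: pq)
  have mult: "\<phi> (A ** B) = \<phi> A ** \<phi> B" for A B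
    by (auto simp: \<phi>_def vec_eq_iff matrix_matrix_mult_def sum_distrib_left sum_distrib_right
        mult_ac c1 intro!: sum.cong)
  have star: "star_automorphism \<phi>"
    unfolding star_automorphism_def
    using bij mult \<beta>
    by (auto simp: c2 \<phi>_def vec_eq_iff algebra_simps mat_def conj_transpose_def)
  have tr: "normalized_trace (\<phi> A) = normalized_trace A" for A
    by (simp add: normalized_trace_def trace_def \<phi>_def mult_ac c1)
  have D: "\<phi> ` diagonal_matrices = diagonal_matrices"
  proof
    show "\<phi> ` diagonal_matrices \<subseteq> diagonal_matrices"
      by (auto simp: \<phi>_def diagonal_matrices_def)
    have "A \<in> diagonal_matrices \<Longrightarrow> \<psi> A \<in> diagonal_matrices" for A
      by (auto simp: \<psi>_def diagonal_matrices_def)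
    then show "diagonal_matrices \<subseteq> \<phi> ` diagonal_matrices"
      by (metis image_eqI pq(1) subsetI)
  qed
  have R: "\<phi> (conj_transpose V ** A ** V) = conj_transpose U ** A ** U"
    if "A \<in> diagonal_matrices" for A
  proof -
    have A: "A $ k $ l = (if k = l then A $ k $ k else 0)" for k l
      using that by (auto simp: diagonal_matrices_def)
    have e: "(conj_transpose W ** A ** W) $ i $ j = (\<Sum>k\<in>UNIV. cnj (W $ k $ i) * A $ k $ k * W $ k $ j)"
      for W :: "complex^'n^'n" and i j
    proof -
      have "(\<Sum>k\<in>UNIV. cnj (W $ k $ i) * A $ k $ l) = cnj (W $ l $ i) * A $ l $ l" for l
        by (subst A) (simp add: if_distrib if_distribR cong: if_cong)
      then show ?thesis
        by (simp add: matrix_matrix_mult_def conj_transpose_def)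
    qed
    have "\<beta> i * (cnj (V $ k $ i) * A $ k $ k * V $ k $ j) * cnj (\<beta> j) = cnj (U $ k $ i) * A $ k $ k * U $ k $ j"
      for i j k
    proof -
      have "\<beta> i * (cnj (V $ k $ i) * A $ k $ k * V $ k $ j) * cnj (\<beta> j)
          = (\<beta> i * cnj (\<beta> i)) * (\<beta> j * cnj (\<beta> j)) * (\<alpha> k * cnj (\<alpha> k)) * (cnj (U $ k $ i) * A $ k $ k * U $ k $ j)"
        by (simp add: V mult_ac)
      then show ?thesis by (simp add: \<alpha> \<beta>)
    qed
    then show ?thesis
      unfolding \<phi>_def vec_eq_iff
      by (auto simp only: e sum_distrib_left sum_distrib_right vec_lambda_beta intro!: sum.cong)
  qed
  have "\<phi> ` rotated_diagonal V = rotated_diagonal U"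
    unfolding rotated_diagonal_def image_image by (intro image_cong refl R)
  with star tr D show ?thesis
    unfolding biunitary_equivalent_def by blast
qed

text \<open>Derivative of the unitarity equations under
  \<open>U i k \<mapsto> U i k * (1 + \<delta> i k)\<close>, with \<open>cnj \<delta>\<close>
  replaced by \<open>- \<delta>\<close> as for a phase to first order. The solutions
  \<open>a i + b k\<close> come from rescaling rows and columns. The unknown is complex because
  \<open>w - 1\<close> for a phase \<open>w\<close> is not exactly imaginary and because Fourier
  components are taken later.\<close>

definition infinitesimally_rigid :: "complex^'n^'n \<Rightarrow> bool" where
  "infinitesimally_rigid U \<longleftrightarrow>
     (\<forall>\<delta>. (\<forall>i j. (\<Sum>k\<in>UNIV. U $ i $ k * cnj (U $ j $ k) * (\<delta> i k - \<delta> j k)) = 0)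
        \<longrightarrow> (\<exists>a b. \<forall>i k. \<delta> i k = a i + b k))"

lemma rigid_imp_isolated:
  fixes U :: "complex^'n^'n"
  assumes U: "biunitary U" and rigid: "infinitesimally_rigid U"
  shows "\<exists>\<epsilon>>0. \<forall>V. biunitary V \<and> operator_norm (V - U) < \<epsilon> \<longrightarrow> biunitary_equivalent V U"
proof -
  define n where "n = real CARD('n)"
  have n: "n \<ge> 1" unfolding n_def by (simp add: Suc_leI)
  obtain o' :: 'n where True by simp
  \<comment> \<open>Vanishing in row and column \<open>o'\<close> excludes all nonzero
    \<open>a i + b k\<close>, so that \<open>L\<close> is injective on \<open>S\<close> and hence
    bounded below there.\<close>
  define S :: "(complex^'n^'n) set" where "S = {\<delta>. \<forall>k. \<delta> $ o' $ k = 0 \<and> \<delta> $ k $ o' = 0}"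
  define L :: "complex^'n^'n \<Rightarrow> complex^'n^'n" where
    "L = (\<lambda>\<delta>. \<chi> i j. \<Sum>k\<in>UNIV. U $ i $ k * cnj (U $ j $ k) * (\<delta> $ i $ k - \<delta> $ j $ k))"
  have lin: "linear L"
    by (rule linearI) (simp_all add: L_def vec_eq_iff sum.distrib[symmetric] scaleR_sum_right algebra_simps)
  have "\<exists>e>0. \<forall>x\<in>S. e * norm x \<le> norm (L x)"
  proof (rule injective_imp_isometric)
    show "subspace S" by (auto simp: S_def subspace_def)
    then show "closed S" by (rule closed_subspace)
    show "bounded_linear L" using lin by (simp add: linear_conv_bounded_linear)
    show "\<forall>x\<in>S. L x = 0 \<longrightarrow> x = 0"
    proof (intro ballI impI)
      fix x assume x: "x \<in> S" "L x = 0"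
      then have "\<forall>i j. (\<Sum>k\<in>UNIV. U $ i $ k * cnj (U $ j $ k) * (x $ i $ k - x $ j $ k)) = 0"
        by (simp add: L_def vec_eq_iff)
      with rigid obtain a b where ab: "\<And>i k. x $ i $ k = a i + b k"
        unfolding infinitesimally_rigid_def by (elim allE[of _ "\<lambda>i k. x $ i $ k"]) blast
      have "a i + b o' = 0" "a o' + b i = 0" "a o' + b o' = 0" for i
        using x(1) by (auto simp: S_def simp flip: ab)
      then have "x $ i $ k = 0" for i k
        unfolding ab by (metis add_left_cancel)
      then show "x = 0" by (simp add: vec_eq_iff)
    qed
  qed
  then obtain e where e: "e > 0" "\<And>x. x \<in> S \<Longrightarrow> e * norm x \<le> norm (L x)" by blast
  \<comment> \<open>The deviation satisfies \<open>q \<le> 4 * n^3 * \<epsilon>\<close> and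
    \<open>e * q \<le> 2 * n^3 * q^2\<close>; this choice makes \<open>2 * n^3 * q\<close> at most
    \<open>e / 2\<close>, which forces \<open>q = 0\<close>.\<close>
  define \<epsilon> where "\<epsilon> = e / (16 * n ^ 6)"
  have \<epsilon>: "\<epsilon> > 0" using e n by (simp add: \<epsilon>_def)
  have "biunitary_equivalent V U" if V: "biunitary V" and small: "operator_norm (V - U) < \<epsilon>" for V
  proof -
    define h where "h = (\<lambda>i k. n * V $ i $ k * cnj (U $ i $ k))"
    \<comment> \<open>Row and column phases that make \<open>r i * h i k * t k\<close> equal to 1
      whenever \<open>i\<close> or \<open>k\<close> is \<open>o'\<close>.\<close>
    define r where "r = (\<lambda>i. cnj (h i o') * h o' o')"
    define t where "t = (\<lambda>k. cnj (h o' k))"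
    define \<delta> where "\<delta> = ((\<chi> i k. r i * h i k * t k - 1) :: complex^'n^'n)"
    have UU: "cnj (U $ i $ k) * U $ i $ k = 1 / n" "U $ i $ k * cnj (U $ i $ k) = 1 / n" for i k
      using biunitary_mult_cnj[OF U, of i k] by (simp_all add: n_def mult.commute)
    have VV: "V $ i $ k * cnj (V $ i $ k) = 1 / n" for i k
      using biunitary_mult_cnj[OF V, of i k] by (simp_all add: n_def mult.commute)
    have hh: "h i k * cnj (h i k) = 1" for i k
    proof -
      have "h i k * cnj (h i k) = n * n * (V $ i $ k * cnj (V $ i $ k)) * (cnj (U $ i $ k) * U $ i $ k)"
        by (simp add: h_def mult_ac)
      then show ?thesis using n by (simp add: UU VV)
    qed
    have mh: "cmod (h i k) = 1" for i k
      using hh[of i k] by (metis complex_mod_mult_cnj norm_one power2_eq_1_iff norm_ge_zero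
          abs_of_nonneg abs_minus_cancel)
    have rr: "r i * cnj (r i) = 1" for i
    proof -
      have "r i * cnj (r i) = (h i o' * cnj (h i o')) * (h o' o' * cnj (h o' o'))"
        by (simp add: r_def mult_ac)
      then show ?thesis by (simp add: hh)
    qed
    have tt: "t i * cnj (t i) = 1" for i
      using hh[of o' i] by (simp add: t_def mult.commute)
    have mr: "cmod (r i) = 1" and mt: "cmod (t i) = 1" for i
      by (simp_all add: r_def t_def norm_mult mh)
    have VU: "V $ i $ k = h i k * U $ i $ k" for i k
      using UU[of i k] n by (simp add: h_def mult.assoc)
    have h1: "cmod (h i k - 1) \<le> n * \<epsilon>" for i k
    proof -
      have "h i k - 1 = n * (V $ i $ k - U $ i $ k) * cnj (U $ i $ k)"
        using UU[of i k] n by (simp add: h_def algebra_simps)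
      then have "cmod (h i k - 1) = n * cmod ((V - U) $ i $ k) * cmod (U $ i $ k)"
        using n by (simp add: norm_mult)
      also have "\<dots> \<le> n * \<epsilon> * 1"
        using matrix_entry_le_operator_norm[of "V - U" i k] small n
        by (intro mult_mono) (auto simp: biunitary_cmod[OF U] n_def intro!: mult_nonneg_nonneg less_imp_le[OF \<epsilon>])
      finally show ?thesis by simp
    qed
    have \<delta>1: "cmod (\<delta> $ i $ k) \<le> 4 * n * \<epsilon>" for i k
    proof -
      have pr: "cmod (a * b - 1) \<le> cmod (a - 1) + cmod (b - 1)" if "cmod a = 1" for a b
      proof -
        have "cmod (a * (b - 1) + (a - 1)) \<le> cmod (a - 1) + cmod (b - 1)"
          using norm_triangle_ineq[of "a * (b-1)" "a-1"] that by (simp add: norm_mult)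
        then show ?thesis by (simp add: algebra_simps)
      qed
      have cc: "cmod (cnj z - 1) = cmod (z - 1)" for z
        by (metis complex_cnj_diff complex_cnj_one complex_mod_cnj)
      have "cmod (r i * h i k * t k - 1) \<le> cmod (r i * h i k - 1) + cmod (t k - 1)"
        by (rule pr) (simp add: norm_mult mr mh)
      also have "cmod (r i * h i k - 1) \<le> cmod (r i - 1) + cmod (h i k - 1)"
        by (rule pr) (simp add: mr)
      also have "cmod (r i - 1) \<le> cmod (cnj (h i o') - 1) + cmod (h o' o' - 1)"
        unfolding r_def by (rule pr) (simp add: mh)
      finally show ?thesis
        using h1[of i o'] h1[of o' o'] h1[of i k] h1[of o' k] by (simp add: \<delta>_def t_def cc)
    qed
    have \<delta>S: "\<delta> \<in> S"
    proof -
      have c: "h i o' * cnj (h i o') = 1" "cnj (h i o') * h i o' = 1" "cnj (h o' i) * h o' i = 1" for i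
        using hh[of i o'] hh[of o' i] by (simp_all add: mult.commute)
      have "r i * h i o' * t o' = (h i o' * cnj (h i o')) * (h o' o' * cnj (h o' o'))" for i
        by (simp add: r_def t_def mult_ac)
      moreover have "r o' * h o' i * t i = (h o' o' * cnj (h o' o')) * (h o' i * cnj (h o' i))" for i
        by (simp add: r_def t_def mult_ac)
      ultimately show ?thesis by (simp add: S_def \<delta>_def hh)
    qed
    define w where "w = (\<lambda>i k. r i * h i k * t k)"
    have ww: "w i k * cnj (w i k) = 1" for i k
    proof -
      have "w i k * cnj (w i k) = (r i * cnj (r i)) * (h i k * cnj (h i k)) * (t k * cnj (t k))"
        by (simp add: w_def mult_ac)
      then show ?thesis by (simp add: rr hh tt)
    qed
    have \<delta>w: "\<delta> $ i $ k = w i k - 1" for i k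
      by (simp add: \<delta>_def w_def)
    have Lij: "L \<delta> $ i $ j = (\<Sum>k\<in>UNIV. U $ i $ k * cnj (U $ j $ k) *
        (\<delta> $ j $ k * cnj (\<delta> $ j $ k) - \<delta> $ i $ k * cnj (\<delta> $ j $ k)))" for i j
    proof -
      have W: "(\<Sum>k\<in>UNIV. U $ i $ k * cnj (U $ j $ k) * (w i k * cnj (w j k)))
          = (\<Sum>k\<in>UNIV. U $ i $ k * cnj (U $ j $ k))"
      proof -
        have "(\<Sum>k\<in>UNIV. U $ i $ k * cnj (U $ j $ k) * (w i k * cnj (w j k)))
           = r i * cnj (r j) * (\<Sum>k\<in>UNIV. V $ i $ k * cnj (V $ j $ k))"
          unfolding sum_distrib_left
        proof (intro sum.cong refl)
          fix k
          have "U $ i $ k * cnj (U $ j $ k) * (w i k * cnj (w j k)) =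
            r i * cnj (r j) * (V $ i $ k * cnj (V $ j $ k)) * (t k * cnj (t k))"
            by (simp add: w_def VU mult_ac)
          then show "U $ i $ k * cnj (U $ j $ k) * (w i k * cnj (w j k)) =
            r i * cnj (r j) * (V $ i $ k * cnj (V $ j $ k))" by (simp add: tt)
        qed
        then show ?thesis
          by (simp add: biunitary_rows[OF U] biunitary_rows[OF V] rr)
      qed
      have "L \<delta> $ i $ j = (\<Sum>k\<in>UNIV. U $ i $ k * cnj (U $ j $ k) * (\<delta> $ i $ k - \<delta> $ j $ k))"
        by (simp add: L_def)
      also have "\<dots> = (\<Sum>k\<in>UNIV. U $ i $ k * cnj (U $ j $ k) * (w i k * cnj (w j k))
          - U $ i $ k * cnj (U $ j $ k) + U $ i $ k * cnj (U $ j $ k) *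
        (\<delta> $ j $ k * cnj (\<delta> $ j $ k) - \<delta> $ i $ k * cnj (\<delta> $ j $ k)))"
      proof (intro sum.cong refl)
        fix k
        \<comment> \<open>Since \<open>w j k\<close> has modulus 1,
          \<open>cnj \<delta> = - \<delta> - \<delta> * cnj \<delta>\<close> at
          \<open>(j, k)\<close>. This removes the conjugate from the linear part of
          \<open>w i k * cnj (w j k) - 1\<close> and leaves a quadratic remainder.\<close>
        have "\<delta> $ i $ k - \<delta> $ j $ k = w i k * cnj (w j k) - 1 +
          (\<delta> $ j $ k * cnj (\<delta> $ j $ k) - \<delta> $ i $ k * cnj (\<delta> $ j $ k))"
          using ww[of j k] by (simp add: \<delta>w algebra_simps)
        then show "U $ i $ k * cnj (U $ j $ k) * (\<delta> $ i $ k - \<delta> $ j $ k) =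
          U $ i $ k * cnj (U $ j $ k) * (w i k * cnj (w j k))
          - U $ i $ k * cnj (U $ j $ k) + U $ i $ k * cnj (U $ j $ k) *
        (\<delta> $ j $ k * cnj (\<delta> $ j $ k) - \<delta> $ i $ k * cnj (\<delta> $ j $ k))"
          by (simp only: distrib_left right_diff_distrib mult_1_right)
      qed
      finally show ?thesis by (simp add: sum.distrib sum_subtractf W)
    qed
    define q where "q = norm \<delta>"
    have dq: "cmod (\<delta> $ i $ k) \<le> q" for i k
      unfolding q_def using Finite_Cartesian_Product.norm_nth_le[of "\<delta> $ i" k]
        Finite_Cartesian_Product.norm_nth_le[of \<delta> i] by linarith
    have norm_le: "norm A \<le> n * n * c" if "\<And>i k. cmod (A $ i $ k) \<le> c" for A :: "complex^'n^'n" and c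
    proof -
      have l1: "norm x \<le> (\<Sum>i\<in>UNIV. norm (x $ i))" for x :: "'b::real_normed_vector^'n"
        unfolding norm_vec_def by (rule L2_set_le_sum) simp
      have "norm A \<le> (\<Sum>i\<in>UNIV. norm (A $ i))" by (rule l1)
      also have "\<dots> \<le> (\<Sum>i\<in>(UNIV::'n set). \<Sum>k\<in>(UNIV::'n set). c)"
        by (intro sum_mono order_trans[OF l1] that)
      finally show ?thesis by (simp add: n_def)
    qed
    have "q \<le> n * n * (4 * n * \<epsilon>)" unfolding q_def by (rule norm_le[OF \<delta>1])
    have q0: "q \<ge> 0" by (simp add: q_def)
    have "cmod (L \<delta> $ i $ j) \<le> n * (2 * q * q)" for i j
    proof -
      have "cmod (L \<delta> $ i $ j) \<le> (\<Sum>k\<in>(UNIV::'n set). 2 * q * q)"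
        unfolding Lij
      proof (intro order_trans[OF norm_sum] sum_mono)
        fix k
        have "cmod (\<delta> $ j $ k * cnj (\<delta> $ j $ k) - \<delta> $ i $ k * cnj (\<delta> $ j $ k)) \<le> q * q + q * q"
          using dq q0 by (intro order_trans[OF norm_triangle_ineq4] add_mono)
            (auto simp: norm_mult intro!: mult_mono)
        moreover have "cmod (U $ i $ k * cnj (U $ j $ k)) \<le> 1"
          using n by (simp add: norm_mult biunitary_cmod[OF U] n_def)
        ultimately show "cmod (U $ i $ k * cnj (U $ j $ k) *
          (\<delta> $ j $ k * cnj (\<delta> $ j $ k) - \<delta> $ i $ k * cnj (\<delta> $ j $ k))) \<le> 2 * q * q"
          unfolding norm_mult[of "U $ i $ k * cnj (U $ j $ k)"]
          using mult_mono[of "cmod (U $ i $ k * cnj (U $ j $ k))" 1] by fastforce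
      qed
      then show ?thesis by (simp add: n_def)
    qed
    then have "norm (L \<delta>) \<le> n * n * (n * (2 * q * q))" by (rule norm_le)
    with e(2)[OF \<delta>S] have "e * q \<le> 2 * n ^ 3 * q * q"
      by (simp add: q_def power3_eq_cube mult_ac)
    moreover have "2 * n ^ 3 * q < e" if "q > 0"
    proof -
      have "2 * n ^ 3 * q \<le> 2 * n ^ 3 * (n * n * (4 * n * \<epsilon>))"
        using \<open>q \<le> _\<close> n by (intro mult_left_mono) auto
      also have "\<dots> = e / 2" using n by (simp add: \<epsilon>_def field_simps power_numeral_reduce)
      also have "\<dots> < e" using e by simp
      finally show ?thesis .
    qed
    ultimately have "q = 0"
      using q0 by (smt (verit) mult_less_cancel_right_disj mult.assoc)
    then have \<delta>0: "\<delta> = 0" by (simp add: q_def)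
    show ?thesis
    proof (rule biunitary_equivalentI_phases)
      show "V $ i $ k = cnj (r i) * U $ i $ k * cnj (t k)" for i k
      proof -
        have "r i * h i k * t k = 1" using \<delta>0 by (simp add: \<delta>_def vec_eq_iff)
        then have "(r i * cnj (r i)) * h i k * (t k * cnj (t k)) = cnj (r i) * cnj (t k)"
          by (simp add: mult_ac)
        then show ?thesis by (simp add: rr tt VU mult_ac)
      qed
      show "cnj (r i) * cnj (cnj (r i)) = 1" for i using rr[of i] by (simp add: mult.commute)
      show "cnj (t i) * cnj (cnj (t i)) = 1" for i using tt[of i] by (simp add: mult.commute)
    qed
  qed
  with \<epsilon> show ?thesis by blast
qed

section \<open>Cyclic roots and their symmetries\<close>

lemma UNIV_7: "(UNIV :: 7 set) = {0, 1, 2, 3, 4, 5, 6}"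
proof -
  have "card {0, 1, 2, 3, 4, 5, 6 :: 7} = CARD(7)" by simp
  then show ?thesis by (metis card_subset_eq finite_class.finite_UNIV subset_UNIV)
qed

lemma all_7: "(\<forall>k::7. P k) \<longleftrightarrow> P 0 \<and> P 1 \<and> P 2 \<and> P 3 \<and> P 4 \<and> P 5 \<and> P 6"
proof -
  have "(\<forall>k::7. P k) \<longleftrightarrow> (\<forall>k\<in>UNIV. P k)" by simp
  then show ?thesis unfolding UNIV_7 by simp
qed

lemma sum_7: "(\<Sum>k\<in>UNIV. f (k::7)) = f 0 + f 1 + f 2 + f 3 + f 4 + f 5 + f 6"
  for f :: "7 \<Rightarrow> 'a::comm_monoid_add"
  unfolding UNIV_7 by (simp add: add.assoc)

definition rep :: "7 \<Rightarrow> nat" where "rep k = nat (Rep_bit1 k)"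

lemma of_nat_rep [simp]: "of_nat (rep k) = k"
proof -
  have "0 \<le> Rep_bit1 k" using Rep_bit1[of k] by simp
  then show ?thesis
    by (simp only: rep_def bit1.of_nat_eq int_nat_eq if_True bit1.Rep_mod bit1.Rep_bit1_inverse)
qed

lemma rep_numerals [simp]:
  "rep 0 = 0" "rep 1 = 1" "rep 2 = 2" "rep 3 = 3" "rep 4 = 4" "rep 5 = 5" "rep 6 = 6"
  by (simp_all add: rep_def bit1.Rep_numeral bit1.Rep_0 bit1.Rep_1)

lemma rep_of_nat: "rep (of_nat n) = n mod 7"
proof -
  have "Rep_bit1 (of_nat n :: 7) = int n mod int CARD(7)"
    by (simp only: bit1.of_nat_eq bit1.Rep_Abs_mod)
  then show ?thesis by (simp add: rep_def nat_mod_distrib)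
qed

lemma rep_less: "rep k < 7"
  by (metis mod_less_divisor of_nat_rep rep_of_nat zero_less_numeral)

lemma rep_add: "rep (k + d) = (rep k + rep d) mod 7"
  by (metis of_nat_add of_nat_rep rep_of_nat)

lemma rep_mult: "rep (k * d) = (rep k * rep d) mod 7"
  by (metis of_nat_mult of_nat_rep rep_of_nat)

lemma rep_diff: "rep (k - d) = (rep k + (7 - rep d)) mod 7"
proof -
  have "of_nat (rep k + (7 - rep d)) = (k - d :: 7)"
    using rep_less[of d] by (simp add: of_nat_diff)
  then show ?thesis by (metis rep_of_nat)
qed

lemma sum_shift: "(\<Sum>k\<in>UNIV. f (k + a)) = (\<Sum>k\<in>UNIV. f k)"
  for f :: "'n::{finite,ab_group_add} \<Rightarrow> 'a::comm_monoid_add"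
  by (rule sum.reindex_bij_witness[of _ "\<lambda>k. k - a" "\<lambda>k. k + a"]) auto

lemma unit_7: "\<exists>u. u * k = 1" if "k \<noteq> 0" for k :: 7
proof -
  have "1 * 1 = (1::7)" "4 * 2 = (1::7)" "5 * 3 = (1::7)" "2 * 4 = (1::7)" "3 * 5 = (1::7)" "6 * 6 = (1::7)"
    by simp_all
  then have "\<forall>k::7. k \<noteq> 0 \<longrightarrow> (\<exists>u. u * k = 1)" unfolding all_7 by blast
  with that show ?thesis by blast
qed

section \<open>A primitive seventh root of unity and the characters of the integers modulo 7\<close>

definition heptic_re :: real where
  "heptic_re = (SOME c. 0.62348 < c \<and> c < 0.62349 \<and> 8 * c ^ 3 + 4 * c\<^sup>2 - 4 * c - 1 = 0)"

lemma heptic_re: "0.62348 < heptic_re" "heptic_re < 0.62349"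
  and heptic_re_eq: "8 * heptic_re ^ 3 + 4 * heptic_re\<^sup>2 - 4 * heptic_re - 1 = 0"
proof -
  let ?f = "\<lambda>c::real. 8 * c ^ 3 + 4 * c\<^sup>2 - 4 * c - 1"
  have "\<exists>c\<ge>0.62348. c \<le> 0.62349 \<and> ?f c = 0"
    by (rule IVT') (auto intro!: continuous_intros simp: power_numeral_reduce)
  then obtain c where c: "c \<ge> 0.62348" "c \<le> 0.62349" "?f c = 0" by blast
  moreover have "c \<noteq> 0.62348" "c \<noteq> 0.62349" using c(3) by (auto simp: power_numeral_reduce simp del: eq_divide_eq_numeral1 divide_eq_eq_numeral1)
  ultimately have "0.62348 < c \<and> c < 0.62349 \<and> ?f c = 0" by (simp add: less_le)
  then have "0.62348 < heptic_re \<and> heptic_re < 0.62349 \<and> ?f heptic_re = 0"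
    unfolding heptic_re_def by (rule someI)
  then show "0.62348 < heptic_re" "heptic_re < 0.62349" "?f heptic_re = 0" by auto
qed

definition heptic_im :: real where "heptic_im = sqrt (1 - heptic_re\<^sup>2)"

lemma heptic_im_sq: "heptic_im\<^sup>2 = 1 - heptic_re\<^sup>2"
proof -
  have "heptic_re\<^sup>2 \<le> 1\<^sup>2" using heptic_re by (intro power_mono) auto
  then show ?thesis by (simp add: heptic_im_def)
qed

lemma heptic_im: "0.78183 < heptic_im" "heptic_im < 0.78184"
proof -
  have "heptic_re\<^sup>2 < 0.62349\<^sup>2" "0.62348\<^sup>2 < heptic_re\<^sup>2" using heptic_re by (intro power_strict_mono; simp)+
  then have "0.78183\<^sup>2 < heptic_im\<^sup>2" "heptic_im\<^sup>2 < 0.78184\<^sup>2" 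
    unfolding heptic_im_sq by (simp_all add: power2_eq_square)
  moreover have "heptic_im \<ge> 0" using heptic_re by (simp add: heptic_im_def power_le_one)
  moreover have "(0::real) \<le> 0.78184" by simp
  ultimately show "0.78183 < heptic_im" "heptic_im < 0.78184"
    using power_less_imp_less_base by blast+
qed

text \<open>This is \<open>exp (2 \<pi> \<i> / 7)\<close>; presenting its real part as a root of the minimal polynomial gives
  rational bounds without any evaluation of trigonometric functions.\<close>
definition \<omega> :: complex where "\<omega> = Complex heptic_re heptic_im"

lemma omega_power_7: "\<omega> ^ 7 = 1"
  and omega_neq_1: "\<omega> \<noteq> 1" and omega_cnj: "\<omega> * cnj \<omega> = 1"
proof -
  \<comment> \<open>\<open>t\<close> is \<open>\<omega> + 1/\<omega>\<close>, and its cubic is the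
    seventh cyclotomic polynomial at \<open>\<omega>\<close> divided by
    \<open>\<omega>^3\<close>.\<close>
  define t where "t = 2 * heptic_re"
  have t: "t ^ 3 + t\<^sup>2 - 2 * t - 1 = 0"
    using heptic_re_eq by (simp add: t_def power_mult_distrib)
  show 1: "\<omega> * cnj \<omega> = 1"
    using heptic_im_sq by (simp add: \<omega>_def complex_eq_iff power2_eq_square)
  have "\<omega> + cnj \<omega> = of_real t" by (simp add: \<omega>_def t_def complex_eq_iff)
  then have "\<omega>\<^sup>2 + 1 = of_real t * \<omega>" using 1 by (metis distrib_left mult.commute power2_eq_square)
  moreover have "(of_real t)^3 + (of_real t)\<^sup>2 - 2 * of_real t - 1 = (0::complex)"
    using t by (metis (no_types, lifting) of_real_1 of_real_add of_real_diff of_real_eq_0_iff of_real_mult of_real_numeral of_real_power)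
  ultimately show "\<omega> ^ 7 = 1" by algebra
  show "\<omega> \<noteq> 1" using heptic_re by (auto simp: \<omega>_def complex_eq_iff)
qed

definition chi :: "7 \<Rightarrow> complex" where "chi k = \<omega> ^ rep k"

lemma omega_power_mod: "\<omega> ^ (n mod 7) = \<omega> ^ n"
  by (metis mod_mult_div_eq omega_power_7 power_add power_mult power_one mult_1_right)

lemma chi_of_nat: "chi (of_nat n) = \<omega> ^ n"
  by (simp add: chi_def rep_of_nat omega_power_mod)

lemma chi_add: "chi (a + b) = chi a * chi b"
  by (metis chi_of_nat of_nat_add of_nat_rep power_add)

lemma chi_0 [simp]: "chi 0 = 1" by (simp add: chi_def)

lemma chi_cnj: "chi k * cnj (chi k) = 1"
  unfolding chi_def complex_cnj_power power_mult_distrib[symmetric] by (simp add: omega_cnj)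

lemma chi_neq_0 [simp]: "chi k \<noteq> 0" using chi_cnj[of k] by auto

lemma chi_minus: "chi (- k) = inverse (chi k)"
  by (metis add.right_inverse chi_0 chi_add inverse_unique)

lemma chi_diff: "chi (a - b) = chi a / chi b"
  by (metis chi_add chi_minus divide_inverse uminus_add_conv_diff add.commute)

lemma cnj_chi: "cnj (chi k) = chi (- k)"
  using chi_cnj[of k] by (metis chi_minus inverse_unique)

lemma norm_chi [simp]: "cmod (chi k) = 1"
  using chi_cnj[of k] by (metis complex_mod_mult_cnj norm_one power2_eq_1_iff norm_ge_zero abs_of_nonneg abs_minus_cancel)

lemma chi_power_7: "chi k ^ 7 = 1"
  unfolding chi_def by (metis mult.commute omega_power_7 power_mult power_one)

lemma chi_eq_1_iff: "chi k = 1 \<longleftrightarrow> k = 0"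
proof
  assume k: "chi k = 1"
  show "k = 0"
  proof (rule ccontr)
    assume "k \<noteq> 0"
    then obtain u where u: "u * k = 1" using unit_7 by blast
    have "chi (of_nat n * k) = 1" for n
      by (induction n) (simp_all add: chi_add distrib_right k)
    from this[of "rep u"] have "chi 1 = 1" by (simp add: u)
    then show False using chi_of_nat[of 1] omega_neq_1 by simp
  qed
qed simp

lemma chi_eq_iff: "chi a = chi b \<longleftrightarrow> a = b"
  using chi_eq_1_iff[of "a - b"] by (auto simp: chi_diff)

lemma sum_chi: "(\<Sum>m\<in>UNIV. chi (m * k)) = (if k = 0 then 7 else 0)"
proof (cases "k = 0")
  case False
  have "(\<Sum>m\<in>UNIV. chi (m * k)) = (\<Sum>m\<in>UNIV. chi ((m + 1) * k))"
    by (rule sum_shift[symmetric])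
  also have "\<dots> = chi k * (\<Sum>m\<in>UNIV. chi (m * k))"
    by (simp only: distrib_right chi_add sum_distrib_left mult_1_left mult.commute[of "chi k"])
  finally show ?thesis using False chi_eq_1_iff[of k] by auto
qed simp


text \<open>Orthogonality of the rows of the circulant matrix of \<open>x\<close>, with
  \<open>1 / x\<close> in place of the conjugate. The two agree up to a constant factor when all
  \<open>x k\<close> have the same modulus.\<close>

definition cyclic_root :: "(7 \<Rightarrow> complex) \<Rightarrow> bool" where
  "cyclic_root x \<longleftrightarrow> (\<forall>k. x k \<noteq> 0) \<and> (\<forall>d. d \<noteq> 0 \<longrightarrow> (\<Sum>k\<in>UNIV. x k / x (k - d)) = 0)"

text \<open>First-order deformations of the circulant matrix of \<open>x\<close> in the isotypic component of the
  character \<open>chi (m * _)\<close> of the simultaneous cyclic shifts of rows and columns.\<close>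
definition tangent :: "7 \<Rightarrow> (7 \<Rightarrow> complex) \<Rightarrow> (7 \<Rightarrow> complex) \<Rightarrow> bool" where
  "tangent m x g \<longleftrightarrow> (\<forall>d. (\<Sum>k\<in>UNIV. x k / x (k - d) * (g k - chi (m * d) * g (k - d))) = 0)"

text \<open>The functions \<open>\<alpha> + \<beta> * chi (m * k)\<close> are the components, for
  the character of \<open>m\<close>, of the trivial deformations \<open>a i + b k\<close>.\<close>

definition nondeg :: "7 \<Rightarrow> (7 \<Rightarrow> complex) \<Rightarrow> bool" where
  "nondeg m x \<longleftrightarrow> (\<forall>g. tangent m x g \<longrightarrow> (\<exists>\<alpha> \<beta>. \<forall>k. g k = \<alpha> + \<beta> * chi (m * k)))"

definition translate :: "7 \<Rightarrow> 7 \<Rightarrow> (7 \<Rightarrow> complex) \<Rightarrow> 7 \<Rightarrow> complex" where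
  "translate a b x = (\<lambda>k. chi (b * k) * x (k - a) / x (- a))"

section \<open>Symmetries of cyclic roots and of their tangent equations\<close>

lemma cyclic_root_nonzero: "cyclic_root x \<Longrightarrow> x k \<noteq> 0"
  by (simp add: cyclic_root_def)

lemma translate_ratio:
  assumes "\<And>k. x k \<noteq> 0"
  shows "translate a b x k / translate a b x (k - d) = chi (b * d) * (x (k - a) / x (k - a - d))"
  using assms by (simp add: translate_def chi_diff field_simps)

lemma cyclic_root_translate:
  assumes "cyclic_root x"
  shows "cyclic_root (translate a b x)"
  unfolding cyclic_root_def
proof (intro conjI allI impI)
  show "translate a b x k \<noteq> 0" for k
    using assms by (simp add: translate_def cyclic_root_def)
  fix d :: 7 assume d: "d \<noteq> 0"
  have "(\<Sum>k\<in>UNIV. translate a b x k / translate a b x (k - d))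
      = chi (b * d) * (\<Sum>k\<in>UNIV. x (k + - a) / x (k + - a - d))"
    using assms by (simp add: translate_ratio cyclic_root_def sum_distrib_left)
  also have "(\<Sum>k\<in>UNIV. x (k + - a) / x (k + - a - d)) = (\<Sum>k\<in>UNIV. x k / x (k - d))"
    by (rule sum_shift)
  finally show "(\<Sum>k\<in>UNIV. translate a b x k / translate a b x (k - d)) = 0"
    using assms d by (simp add: cyclic_root_def)
qed

lemma nondeg_translate:
  assumes x: "\<And>k. x k \<noteq> 0" and nd: "nondeg m x"
  shows "nondeg m (translate a b x)"
  unfolding nondeg_def
proof (intro allI impI)
  fix g assume g: "tangent m (translate a b x) g"
  have "tangent m x (\<lambda>k. g (k + a))"
    unfolding tangent_def
  proof
    fix d
    have "0 = (\<Sum>k\<in>UNIV. chi (b * d) * (x (k - a) / x (k - a - d)) * (g k - chi (m * d) * g (k - d)))"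
      using g by (simp add: tangent_def translate_ratio[OF x])
    also have "\<dots> = (\<Sum>k\<in>UNIV. chi (b * d) * (x (k + a - a) / x (k + a - a - d)) * (g (k + a) - chi (m * d) * g (k + a - d)))"
      by (rule sum_shift[symmetric])
    also have "\<dots> = chi (b * d) * (\<Sum>k\<in>UNIV. x k / x (k - d) * (g (k + a) - chi (m * d) * g (k - d + a)))"
      by (simp add: sum_distrib_left mult.assoc algebra_simps)
    finally show "(\<Sum>k\<in>UNIV. x k / x (k - d) * (g (k + a) - chi (m * d) * g (k - d + a))) = 0" by simp
  qed
  with nd obtain \<alpha> \<beta> where ab: "g (k + a) = \<alpha> + \<beta> * chi (m * k)" for k
    unfolding nondeg_def by blast
  have "g k = \<alpha> + \<beta> / chi (m * a) * chi (m * k)" for k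
    using ab[of "k - a"] by (simp add: chi_diff right_diff_distrib)
  then show "\<exists>\<alpha> \<beta>. \<forall>k. g k = \<alpha> + \<beta> * chi (m * k)" by blast
qed

lemma sum_unit: "(\<Sum>k\<in>UNIV. f (u * k)) = (\<Sum>k\<in>UNIV. f k)" if "v * u = (1::7)"
  using that by (intro sum.reindex_bij_witness[of _ "\<lambda>k. v * k" "\<lambda>k. u * k"])
    (auto simp: mult.assoc[symmetric] mult.commute[of u v])

lemma cyclic_root_unit:
  assumes "cyclic_root x" and u: "v * u = 1"
  shows "cyclic_root (\<lambda>k. x (u * k))"
  unfolding cyclic_root_def
proof (intro conjI allI impI)
  show "x (u * k) \<noteq> 0" for k using assms(1) by (simp add: cyclic_root_def)
  fix d :: 7 assume "d \<noteq> 0"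
  then have "u * d \<noteq> 0" using u by (metis mult.assoc mult_1 mult_zero_right)
  then show "(\<Sum>k\<in>UNIV. x (u * k) / x (u * (k - d))) = 0"
    using sum_unit[OF u, of "\<lambda>k. x k / x (k - u * d)"] assms(1)
    by (simp add: right_diff_distrib cyclic_root_def)
qed

text \<open>Multiplying indices by a unit permutes the characters. For a root invariant under
  \<open>u\<close> this makes nondegeneracy at one \<open>m\<close> imply it along the whole orbit
  of \<open>m\<close>.\<close>

lemma nondeg_unit:
  assumes nd: "nondeg (m * v) x" and u: "v * u = 1"
  shows "nondeg m (\<lambda>k. x (u * k))"
  unfolding nondeg_def
proof (intro allI impI)
  have u': "u * v = 1" using u by (simp add: mult.commute)
  have uv: "u * (v * k) = k" "v * (u * k) = k" for k
    using u u' by (simp_all flip: mult.assoc)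
  fix g assume g: "tangent m (\<lambda>k. x (u * k)) g"
  have "tangent (m * v) x (\<lambda>k. g (v * k))"
    unfolding tangent_def
  proof
    fix d
    have "(\<Sum>k\<in>UNIV. x k / x (k - d) * (g (v * k) - chi (m * v * d) * g (v * (k - d))))
        = (\<Sum>k\<in>UNIV. x (u * k) / x (u * k - d) * (g (v * (u * k)) - chi (m * v * d) * g (v * (u * k - d))))"
      by (rule sum_unit[OF u, symmetric])
    also have "\<dots> = (\<Sum>k\<in>UNIV. x (u * k) / x (u * (k - v * d)) * (g k - chi (m * (v * d)) * g (k - v * d)))"
      by (simp add: right_diff_distrib uv mult.assoc)
    also have "\<dots> = 0" using g by (simp add: tangent_def)
    finally show "(\<Sum>k\<in>UNIV. x k / x (k - d) * (g (v * k) - chi (m * v * d) * g (v * (k - d)))) = 0" .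
  qed
  with nd obtain \<alpha> \<beta> where ab: "g (v * k) = \<alpha> + \<beta> * chi (m * v * k)" for k
    unfolding nondeg_def by blast
  have "g k = \<alpha> + \<beta> * chi (m * k)" for k
    using ab[of "u * k"] by (simp add: uv mult.assoc)
  then show "\<exists>\<alpha> \<beta>. \<forall>k. g k = \<alpha> + \<beta> * chi (m * k)" by blast
qed

lemma cyclic_root_inverse:
  assumes "cyclic_root x"
  shows "cyclic_root (\<lambda>k. inverse (x k))"
  unfolding cyclic_root_def
proof (intro conjI allI impI)
  show "inverse (x k) \<noteq> 0" for k using assms(1) by (simp add: cyclic_root_def)
  fix d :: 7 assume d: "d \<noteq> 0"
  have "(\<Sum>k\<in>UNIV. inverse (x k) / inverse (x (k - d))) = (\<Sum>k\<in>UNIV. x (k + - d) / x (k + - d - - d))"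
    by (simp add: divide_inverse mult.commute)
  also have "\<dots> = (\<Sum>k\<in>UNIV. x k / x (k - - d))" by (rule sum_shift)
  also have "\<dots> = 0"
    using assms d spec[of "\<lambda>d. d \<noteq> 0 \<longrightarrow> (\<Sum>k\<in>UNIV. x k / x (k - d)) = 0" "- d"]
    by (simp add: cyclic_root_def)
  finally show "(\<Sum>k\<in>UNIV. inverse (x k) / inverse (x (k - d))) = 0" .
qed

text \<open>The equation of \<open>x\<close> at \<open>d\<close> is \<open>- chi (m * d)\<close>
  times the equation of \<open>1 / x\<close> at \<open>- d\<close>, with the same
  \<open>g\<close>.\<close>

lemma nondeg_inverse:
  assumes x: "\<And>k. x k \<noteq> 0" and nd: "nondeg m x"
  shows "nondeg m (\<lambda>k. inverse (x k))"
  unfolding nondeg_def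
proof (intro allI impI)
  fix g assume g: "tangent m (\<lambda>k. inverse (x k)) g"
  have "tangent m x g"
    unfolding tangent_def
  proof
    fix d
    have "(\<Sum>k\<in>UNIV. x k / x (k - d) * (g k - chi (m * d) * g (k - d)))
      = (\<Sum>k\<in>UNIV. x (k + d) / x (k + d - d) * (g (k + d) - chi (m * d) * g (k + d - d)))"
      by (rule sum_shift[symmetric])
    also have "\<dots> = - chi (m * d) * (\<Sum>k\<in>UNIV. inverse (x k) / inverse (x (k - - d)) * (g k - chi (m * (- d)) * g (k - - d)))"
    proof -
      have "X / z * (G - c * h) = - c * (inverse z / inverse X * (h - inverse c * G))" if "c \<noteq> 0" for X z G c h :: complex
        using that by (simp add: divide_inverse algebra_simps)
      then show ?thesis
        unfolding sum_distrib_left by (intro sum.cong refl) (simp only: chi_minus mult_minus_right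
          minus_minus diff_minus_eq_add add_diff_cancel_right' chi_neq_0 not_False_eq_True)
    qed
    also have "\<dots> = 0" using g unfolding tangent_def by (simp only: mult_zero_right)
    finally show "(\<Sum>k\<in>UNIV. x k / x (k - d) * (g k - chi (m * d) * g (k - d))) = 0" .
  qed
  with nd show "\<exists>\<alpha> \<beta>. \<forall>k. g k = \<alpha> + \<beta> * chi (m * k)"
    unfolding nondeg_def by blast
qed

section \<open>A bound on the number of cyclic roots\<close>

lemma inverse_ratio_sum:
  "(\<Sum>j\<in>UNIV. x (j + d) * inverse (x j)) = (\<Sum>k\<in>UNIV. x k / x (k - d))" for x :: "7 \<Rightarrow> complex"
  using sum_shift[of "\<lambda>k. x k / x (k - d)" d] by (simp add: divide_inverse)

text \<open>A cyclic root \<open>x\<close> and \<open>u = 1/x\<close> solve the bilinear system \<open>x k * u k = 1\<close>,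
  \<open>\<Sum>k. x k * u (k - d) = 0\<close>. The matrix collects the divided differences of these equations between
  \<open>(x, u)\<close> and a second pair \<open>(y, v)\<close>, in the order \<open>B(x, u) - B(y, v) = B(x - y, u) + B(y, u - v)\<close>,
  so that only \<open>u\<close> and \<open>y\<close> enter. The two rows indexed by 0 express the normalisation at 0.\<close>
definition bezout_matrix :: "(7 \<Rightarrow> complex) \<Rightarrow> (7 \<Rightarrow> complex) \<Rightarrow> complex^(7 + 7)^(7 + 7)" where
  "bezout_matrix u y = (\<chi> r c. case r of
       Inl k \<Rightarrow> (case c of
           Inl j \<Rightarrow> (if j = k then (if k = 0 then 1 else u k) else 0)
         | Inr j \<Rightarrow> (if j = k \<and> k \<noteq> 0 then y k else 0))
     | Inr d \<Rightarrow> (case c of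
           Inl j \<Rightarrow> (if d = 0 then 0 else u (j - d))
         | Inr j \<Rightarrow> (if d = 0 then (if j = 0 then 1 else 0) else y (j + d))))"

lemma sum_UNIV_Plus:
  "(\<Sum>c\<in>UNIV. f c) = (\<Sum>j\<in>UNIV. f (Inl j)) + (\<Sum>j\<in>UNIV. f (Inr j))"
  for f :: "'a::finite + 'b::finite \<Rightarrow> 'c::comm_monoid_add"
  unfolding UNIV_Plus_UNIV[symmetric, where 'a='a and 'b='b] by (subst sum.Plus) simp_all

lemma bezout_matrix_mult_Inl:
  "(bezout_matrix u y *v w) $ Inl k =
     (if k = 0 then w $ Inl 0 else u k * w $ Inl k + y k * w $ Inr k)"
proof -
  have *: "(if P then a else 0) * b = (if P then a * b else 0)" for P and a b :: complex by simp
  show ?thesis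
    by (cases "k = 0") (simp_all add: bezout_matrix_def matrix_vector_mult_def sum_UNIV_Plus *)
qed

lemma bezout_matrix_mult_Inr:
  "(bezout_matrix u y *v w) $ Inr d =
     (if d = 0 then w $ Inr 0 else (\<Sum>j\<in>UNIV. u (j - d) * w $ Inl j + y (j + d) * w $ Inr j))"
proof -
  have *: "(if P then a else 0) * b = (if P then a * b else 0)" for P and a b :: complex by simp
  show ?thesis
    by (cases "d = 0") (simp_all add: bezout_matrix_def matrix_vector_mult_def sum_UNIV_Plus sum.distrib *)
qed

text \<open>The difference of the solutions \<open>(x, 1/x)\<close> and \<open>(y, 1/y)\<close> of
  the bilinear system is a nonzero kernel vector.\<close>

lemma det_bezout_distinct:
  assumes x: "cyclic_root x" "x 0 = 1" and y: "cyclic_root y" "y 0 = 1" and "x \<noteq> y"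
  shows "det (bezout_matrix (\<lambda>k. inverse (x k)) y) = 0"
proof (rule ccontr)
  define u v where "u = (\<lambda>k. inverse (x k))" and "v = (\<lambda>k. inverse (y k))"
  have x0: "x k \<noteq> 0" and y0: "y k \<noteq> 0" for k using x y by (auto simp: cyclic_root_def)
  assume "det (bezout_matrix (\<lambda>k. inverse (x k)) y) \<noteq> 0"
  then obtain B where B: "B ** bezout_matrix u y = mat 1"
    using invertible_det_nz invertible_left_inverse u_def by blast
  define w :: "complex^(7+7)" where
    "w = (\<chi> c. case c of Inl j \<Rightarrow> x j - y j | Inr j \<Rightarrow> u j - v j)"
  have "(bezout_matrix u y *v w) $ r = 0" for r
  proof (cases r)
    case (Inl k)
    then show ?thesis using x0[of k] y0[of k] x y
      by (simp add: bezout_matrix_mult_Inl w_def u_def v_def field_simps)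
  next
    case (Inr d)
    show ?thesis
    proof (cases "d = 0")
      case True
      then show ?thesis using Inr x y by (simp add: bezout_matrix_mult_Inr w_def u_def v_def)
    next
      case False
      \<comment> \<open>The mixed terms of \<open>u\<close> and \<open>y\<close> from the two halves
        of the row cancel after a shift; what remains are the equations of \<open>x\<close> and of
        \<open>y\<close>.\<close>
      have s: "(\<Sum>j\<in>UNIV. u (j - d) * y j) = (\<Sum>j\<in>UNIV. y (j + d) * u j)"
        using sum_shift[of "\<lambda>j. u (j - d) * y j" d] by (simp add: mult.commute)
      have "(\<Sum>j\<in>UNIV. u (j - d) * x j) = 0" "(\<Sum>j\<in>UNIV. y (j + d) * v j) = 0"
        using x(1) y(1) False unfolding v_def inverse_ratio_sum
        by (simp_all add: u_def cyclic_root_def divide_inverse mult.commute)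
      with False Inr s show ?thesis
        by (simp add: bezout_matrix_mult_Inr w_def sum_subtractf sum.distrib right_diff_distrib)
    qed
  qed
  then have "bezout_matrix u y *v w = 0" by (simp add: vec_eq_iff)
  then have "w = 0" by (metis B matrix_vector_mul_assoc matrix_vector_mul_lid matrix_vector_mult_0_right)
  then have "w $ Inl k = 0" for k by simp
  then have "x k = y k" for k unfolding w_def by simp
  with \<open>x \<noteq> y\<close> show False by blast
qed

text \<open>The rows \<open>Inl k\<close> force a kernel vector into the logarithmic form
  \<open>(x g, - g / x)\<close>, and the rows \<open>Inr d\<close> then say that \<open>g\<close> is
  tangent for the trivial character. So \<open>g\<close> is constant, and the normalisation rows
  make it zero.\<close>

lemma det_bezout_same:
  assumes x: "cyclic_root x" and nd: "nondeg 0 x"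
  shows "det (bezout_matrix (\<lambda>k. inverse (x k)) x) \<noteq> 0"
proof -
  define u where "u = (\<lambda>k. inverse (x k))"
  have x0: "x k \<noteq> 0" for k using x by (auto simp: cyclic_root_def)
  have "w = 0" if w: "bezout_matrix u x *v w = 0" for w
  proof -
    define g where "g = (\<lambda>k. w $ Inl k / x k)"
    have w0: "w $ Inl 0 = 0" "w $ Inr 0 = 0"
      using bezout_matrix_mult_Inl[of u x w 0] bezout_matrix_mult_Inr[of u x w 0] by (simp_all add: w)
    have l: "w $ Inl k = x k * g k" for k using x0 by (simp add: g_def)
    have r: "w $ Inr k = - u k * g k" for k
    proof (cases "k = 0")
      case False
      then have "u k * w $ Inl k + x k * w $ Inr k = 0"
        using bezout_matrix_mult_Inl[of u x w k] by (simp add: w)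
      then show ?thesis using x0[of k] by (simp add: l u_def field_simps add_eq_0_iff)
    qed (simp add: w0 g_def)
    have "tangent 0 x g"
      unfolding tangent_def
    proof
      fix d :: 7
      show "(\<Sum>k\<in>UNIV. x k / x (k - d) * (g k - chi (0 * d) * g (k - d))) = 0"
      proof (cases "d = 0")
        case False
        then have "0 = (\<Sum>j\<in>UNIV. u (j - d) * w $ Inl j) + (\<Sum>j\<in>UNIV. x (j + d) * w $ Inr j)"
          using bezout_matrix_mult_Inr[of u x w d] by (simp add: w sum.distrib)
        also have "(\<Sum>j\<in>UNIV. x (j + d) * w $ Inr j) = (\<Sum>j\<in>UNIV. x j * w $ Inr (j - d))"
          using sum_shift[of "\<lambda>j. x j * w $ Inr (j - d)" d] by simp
        finally show ?thesis
          by (simp add: l r u_def sum.distrib[symmetric] sum_subtractf[symmetric] divide_inverse algebra_simps sum_negf)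
      qed simp
    qed
    then obtain \<alpha> where "g k = \<alpha>" for k
      using nd unfolding nondeg_def by fastforce
    moreover have "g 0 = 0" by (simp add: g_def w0)
    ultimately have "g k = 0" for k by metis
    then have "w $ r = 0" for r by (cases r) (simp_all add: l r)
    then show ?thesis by (simp add: vec_eq_iff)
  qed
  then have "invertible (bezout_matrix u x)"
    unfolding invertible_left_inverse by (simp add: matrix_left_invertible_ker)
  then show ?thesis by (simp add: invertible_det_nz u_def)
qed

section \<open>The Bezoutian as a form of degree six, and the count\<close>

definition monomial :: "7 multiset \<Rightarrow> (7 \<Rightarrow> complex) \<Rightarrow> complex" where
  "monomial A y = prod_mset (image_mset y A)"

lemma sum_fun_apply: "(\<Sum>i\<in>A. F i) y = (\<Sum>i\<in>A. F i y)" for F :: "'i \<Rightarrow> 'a \<Rightarrow> complex"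
  by (induction A rule: infinite_finite_induct) auto

interpretation fun_vs: vector_space "\<lambda>c (f :: 'a \<Rightarrow> complex) y. c * f y"
  by unfold_locales (auto simp: fun_eq_iff algebra_simps)

text \<open>Only the seven columns \<open>Inr j\<close> contain \<open>y\<close>, and their entries
  are zero or single values of \<open>y\<close>, except in row \<open>Inr 0\<close>. That row is a
  unit vector, so a permutation with nonzero product sends \<open>Inr 0\<close> to itself and takes
  exactly six factors from \<open>y\<close>. The normalisation thus lowers the degree from 7 to
  6.\<close>

lemma det_bezout_in_span:
  "(\<lambda>y. det (bezout_matrix u y)) \<in> fun_vs.span (monomial ` multisets_of_size UNIV 6)"
proof -
  have summand: "(\<lambda>y. of_int (sign p) * (\<Prod>r\<in>UNIV. bezout_matrix u y $ r $ p r))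
      \<in> fun_vs.span (monomial ` multisets_of_size UNIV 6)"
    if p: "p permutes UNIV" for p
  proof (cases "p (Inr 0) = Inr 0")
    case False
    have "(\<Prod>r\<in>UNIV. bezout_matrix u y $ r $ p r) = 0" for y
    proof (rule prod_zero)
      show "\<exists>r\<in>UNIV. bezout_matrix u y $ r $ p r = 0"
        using False by (intro bexI[of _ "Inr 0"]) (auto simp: bezout_matrix_def split: sum.split)
    qed simp
    then have "(\<lambda>y. of_int (sign p) * (\<Prod>r\<in>UNIV. bezout_matrix u y $ r $ p r)) = 0"
      by (simp only: mult_zero_right zero_fun_def)
    then show ?thesis using fun_vs.span_zero by metis
  next
    case p0: True
    define R where "R = p -` range Inr - {Inr 0}"
    have cR: "card R = 6"
    proof -
      have bij: "bij p" using p by (rule permutes_bij)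
      have "card (p -` range Inr) = card (range (Inr :: 7 \<Rightarrow> 7 + 7))"
        using bij by (intro card_vimage_inj) (auto simp: bij_def)
      also have "\<dots> = 7" by (subst card_image) auto
      finally show ?thesis using p0 by (simp add: R_def)
    qed
    define idx where "idx = (\<lambda>r. case r of Inl k \<Rightarrow> k | Inr d \<Rightarrow> (case p r of Inl j \<Rightarrow> 0 | Inr j \<Rightarrow> j + d))"
    have ent: "\<exists>c. \<forall>y. bezout_matrix u y $ r $ p r = c * (if r \<in> R then y (idx r) else 1)" for r
    proof (cases "p r")
      case (Inl j)
      then have "r \<notin> R" by (auto simp: R_def)
      then show ?thesis using Inl by (cases r) (auto simp: bezout_matrix_def)
    next
      case (Inr j)
      show ?thesis
      proof (cases "r = Inr 0")
        case True
        then show ?thesis using p0 by (auto simp: R_def bezout_matrix_def)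
      next
        case False
        then have "r \<in> R" using Inr by (simp add: R_def)
        then show ?thesis using False Inr
          by (cases r) (auto simp: bezout_matrix_def idx_def intro: exI[of _ 0] exI[of _ 1])
      qed
    qed
    then obtain c where c: "bezout_matrix u y $ r $ p r = c r * (if r \<in> R then y (idx r) else 1)" for r y
      by metis
    define A where "A = image_mset idx (mset_set R)"
    have "A \<in> multisets_of_size UNIV 6" by (simp add: A_def multisets_of_size_def cR)
    moreover have "(\<Prod>r\<in>UNIV. bezout_matrix u y $ r $ p r) = (\<Prod>r\<in>UNIV. c r) * monomial A y" for y
    proof -
      have "(\<Prod>r\<in>UNIV. if r \<in> R then y (idx r) else 1) = (\<Prod>r\<in>R. y (idx r))"
        by (simp add: prod.If_cases)
      then show ?thesis
        by (simp add: c prod.distrib monomial_def A_def prod_unfold_prod_mset image_mset.compositionality o_def)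
    qed
    ultimately have m: "monomial A \<in> monomial ` multisets_of_size UNIV 6"
      and e: "\<And>y. (\<Prod>r\<in>UNIV. bezout_matrix u y $ r $ p r) = (\<Prod>r\<in>UNIV. c r) * monomial A y"
      by blast+
    show ?thesis
      unfolding e mult.assoc[symmetric]
      by (rule fun_vs.span_scale[OF fun_vs.span_base[OF m]])
  qed
  have "(\<lambda>y. det (bezout_matrix u y))
      = (\<Sum>p\<in>{p. p permutes UNIV}. (\<lambda>y. of_int (sign p) * (\<Prod>r\<in>UNIV. bezout_matrix u y $ r $ p r)))"
    by (rule ext) (simp only: det_def sum_fun_apply)
  also have "\<dots> \<in> fun_vs.span (monomial ` multisets_of_size UNIV 6)"
    by (rule fun_vs.span_sum) (use summand in simp)
  finally show ?thesis .
qed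

text \<open>The functions \<open>y \<mapsto> det (bezout_matrix (1/x) y)\<close>, for \<open>x \<in> K\<close>, are dual to the points of \<open>K\<close> up to
  nonzero factors and vanish at every further root; the form \<open>(y 0)^6\<close> does not. So a further root would give
  925 independent vectors in a space of dimension \<open>(12 choose 6) = 924\<close>.\<close>
theorem cyclic_roots_complete:
  assumes K: "finite K" "card K \<ge> 924"
    and root: "\<And>x. x \<in> K \<Longrightarrow> cyclic_root x" and norm: "\<And>x. x \<in> K \<Longrightarrow> x 0 = 1"
    and nd: "\<And>x. x \<in> K \<Longrightarrow> nondeg 0 x"
    and z: "cyclic_root z" "z 0 = 1"
  shows "z \<in> K"
proof (rule ccontr)
  assume zK: "z \<notin> K"
  define \<phi> where "\<phi> = (\<lambda>x y. det (bezout_matrix (\<lambda>k. inverse (x k :: complex)) y))"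
  define \<psi> where "\<psi> = monomial (replicate_mset 6 0)"
  define S where "S = monomial ` multisets_of_size UNIV 6"
  have \<psi>1: "\<psi> y = 1" if "y 0 = 1" for y using that by (simp add: \<psi>_def monomial_def)
  have off: "\<phi> x y = 0" if "x \<in> K" "cyclic_root y" "y 0 = 1" "x \<noteq> y" for x y
    unfolding \<phi>_def using det_bezout_distinct root norm that by blast
  have diag: "\<phi> x x \<noteq> 0" if "x \<in> K" for x
    unfolding \<phi>_def using det_bezout_same root nd that by blast
  have inj: "inj_on \<phi> K"
    by (intro inj_onI) (metis diag off root norm)
  have \<psi>K: "\<psi> \<notin> \<phi> ` K"
    using off[of _ z] z zK \<psi>1[of z] by (metis image_iff zero_neq_one)
  have indep: "fun_vs.independent (insert \<psi> (\<phi> ` K))"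
  proof
    assume "fun_vs.dependent (insert \<psi> (\<phi> ` K))"
    then have "\<exists>A c. finite A \<and> A \<subseteq> insert \<psi> (\<phi> ` K) \<and> (\<Sum>f\<in>A. (\<lambda>y. c f * f y)) = 0 \<and> (\<exists>f\<in>A. c f \<noteq> 0)"
      by (simp only: fun_vs.dependent_explicit)
    then obtain A c where A': "finite A \<and> A \<subseteq> insert \<psi> (\<phi> ` K) \<and> (\<Sum>f\<in>A. (\<lambda>y. c f * f y)) = 0 \<and> (\<exists>f\<in>A. c f \<noteq> 0)"
      by (elim exE)
    then have A: "A \<subseteq> insert \<psi> (\<phi> ` K)" "finite A" and s: "(\<Sum>f\<in>A. (\<lambda>y. c f * f y)) = 0"
      by simp_all
    obtain f where f: "f \<in> A" and cf: "c f \<noteq> 0" using A' by (elim conjE bexE)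
    have s': "(\<Sum>f\<in>A. c f * f y) = 0" for y
      using fun_cong[OF s, of y] by (simp add: sum_fun_apply)
    \<comment> \<open>Evaluation at \<open>z\<close> kills every \<open>\<phi> x\<close> and
      isolates the coefficient of \<open>\<psi>\<close>; only then does evaluation at a point of
      \<open>K\<close> isolate the coefficient of the corresponding \<open>\<phi> x\<close>.\<close>
    have c\<psi>: "c \<psi> = 0" if "\<psi> \<in> A"
    proof -
      have "0 = (\<Sum>f\<in>A. c f * f z)" using s' by simp
      also have "\<dots> = c \<psi> * \<psi> z + (\<Sum>f\<in>A - {\<psi>}. c f * f z)"
        by (rule sum.remove) (use A that in auto)
      also have "(\<Sum>f\<in>A - {\<psi>}. c f * f z) = 0"
      proof (rule sum.neutral, intro ballI)
        fix f assume "f \<in> A - {\<psi>}"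
        then obtain x where "x \<in> K" "f = \<phi> x" using A by blast
        then show "c f * f z = 0" using off[of x z] z zK by auto
      qed
      finally show ?thesis using \<psi>1 z by simp
    qed
    show False
    proof (cases "f = \<psi>")
      case False
      with f A obtain x where x: "x \<in> K" "f = \<phi> x" by blast
      have "0 = (\<Sum>f\<in>A. c f * f x)" using s' by simp
      also have "\<dots> = c f * f x + (\<Sum>h\<in>A - {f}. c h * h x)"
        by (rule sum.remove) (use A f in auto)
      also have "(\<Sum>h\<in>A - {f}. c h * h x) = 0"
      proof (rule sum.neutral, intro ballI)
        fix h assume h: "h \<in> A - {f}"
        show "c h * h x = 0"
        proof (cases "h = \<psi>")
          case True then show ?thesis using c\<psi> h by simp
        next
          case False
          with h A obtain x' where "x' \<in> K" "h = \<phi> x'" by blast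
          then show ?thesis using h x off[of x' x] root norm by auto
        qed
      qed
      finally show ?thesis using diag x cf by simp
    next
      case True
      then show ?thesis using f c\<psi> cf by metis
    qed
  qed
  have finS: "finite S" unfolding S_def by (intro finite_imageI finite_multisets_of_size) simp
  have "\<psi> \<in> S" by (auto simp: S_def \<psi>_def multisets_of_size_def)
  then have "insert \<psi> (\<phi> ` K) \<subseteq> fun_vs.span S"
    using det_bezout_in_span unfolding \<phi>_def S_def by (auto intro: fun_vs.span_base)
  then have "card (insert \<psi> (\<phi> ` K)) \<le> card S"
    using fun_vs.independent_span_bound[OF finS indep] by blast
  also have "card (insert \<psi> (\<phi> ` K)) = Suc (card K)"
    using \<psi>K K(1) inj by (simp add: card_image)
  also have "card S \<le> card (multisets_of_size (UNIV :: 7 set) 6)"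
    unfolding S_def by (intro card_image_le) auto
  also have "\<dots> = 12 choose 6" by (subst card_multisets_of_size) auto
  also have "12 choose 6 = (924::nat)" by (simp add: numeral_eq_Suc)
  finally show False using K(2) by simp
qed

section \<open>Circulant matrices\<close>

text \<open>The equations are invariant under simultaneous shifts of rows and columns, so the
  Fourier transform along the shifted diagonals \<open>\<delta> i (i + l)\<close> decouples them
  into the tangent equations. Transforming back turns \<open>\<alpha> m\<close> and
  \<open>\<beta> m * chi (m * l)\<close> into a function of the row and a function of the
  column.\<close>

lemma circulant_rigid:
  fixes U :: "complex^7^7"
  assumes U: "\<And>i j. U $ i $ j = s (j - i)"
    and cnj: "\<And>k. cnj (s k) = c / s k" and c: "c \<noteq> 0" and nd: "\<And>m. nondeg m s"
  shows "infinitesimally_rigid U"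
  unfolding infinitesimally_rigid_def
proof (intro allI impI)
  fix \<delta> :: "7 \<Rightarrow> 7 \<Rightarrow> complex"
  assume \<delta>: "\<forall>i j. (\<Sum>k\<in>UNIV. U $ i $ k * cnj (U $ j $ k) * (\<delta> i k - \<delta> j k)) = 0"
  define g where "g = (\<lambda>m l. \<Sum>i\<in>UNIV. chi (- (m * i)) * \<delta> i (i + l))"
  have row: "(\<Sum>l\<in>UNIV. s l / s (l - d) * (\<delta> i (i + l) - \<delta> (i + d) (i + l))) = 0" for i d
  proof -
    have "0 = (\<Sum>k\<in>UNIV. U $ i $ k * cnj (U $ (i + d) $ k) * (\<delta> i k - \<delta> (i + d) k))"
      using \<delta> by simp
    also have "\<dots> = (\<Sum>l\<in>UNIV. U $ i $ (l + i) * cnj (U $ (i + d) $ (l + i)) * (\<delta> i (l + i) - \<delta> (i + d) (l + i)))"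
      by (rule sum_shift[symmetric])
    also have "\<dots> = c * (\<Sum>l\<in>UNIV. s l / s (l - d) * (\<delta> i (i + l) - \<delta> (i + d) (i + l)))"
      unfolding sum_distrib_left
      by (intro sum.cong refl) (simp add: U cnj add.commute[of i])
    finally show ?thesis using c by simp
  qed
  have "tangent m s (g m)" for m
    unfolding tangent_def
  proof
    fix d
    have sh: "(\<Sum>i\<in>UNIV. chi (- (m * i)) * \<delta> (i + d) (i + l)) = chi (m * d) * g m (l - d)" for l
    proof -
      have "chi (m * d) * g m (l - d) = (\<Sum>i\<in>UNIV. chi (m * d) * (chi (- (m * i)) * \<delta> i (i + (l - d))))"
        by (simp add: g_def sum_distrib_left)
      also have "\<dots> = (\<Sum>i\<in>UNIV. chi (m * d) * (chi (- (m * (i + d))) * \<delta> (i + d) (i + d + (l - d))))"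
        by (rule sum_shift[symmetric])
      also have "\<dots> = (\<Sum>i\<in>UNIV. chi (- (m * i)) * \<delta> (i + d) (i + l))"
      proof (intro sum.cong refl)
        fix i
        have "chi (m * d) * chi (- (m * (i + d))) = chi (- (m * i))"
          by (simp add: chi_add[symmetric] algebra_simps)
        then show "chi (m * d) * (chi (- (m * (i + d))) * \<delta> (i + d) (i + d + (l - d))) =
          chi (- (m * i)) * \<delta> (i + d) (i + l)"
          by (simp only: mult.assoc[symmetric]) (simp add: algebra_simps)
      qed
      finally show ?thesis by simp
    qed
    have "0 = (\<Sum>i\<in>UNIV. chi (- (m * i)) * (\<Sum>l\<in>UNIV. s l / s (l - d) * (\<delta> i (i + l) - \<delta> (i + d) (i + l))))"
      by (simp only: row mult_zero_right sum.neutral_const)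
    also have "\<dots> = (\<Sum>l\<in>UNIV. \<Sum>i\<in>UNIV. s l / s (l - d) * (chi (- (m * i)) * \<delta> i (i + l) - chi (- (m * i)) * \<delta> (i + d) (i + l)))"
      unfolding sum_distrib_left by (subst sum.swap) (simp add: algebra_simps)
    also have "\<dots> = (\<Sum>l\<in>UNIV. s l / s (l - d) * (g m l - chi (m * d) * g m (l - d)))"
      by (simp only: sum_distrib_left[symmetric] sum_subtractf sh) (simp add: g_def)
    finally show "(\<Sum>l\<in>UNIV. s l / s (l - d) * (g m l - chi (m * d) * g m (l - d))) = 0" by simp
  qed
  then have "\<forall>m. \<exists>\<alpha> \<beta>. \<forall>l. g m l = \<alpha> + \<beta> * chi (m * l)"
    using nd unfolding nondeg_def by blast
  then obtain \<alpha> \<beta> where ab: "\<And>m l. g m l = \<alpha> m + \<beta> m * chi (m * l)" by metis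
  define a where "a = (\<lambda>i. (\<Sum>m\<in>UNIV. \<alpha> m * chi (m * i)) / 7)"
  define b where "b = (\<lambda>i. (\<Sum>m\<in>UNIV. \<beta> m * chi (m * i)) / 7)"
  have "\<delta> i k = a i + b k" for i k
  proof -
    define l where "l = k - i"
    have "(\<Sum>m\<in>UNIV. chi (m * i) * g m l) = (\<Sum>j\<in>UNIV. \<Sum>m\<in>UNIV. chi (m * (i - j)) * \<delta> j (j + l))"
      unfolding g_def sum_distrib_left
      by (subst sum.swap) (simp add: right_diff_distrib chi_diff chi_minus divide_inverse mult.assoc)
    also have "\<dots> = (\<Sum>j\<in>UNIV. if i - j = 0 then 7 * \<delta> j (j + l) else 0)"
      unfolding sum_distrib_right[symmetric] sum_chi by (intro sum.cong refl) simp
    also have "\<dots> = 7 * \<delta> i (i + l)" by simp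
    finally have "7 * \<delta> i k = (\<Sum>m\<in>UNIV. chi (m * i) * (\<alpha> m + \<beta> m * chi (m * l)))"
      by (simp add: ab l_def)
    also have "\<dots> = (\<Sum>m\<in>UNIV. \<alpha> m * chi (m * i) + \<beta> m * chi (m * k))"
    proof (intro sum.cong refl)
      fix m
      have "chi (m * i) * chi (m * l) = chi (m * k)"
        by (simp add: chi_add[symmetric] l_def algebra_simps)
      then have "\<beta> m * (chi (m * i) * chi (m * l)) = \<beta> m * chi (m * k)" by simp
      then show "chi (m * i) * (\<alpha> m + \<beta> m * chi (m * l)) = \<alpha> m * chi (m * i) + \<beta> m * chi (m * k)"
        by (simp add: algebra_simps)
    qed
    finally show ?thesis by (simp add: a_def b_def sum.distrib field_simps)
  qed
  then show "\<exists>a b. \<forall>i k. \<delta> i k = a i + b k" by blast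
qed

lemma circulant_biunitary_cyclic_root:
  fixes U :: "complex^7^7"
  assumes bi: "biunitary U" and U: "\<And>i j. U $ i $ j = s (j - i)"
  shows "cyclic_root s" "\<And>k. cnj (s k) = (1 / 7) / s k"
proof -
  have s0: "s k \<noteq> 0" for k using biunitary_nonzero[OF bi, of 0 k] by (simp add: U)
  show cnj: "cnj (s k) = (1 / 7) / s k" for k
    using biunitary_mult_cnj[OF bi, of 0 k] s0[of k] by (simp add: U field_simps)
  have "(\<Sum>k\<in>UNIV. s k / s (k - d)) = 0" if "d \<noteq> 0" for d
  proof -
    have "(1 / 7) * (\<Sum>k\<in>UNIV. s k / s (k - d)) = (\<Sum>k\<in>UNIV. U $ 0 $ k * cnj (U $ d $ k))"
      unfolding sum_distrib_left by (simp add: U cnj)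
    then show ?thesis using biunitary_rows[OF bi, of 0 d] that by simp
  qed
  then show "cyclic_root s" using s0 by (simp add: cyclic_root_def)
qed

section \<open>Approximate inverses\<close>

definition seq :: "complex list \<Rightarrow> 7 \<Rightarrow> complex" where
  "seq xs k = xs ! rep k"

lemma seq_simps [simp]:
  "seq [a0,a1,a2,a3,a4,a5,a6] 0 = a0" "seq [a0,a1,a2,a3,a4,a5,a6] 1 = a1"
  "seq [a0,a1,a2,a3,a4,a5,a6] 2 = a2" "seq [a0,a1,a2,a3,a4,a5,a6] 3 = a3"
  "seq [a0,a1,a2,a3,a4,a5,a6] 4 = a4" "seq [a0,a1,a2,a3,a4,a5,a6] 5 = a5"
  "seq [a0,a1,a2,a3,a4,a5,a6] 6 = a6"
  by (simp_all add: seq_def)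

text \<open>By \<open>dom\<close>, the matrix \<open>1 - A\<close> contracts the maximum norm on
  \<open>J\<close>, while it fixes every kernel vector of \<open>A\<close>.\<close>

lemma diagonal_dominance:
  fixes A :: "'n::finite \<Rightarrow> 'n \<Rightarrow> complex"
  assumes dom: "\<And>j. j \<in> J \<Longrightarrow> (\<Sum>k\<in>J. cmod ((if k = j then 1 else 0) - A j k)) < 1"
    and ker: "\<And>j. j \<in> J \<Longrightarrow> (\<Sum>k\<in>J. A j k * g k) = 0" and "j \<in> J"
  shows "g j = 0"
proof -
  define M where "M = Max ((\<lambda>j. cmod (g j)) ` J)"
  have fin: "finite J" by simp
  have le: "cmod (g k) \<le> M" if "k \<in> J" for k unfolding M_def using that fin by simp
  have "M \<in> (\<lambda>j. cmod (g j)) ` J" unfolding M_def using \<open>j \<in> J\<close> fin by (intro Max_in) auto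
  then obtain i where i: "i \<in> J" "M = cmod (g i)" by blast
  have "M = 0"
  proof (rule ccontr)
    assume "M \<noteq> 0"
    then have M: "M > 0" using i by auto
    have "g i = (\<Sum>k\<in>J. (if k = i then g k else 0)) - (\<Sum>k\<in>J. A i k * g k)"
      using i ker fin by simp
    also have "\<dots> = (\<Sum>k\<in>J. ((if k = i then 1 else 0) - A i k) * g k)"
      by (simp only: sum_subtractf[symmetric]) (intro sum.cong refl, simp add: left_diff_distrib)
    finally have "M = cmod (\<Sum>k\<in>J. ((if k = i then 1 else 0) - A i k) * g k)" using i by simp
    also have "\<dots> \<le> (\<Sum>k\<in>J. cmod ((if k = i then 1 else 0) - A i k) * M)"
      by (intro order_trans[OF norm_sum] sum_mono) (use le M in \<open>auto simp: norm_mult intro!: mult_left_mono\<close>)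
    also have "\<dots> < M" using dom[OF i(1)] M by (simp add: sum_distrib_right[symmetric])
    finally show False by simp
  qed
  then show ?thesis using le[OF \<open>j \<in> J\<close>] by simp
qed

definition tangent_matrix :: "7 \<Rightarrow> (7 \<Rightarrow> complex) \<Rightarrow> 7 \<Rightarrow> 7 \<Rightarrow> complex" where
  "tangent_matrix m x d k = x k / x (k - d) - chi (m * d) * (x (k + d) / x k)"

lemma tangent_sum:
  "(\<Sum>k\<in>UNIV. x k / x (k - d) * (g k - chi (m * d) * g (k - d))) = (\<Sum>k\<in>UNIV. tangent_matrix m x d k * g k)"
proof -
  have "(\<Sum>k\<in>UNIV. x k / x (k - d) * (g k - chi (m * d) * g (k - d)))
     = (\<Sum>k\<in>UNIV. x k / x (k - d) * g k) - (\<Sum>k\<in>UNIV. x k / x (k - d) * chi (m * d) * g (k - d))"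
    by (simp add: sum_subtractf[symmetric] right_diff_distrib mult.assoc)
  also have "(\<Sum>k\<in>UNIV. x k / x (k - d) * chi (m * d) * g (k - d))
     = (\<Sum>k\<in>UNIV. x (k + d) / x (k + d - d) * chi (m * d) * g (k + d - d))"
    by (rule sum_shift[symmetric])
  finally show ?thesis
    by (simp add: tangent_matrix_def sum_subtractf[symmetric] left_diff_distrib right_diff_distrib mult_ac)
qed

definition free_cols :: "7 \<Rightarrow> 7 set" where
  "free_cols m = (if m = 0 then UNIV - {0} else UNIV - {0, 1})"

text \<open>Constants and \<open>chi (m * _)\<close> are always tangent, so \<open>g\<close> may be normalised to vanish at 0, and at 1
  if \<open>m \<noteq> 0\<close>; then a left inverse of the remaining columns, up to a small error, suffices.\<close>
lemma nondegI_approx_inverse: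
  assumes x: "cyclic_root x"
    and inv: "\<And>j. j \<in> free_cols m \<Longrightarrow>
      (\<Sum>k\<in>free_cols m. cmod ((if k = j then 1 else 0) - (\<Sum>d\<in>UNIV. C j d * tangent_matrix m x d k))) < 1"
  shows "nondeg m x"
  unfolding nondeg_def
proof (intro allI impI)
  fix g assume g: "tangent m x g"
  define \<beta> where "\<beta> = (if m = 0 then 0 else (g 1 - g 0) / (chi m - 1))"
  define \<alpha> where "\<alpha> = g 0 - \<beta>"
  define h where "h = (\<lambda>k. g k - (\<alpha> + \<beta> * chi (m * k)))"
  have h0: "h k = 0" if "k \<notin> free_cols m" for k
  proof (cases "m = 0")
    case False
    then have "chi m - 1 \<noteq> 0" by (simp add: chi_eq_1_iff)
    then have "\<beta> * (chi m - 1) = g 1 - g 0" using False by (simp add: \<beta>_def)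
    moreover have "k = 0 \<or> k = 1" using that False by (auto simp: free_cols_def)
    ultimately show ?thesis using False by (auto simp: h_def \<alpha>_def algebra_simps)
  qed (use that in \<open>auto simp: h_def \<alpha>_def \<beta>_def free_cols_def\<close>)
  have row: "(\<Sum>k\<in>UNIV. tangent_matrix m x d k * h k) = 0" for d
  proof -
    have c: "(\<Sum>k\<in>UNIV. x k / x (k - d)) * (1 - chi (m * d)) = 0"
      using x by (cases "d = 0") (auto simp: cyclic_root_def)
    have "(\<Sum>k\<in>UNIV. x k / x (k - d) * (h k - chi (m * d) * h (k - d)))
      = (\<Sum>k\<in>UNIV. x k / x (k - d) * (g k - chi (m * d) * g (k - d)) - \<alpha> * (x k / x (k - d) * (1 - chi (m * d))))"
    proof (intro sum.cong refl)
      fix k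
      have "chi (m * d) * chi (m * (k - d)) = chi (m * k)"
        by (simp add: chi_add[symmetric] algebra_simps)
      then have "h k - chi (m * d) * h (k - d) = g k - chi (m * d) * g (k - d) - \<alpha> * (1 - chi (m * d))"
        by (simp add: h_def algebra_simps)
      then show "x k / x (k - d) * (h k - chi (m * d) * h (k - d)) =
        x k / x (k - d) * (g k - chi (m * d) * g (k - d)) - \<alpha> * (x k / x (k - d) * (1 - chi (m * d)))"
        by (simp only: right_diff_distrib mult.left_commute)
    qed
    also have "\<dots> = 0"
      using g c by (simp only: sum_subtractf sum_distrib_left[symmetric] sum_distrib_right[symmetric] tangent_def) simp
    finally show ?thesis by (simp only: tangent_sum)
  qed
  have rowJ: "(\<Sum>k\<in>free_cols m. tangent_matrix m x d k * h k) = 0" for d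
    using row[of d] sum.mono_neutral_left[of UNIV "free_cols m" "\<lambda>k. tangent_matrix m x d k * h k"] h0 by auto
  have "h k = 0" if "k \<in> free_cols m" for k
  proof (rule diagonal_dominance[OF inv _ that])
    fix j
    have "(\<Sum>k\<in>free_cols m. (\<Sum>d\<in>UNIV. C j d * tangent_matrix m x d k) * h k)
      = (\<Sum>d\<in>UNIV. C j d * (\<Sum>k\<in>free_cols m. tangent_matrix m x d k * h k))"
      unfolding sum_distrib_left sum_distrib_right by (subst sum.swap) (simp add: mult.assoc)
    then show "(\<Sum>k\<in>free_cols m. (\<Sum>d\<in>UNIV. C j d * tangent_matrix m x d k) * h k) = 0"
      by (simp add: rowJ)
  qed
  with h0 have "h k = 0" for k by blast
  then have "g k = \<alpha> + \<beta> * chi (m * k)" for k by (simp add: h_def)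
  then show "\<exists>\<alpha> \<beta>. \<forall>k. g k = \<alpha> + \<beta> * chi (m * k)" by blast
qed

text \<open>The equation for \<open>d = 0\<close> is trivial, so \<open>C\<close> uses the other
  six. The error of \<open>M\<close> enters each entry of the product multiplied by the row sum of
  \<open>C\<close>.\<close>

lemma nondegI_approx:
  assumes x: "cyclic_root x" and C0: "\<And>j. C j 0 = 0"
    and err: "\<And>d k. d \<noteq> 0 \<Longrightarrow> cmod (tangent_matrix m x d k - M d k) \<le> \<eta>"
    and inv: "\<And>j. j \<in> free_cols m \<Longrightarrow>
      (\<Sum>k\<in>free_cols m. cmod ((if k = j then 1 else 0) - (\<Sum>d\<in>UNIV-{0}. C j d * M d k)) + \<eta> * (\<Sum>d\<in>UNIV-{0}. cmod (C j d))) < 1"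
  shows "nondeg m x"
proof (rule nondegI_approx_inverse[OF x, where C=C])
  fix j assume j: "j \<in> free_cols m"
  have bound: "cmod ((if k = j then 1 else 0) - (\<Sum>d\<in>UNIV. C j d * tangent_matrix m x d k))
    \<le> cmod ((if k = j then 1 else 0) - (\<Sum>d\<in>UNIV-{0}. C j d * M d k)) + \<eta> * (\<Sum>d\<in>UNIV-{0}. cmod (C j d))" for k
  proof -
    have "(\<Sum>d\<in>UNIV. C j d * tangent_matrix m x d k) = (\<Sum>d\<in>UNIV-{0}. C j d * tangent_matrix m x d k)"
      using C0 by (intro sum.mono_neutral_right) auto
    also have "\<dots> = (\<Sum>d\<in>UNIV-{0}. C j d * M d k) + (\<Sum>d\<in>UNIV-{0}. C j d * (tangent_matrix m x d k - M d k))"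
      by (simp add: sum.distrib[symmetric] right_diff_distrib)
    finally have split: "(\<Sum>d\<in>UNIV. C j d * tangent_matrix m x d k)
      = (\<Sum>d\<in>UNIV-{0}. C j d * M d k) + (\<Sum>d\<in>UNIV-{0}. C j d * (tangent_matrix m x d k - M d k))" .
    have tri: "cmod (a - (b + c)) \<le> cmod (a - b) + cmod c" for a b c :: complex
      using norm_triangle_ineq4[of "a - b" c] by (simp add: diff_diff_add)
    have "cmod ((if k = j then 1 else 0) - (\<Sum>d\<in>UNIV. C j d * tangent_matrix m x d k))
     \<le> cmod ((if k = j then 1 else 0) - (\<Sum>d\<in>UNIV-{0}. C j d * M d k))
       + cmod (\<Sum>d\<in>UNIV-{0}. C j d * (tangent_matrix m x d k - M d k))"
      unfolding split by (rule tri)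
    also have "cmod (\<Sum>d\<in>UNIV-{0}. C j d * (tangent_matrix m x d k - M d k)) \<le> (\<Sum>d\<in>UNIV-{0}. cmod (C j d) * \<eta>)"
      by (intro order_trans[OF norm_sum] sum_mono) (use err in \<open>auto simp: norm_mult intro!: mult_left_mono\<close>)
    finally show ?thesis by (simp add: sum_distrib_left mult.commute)
  qed
  show "(\<Sum>k\<in>free_cols m. cmod ((if k = j then 1 else 0) - (\<Sum>d\<in>UNIV. C j d * tangent_matrix m x d k))) < 1"
    by (rule le_less_trans[OF sum_mono inv[OF j]]) (rule bound)
qed

text \<open>Pairs of integers are Gaussian integers. Roots, inverses of roots and characters are approximated in
  units of \<open>1/1000\<close>, entries of left inverses in units of \<open>1/100\<close>; hence \<open>approx_entry\<close> counts in units of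
  \<open>10^(-9)\<close> and the residual in \<open>row_ok\<close> in units of \<open>10^(-11)\<close>. The parameter \<open>e\<close> bounds, in units of
  \<open>10^(-9)\<close>, the error of each approximate entry.\<close>

definition gmul :: "int \<times> int \<Rightarrow> int \<times> int \<Rightarrow> int \<times> int" where
  "gmul = (\<lambda>(a, b) (c, d). (a * c - b * d, a * d + b * c))"

definition gadd :: "int \<times> int \<Rightarrow> int \<times> int \<Rightarrow> int \<times> int" where
  "gadd = (\<lambda>(a, b) (c, d). (a + c, b + d))"

definition gneg :: "int \<times> int \<Rightarrow> int \<times> int" where
  "gneg = (\<lambda>(a, b). (- a, - b))"

definition gnorm :: "int \<times> int \<Rightarrow> int" where
  "gnorm = (\<lambda>(a, b). \<bar>a\<bar> + \<bar>b\<bar>)"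

definition gval :: "int \<times> int \<Rightarrow> complex" where
  "gval = (\<lambda>(a, b). Complex (of_int a) (of_int b))"

lemma gval_mul: "gval (gmul z w) = gval z * gval w"
  by (cases z; cases w) (simp add: gval_def gmul_def complex_eq_iff)

lemma gval_add: "gval (gadd z w) = gval z + gval w"
  by (cases z; cases w) (simp add: gval_def gadd_def complex_eq_iff)

lemma gval_neg: "gval (gneg z) = - gval z"
  by (cases z) (simp add: gval_def gneg_def complex_eq_iff)

lemma gval_int: "gval (a, 0) = of_int a"
  by (simp add: gval_def complex_eq_iff)

lemma gval_norm: "cmod (gval z) \<le> of_int (gnorm z)"
  using cmod_le[of "gval z"] by (cases z) (simp add: gval_def gnorm_def)

definition gdot :: "(int \<times> int) list \<Rightarrow> (int \<times> int) list \<Rightarrow> int \<times> int" where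
  "gdot xs ys = foldr gadd (map2 gmul xs ys) (0, 0)"

text \<open>The factor 1000 brings the product of two approximations to the scale of the product of
  three. Adding \<open>7 - d\<close> stands for subtracting \<open>d\<close>, to stay within natural
  numbers.\<close>

definition approx_entry ::
    "(int \<times> int) list \<Rightarrow> (int \<times> int) list \<Rightarrow> (int \<times> int) list \<Rightarrow> nat \<Rightarrow> nat \<Rightarrow> nat \<Rightarrow> int \<times> int" where
  "approx_entry X Y W m d k =
     gadd (gmul (1000, 0) (gmul (X ! k) (Y ! ((k + (7 - d)) mod 7))))
       (gneg (gmul (W ! ((m * d) mod 7)) (gmul (X ! ((k + d) mod 7)) (Y ! k))))"

definition cols :: "nat \<Rightarrow> nat list" where
  "cols m = (if m = 0 then [1, 2, 3, 4, 5, 6] else [2, 3, 4, 5, 6])"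

definition approx_cols where
  "approx_cols X Y W m = map (\<lambda>k. map (\<lambda>d. approx_entry X Y W m d k) [1, 2, 3, 4, 5, 6]) (cols m)"

definition row_ok :: "int \<Rightarrow> nat list \<Rightarrow> (int \<times> int) list list \<Rightarrow> nat \<Rightarrow> (int \<times> int) list \<Rightarrow> bool" where
  "row_ok e ks A j r \<longleftrightarrow> length r = 6 \<and>
     (\<Sum>(k, c)\<leftarrow>zip ks A. gnorm (gadd (if k = j then (10 ^ 11, 0) else (0, 0)) (gneg (gdot r c)))
        + e * sum_list (map gnorm r)) < 10 ^ 11"

definition inverse_ok :: "int \<Rightarrow> nat \<Rightarrow> (int \<times> int) list list \<Rightarrow> (int \<times> int) list list \<Rightarrow> bool" where
  "inverse_ok e m C A \<longleftrightarrow> list_all (\<lambda>j. row_ok e (cols m) A j (C ! j)) (cols m)"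

lemma sum_free_cols: "(\<Sum>k\<in>free_cols m. f k) = (\<Sum>k\<leftarrow>cols (rep m). f (of_nat k))"
  for f :: "7 \<Rightarrow> 'a::comm_monoid_add"
proof -
  have "rep m = 0 \<longleftrightarrow> m = 0" by (metis mod_0 of_nat_0 of_nat_rep rep_of_nat)
  moreover have "(UNIV :: 7 set) - {0} = {1, 2, 3, 4, 5, 6}" "(UNIV :: 7 set) - {0, 1} = {2, 3, 4, 5, 6}"
    unfolding UNIV_7 by simp_all
  ultimately show ?thesis by (simp add: free_cols_def cols_def)
qed

lemma sum_nonzero: "(\<Sum>d\<in>UNIV - {0}. f d) = (\<Sum>d\<leftarrow>[1, 2, 3, 4, 5, 6]. f (of_nat d))"
  for f :: "7 \<Rightarrow> 'a::comm_monoid_add"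
  using sum_free_cols[of f 0] by (simp add: free_cols_def cols_def)

lemma approx_entry_error:
  assumes X: "\<And>k. cmod (x k - gval (X ! rep k) / 1000) \<le> 0.001"
    and Y: "\<And>k. cmod (inverse (x k) - gval (Y ! rep k) / 1000) \<le> 0.001"
    and W: "\<And>k. cmod (chi k - gval (W ! rep k) / 1000) \<le> 0.001"
    and B: "\<And>k. cmod (x k) \<le> B" "\<And>k. cmod (inverse (x k)) \<le> B"
  shows "cmod (tangent_matrix m x d k - gval (approx_entry X Y W (rep m) (rep d) (rep k)) / 10 ^ 9)
    \<le> ((B + 0.001)\<^sup>2 - B\<^sup>2) + (1.001 * (B + 0.001)\<^sup>2 - B\<^sup>2)"
proof -
  define X' Y' W' where "X' = (\<lambda>k. gval (X ! rep k) / 1000)" and "Y' = (\<lambda>k. gval (Y ! rep k) / 1000)"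
    and "W' = (\<lambda>k. gval (W ! rep k) / 1000)"
  \<comment> \<open>The form \<open>(A1 + e1) * (B1 + e2) - A1 * B1\<close> of the bound composes
    well, so the triple product with \<open>chi\<close> is handled by a second application.\<close>
  have prod: "cmod (a * b - a' * b') \<le> (A1 + e1) * (B1 + e2) - A1 * B1"
    if "cmod (a - a') \<le> e1" "cmod (b - b') \<le> e2" "cmod a \<le> A1" "cmod b \<le> B1"
    for a b a' b' :: complex and A1 B1 e1 e2
  proof -
    have "a * b - a' * b' = a * (b - b') + (a - a') * b - (a - a') * (b - b')"
      by (simp add: algebra_simps)
    also have "cmod \<dots> \<le> cmod (a * (b - b')) + cmod ((a - a') * b) + cmod ((a - a') * (b - b'))"
      by (intro order_trans[OF norm_triangle_ineq4] add_right_mono norm_triangle_ineq)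
    also have "\<dots> \<le> A1 * e2 + e1 * B1 + e1 * e2"
      unfolding norm_mult using that
      by (intro add_mono mult_mono) (auto intro: order_trans[OF norm_ge_zero])
    finally show ?thesis by (simp add: algebra_simps)
  qed
  have xy: "cmod (x i * inverse (x j) - X' i * Y' j) \<le> (B + 0.001)\<^sup>2 - B\<^sup>2" for i j
    unfolding power2_eq_square X'_def Y'_def by (intro prod X Y B)
  have nxy: "cmod (x i * inverse (x j)) \<le> B\<^sup>2" for i j
    unfolding norm_mult power2_eq_square by (intro mult_mono B) (auto intro: order_trans[OF norm_ge_zero B(1)])
  have wxy: "cmod (chi l * (x i * inverse (x j)) - W' l * (X' i * Y' j)) \<le> 1.001 * (B + 0.001)\<^sup>2 - B\<^sup>2" for i j l
  proof -
    have "cmod (chi l * (x i * inverse (x j)) - W' l * (X' i * Y' j))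
      \<le> (1 + 0.001) * (B\<^sup>2 + ((B + 0.001)\<^sup>2 - B\<^sup>2)) - 1 * B\<^sup>2"
      by (rule prod[OF _ xy _ nxy]) (use W in \<open>auto simp: W'_def\<close>)
    then show ?thesis by (simp add: algebra_simps)
  qed
  have ent: "gval (approx_entry X Y W (rep m) (rep d) (rep k)) / 10 ^ 9
    = X' k * Y' (k - d) - W' (m * d) * (X' (k + d) * Y' k)"
    by (simp add: approx_entry_def gval_add gval_neg gval_mul gval_int X'_def Y'_def W'_def
        rep_add rep_mult rep_diff add_divide_distrib diff_divide_distrib)
  have "tangent_matrix m x d k - gval (approx_entry X Y W (rep m) (rep d) (rep k)) / 10 ^ 9
    = (x k * inverse (x (k - d)) - X' k * Y' (k - d))
      - (chi (m * d) * (x (k + d) * inverse (x k)) - W' (m * d) * (X' (k + d) * Y' k))"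
    unfolding ent unfolding tangent_matrix_def divide_inverse by (simp add: algebra_simps)
  then show ?thesis
    using norm_triangle_ineq4[of "x k * inverse (x (k - d)) - X' k * Y' (k - d)"
      "chi (m * d) * (x (k + d) * inverse (x k)) - W' (m * d) * (X' (k + d) * Y' k)"]
      xy[of k "k - d"] wxy[of "m * d" "k + d" k] by simp
qed

lemma gval_gdot:
  assumes "length r = 6"
  shows "gval (gdot r (map f [1, 2, 3, 4, 5, 6])) = (\<Sum>d\<leftarrow>[1, 2, 3, 4, 5, 6]. gval (r ! (d - 1)) * gval (f d))"
proof -
  obtain r1 r2 r3 r4 r5 r6 where "r = [r1, r2, r3, r4, r5, r6]"
    using assms by (auto simp: numeral_eq_Suc length_Suc_conv)
  then show ?thesis
    by (simp add: gdot_def gval_add gval_mul gval_int)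
qed

text \<open>Reduces nondegeneracy to an evaluation in integers. Moduli, which need square roots, are
  replaced by the larger \<open>gnorm\<close>.\<close>

lemma nondegI_certificate:
  assumes x: "cyclic_root x"
    and X: "\<And>k. cmod (x k - gval (X ! rep k) / 1000) \<le> 0.001"
    and Y: "\<And>k. cmod (inverse (x k) - gval (Y ! rep k) / 1000) \<le> 0.001"
    and W: "\<And>k. cmod (chi k - gval (W ! rep k) / 1000) \<le> 0.001"
    and B: "\<And>k. cmod (x k) \<le> B" "\<And>k. cmod (inverse (x k)) \<le> B"
    and e: "((B + 0.001)\<^sup>2 - B\<^sup>2) + (1.001 * (B + 0.001)\<^sup>2 - B\<^sup>2) \<le> of_int e / 10 ^ 9"
    and ok: "inverse_ok e (rep m) C (approx_cols X Y W (rep m))"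
  shows "nondeg m x"
proof (rule nondegI_approx[OF x, where C = "\<lambda>j d. if d = 0 then 0 else gval (C ! rep j ! (rep d - 1)) / 100"
      and M = "\<lambda>d k. gval (approx_entry X Y W (rep m) (rep d) (rep k)) / 10 ^ 9" and \<eta> = "of_int e / 10 ^ 9"])
  show "cmod (tangent_matrix m x d k - gval (approx_entry X Y W (rep m) (rep d) (rep k)) / 10 ^ 9)
      \<le> of_int e / 10 ^ 9" for d k
    by (rule order_trans[OF approx_entry_error[OF X Y W B] e])
next
  let ?ds = "[1, 2, 3, 4, 5, 6] :: nat list"
  fix j assume j: "j \<in> free_cols m"
  define r where "r = C ! rep j"
  define A where "A = (\<lambda>k. map (\<lambda>d. approx_entry X Y W (rep m) d k) ?ds)"
  have "rep j \<in> set (cols (rep m))"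
  proof -
    \<comment> \<open>An indicator function in \<open>sum_free_cols\<close> transfers membership
      from the set of columns to the list.\<close>
    have "(\<Sum>k\<in>free_cols m. if k = j then 1 else (0::nat)) = 1" using j by simp
    then have "(\<Sum>k\<leftarrow>cols (rep m). if of_nat k = j then 1 else (0::nat)) = 1"
      by (simp only: sum_free_cols)
    then have "\<exists>k\<in>set (cols (rep m)). of_nat k = j"
      by (rule contrapos_pp) (simp add: sum_list_0 cong: map_cong)
    then obtain k where "k \<in> set (cols (rep m))" "of_nat k = j" by blast
    moreover from this have "k < 7" by (auto simp: cols_def split: if_splits)
    ultimately show ?thesis using rep_of_nat[of k] by auto
  qed
  then have ro: "row_ok e (cols (rep m)) (approx_cols X Y W (rep m)) (rep j) r"
    using ok by (simp add: inverse_ok_def list_all_iff r_def)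
  then have len: "length r = 6" by (simp add: row_ok_def)
  have small: "k < 7" if "k \<in> set (cols m')" for k m' using that by (auto simp: cols_def split: if_splits)
  have bound: "cmod ((if of_nat k = j then 1 else 0)
        - (\<Sum>d\<in>UNIV - {0}. (if d = 0 then 0 else gval (C ! rep j ! (rep d - 1)) / 100)
              * (gval (approx_entry X Y W (rep m) (rep d) (rep (of_nat k))) / 10 ^ 9)))
      + of_int e / 10 ^ 9 * (\<Sum>d\<in>UNIV - {0}. cmod (if d = 0 then 0 else gval (C ! rep j ! (rep d - 1)) / 100))
      \<le> of_int (gnorm (gadd (if k = rep j then (10 ^ 11, 0) else (0, 0)) (gneg (gdot r (A k))))
          + e * sum_list (map gnorm r)) / 10 ^ 11"
    if k: "k \<in> set (cols (rep m))" for k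
  proof -
    have rk: "rep (of_nat k) = k" using small[OF k] by (simp add: rep_of_nat)
    have eq: "(of_nat k = j) = (k = rep j)" using rk by auto
    have e0: "e \<ge> 0"
    proof -
      have "0 \<le> cmod (tangent_matrix 0 x 0 0 - gval (approx_entry X Y W (rep 0) (rep 0) (rep 0)) / 10 ^ 9)" by simp
      also note approx_entry_error[OF X Y W B]
      also note e
      finally show ?thesis by (simp add: zero_le_divide_iff)
    qed
    have dot: "(\<Sum>d\<in>UNIV - {0}. (if d = 0 then 0 else gval (C ! rep j ! (rep d - 1)) / 100)
              * (gval (approx_entry X Y W (rep m) (rep d) (rep (of_nat k))) / 10 ^ 9)) = gval (gdot r (A k)) / 10 ^ 11"
      unfolding A_def gval_gdot[OF len] sum_nonzero by (simp add: rk r_def add_divide_distrib)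
    have "cmod ((if of_nat k = j then 1 else 0) - gval (gdot r (A k)) / 10 ^ 11)
      = cmod (gval (gadd (if k = rep j then (10 ^ 11, 0) else (0, 0)) (gneg (gdot r (A k))))) / 10 ^ 11"
    proof -
      have "(if of_nat k = j then 1 else 0) - gval (gdot r (A k)) / 10 ^ 11
       = gval (gadd (if k = rep j then (10 ^ 11, 0) else (0, 0)) (gneg (gdot r (A k)))) / 10 ^ 11"
        unfolding eq by (simp add: gval_add gval_neg gval_int diff_divide_distrib)
      then show ?thesis by (simp only: norm_divide norm_power norm_numeral)
    qed
    also have "\<dots> \<le> of_int (gnorm (gadd (if k = rep j then (10 ^ 11, 0) else (0, 0)) (gneg (gdot r (A k))))) / 10 ^ 11"
      by (intro divide_right_mono gval_norm) simp
    finally have 1: "cmod ((if of_nat k = j then 1 else 0) - gval (gdot r (A k)) / 10 ^ 11)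
      \<le> of_int (gnorm (gadd (if k = rep j then (10 ^ 11, 0) else (0, 0)) (gneg (gdot r (A k))))) / 10 ^ 11" .
    have "(\<Sum>d\<in>UNIV - {0}. cmod (if d = 0 then 0 else gval (C ! rep j ! (rep d - 1)) / 100))
       \<le> of_int (sum_list (map gnorm r)) / 100"
    proof -
      obtain r1 r2 r3 r4 r5 r6 where r: "r = [r1, r2, r3, r4, r5, r6]"
        using len by (auto simp: numeral_eq_Suc length_Suc_conv)
      show ?thesis
        unfolding sum_nonzero using gval_norm[of r1] gval_norm[of r2] gval_norm[of r3]
          gval_norm[of r4] gval_norm[of r5] gval_norm[of r6]
        by (simp add: r r_def[symmetric] norm_divide)
    qed
    then have "of_int e / 10 ^ 9 * (\<Sum>d\<in>UNIV - {0}. cmod (if d = 0 then 0 else gval (C ! rep j ! (rep d - 1)) / 100))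
       \<le> of_int e / 10 ^ 9 * (of_int (sum_list (map gnorm r)) / 100)"
      using e0 by (intro mult_left_mono) auto
    with 1 show ?thesis
      unfolding dot by (simp add: add_divide_distrib)
  qed
  let ?F = "\<lambda>k. gnorm (gadd (if k = rep j then (10 ^ 11, 0) else (0, 0)) (gneg (gdot r (A k))))
          + e * sum_list (map gnorm r)"
  have "(\<Sum>k\<in>free_cols m. cmod ((if k = j then 1 else 0)
        - (\<Sum>d\<in>UNIV - {0}. (if d = 0 then 0 else gval (C ! rep j ! (rep d - 1)) / 100)
              * (gval (approx_entry X Y W (rep m) (rep d) (rep k)) / 10 ^ 9)))
      + of_int e / 10 ^ 9 * (\<Sum>d\<in>UNIV - {0}. cmod (if d = 0 then 0 else gval (C ! rep j ! (rep d - 1)) / 100)))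
      \<le> (\<Sum>k\<leftarrow>cols (rep m). of_int (?F k) / 10 ^ 11)"
    unfolding sum_free_cols by (rule sum_list_mono) (rule bound)
  also have "\<dots> = of_int (\<Sum>k\<leftarrow>cols (rep m). ?F k) / 10 ^ 11"
    by (induction "cols (rep m)") (simp_all add: cols_def add_divide_distrib)
  also have "(\<Sum>k\<leftarrow>cols (rep m). ?F k) < 10 ^ 11"
  proof -
    have "approx_cols X Y W (rep m) = map A (cols (rep m))" by (simp add: approx_cols_def A_def)
    moreover have "(\<Sum>(k, c)\<leftarrow>zip ks (map A ks). G k c) = (\<Sum>k\<leftarrow>ks. G k (A k))" for ks and G :: "nat \<Rightarrow> _ \<Rightarrow> int"
      by (induction ks) simp_all
    ultimately show ?thesis using ro by (simp add: row_ok_def)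
  qed
  finally show "(\<Sum>k\<in>free_cols m. cmod ((if k = j then 1 else 0)
        - (\<Sum>d\<in>UNIV - {0}. (if d = 0 then 0 else gval (C ! rep j ! (rep d - 1)) / 100)
              * (gval (approx_entry X Y W (rep m) (rep d) (rep k)) / 10 ^ 9)))
      + of_int e / 10 ^ 9 * (\<Sum>d\<in>UNIV - {0}. cmod (if d = 0 then 0 else gval (C ! rep j ! (rep d - 1)) / 100)))
      < 1"
    by simp
qed simp

section \<open>Roots of index one, two and three\<close>

lemma cyclic_rootI_seq:
  assumes "\<forall>x\<in>set [a0,a1,a2,a3,a4,a5,a6]. x \<noteq> 0"
    and "a0/a6 + a1/a0 + a2/a1 + a3/a2 + a4/a3 + a5/a4 + a6/a5 = 0"
    and "a0/a5 + a1/a6 + a2/a0 + a3/a1 + a4/a2 + a5/a3 + a6/a4 = 0"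
    and "a0/a4 + a1/a5 + a2/a6 + a3/a0 + a4/a1 + a5/a2 + a6/a3 = 0"
    and "a0/a3 + a1/a4 + a2/a5 + a3/a6 + a4/a0 + a5/a1 + a6/a2 = 0"
    and "a0/a2 + a1/a3 + a2/a4 + a3/a5 + a4/a6 + a5/a0 + a6/a1 = 0"
    and "a0/a1 + a1/a2 + a2/a3 + a3/a4 + a4/a5 + a5/a6 + a6/a0 = 0"
  shows "cyclic_root (seq [a0,a1,a2,a3,a4,a5,a6])"
proof -
  have m: "- 1 = (6::7)" "- 2 = (5::7)" "- 3 = (4::7)" "- 4 = (3::7)" "- 5 = (2::7)" "- 6 = (1::7)"
    "7 = (0::7)" "8 = (1::7)" "9 = (2::7)" "10 = (3::7)" "11 = (4::7)" "12 = (5::7)" "13 = (6::7)" by simp_all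
  then show ?thesis using assms unfolding cyclic_root_def all_7 sum_7 by (simp add: m)
qed

text \<open>The index is that of the subgroup of units on whose cosets the root is constant: all
  units here, then the squares 1, 2, 4, then 1 and -1. Here two of the seven ratios involve position
  0 and the other five are 1, whence the equation.\<close>

lemma cyclic_root_index1:
  assumes "a * a' = 1" "a + a' + 5 = 0"
  shows "cyclic_root (seq [1,a,a,a,a,a,a])"
proof -
  have inv: "inverse a = a'" "a \<noteq> 0" using assms(1) inverse_unique by auto
  show ?thesis
    by (rule cyclic_rootI_seq) (use assms(2) in \<open>simp_all add: inv divide_inverse algebra_simps\<close>)
qed

lemma cyclic_root_index2:
  assumes "d * d' = 1" "2 * d + 2 * d' + 3 = 0"
  shows "cyclic_root (seq [1,1,1,d,1,d,d])"
proof -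
  have inv: "inverse d = d'" "d \<noteq> 0" using assms(1) inverse_unique by auto
  show ?thesis
    by (rule cyclic_rootI_seq) (use assms(2) in \<open>simp_all add: inv divide_inverse algebra_simps\<close>)
qed

lemma cyclic_root_index3:
  assumes "a * a' = 1" "b * b' = 1" "c * c' = 1"
    and "a + a' + (a * b' + b * a') + (b * c' + c * b') + 1 = 0"
    and "b + b' + (b * c' + c * b') + (a * c' + c * a') + 1 = 0"
    and "c + c' + (a * c' + c * a') + (a * b' + b * a') + 1 = 0"
  shows "cyclic_root (seq [1,a,b,c,c,b,a])"
proof -
  have inv: "inverse a = a'" "inverse b = b'" "inverse c = c'" "a \<noteq> 0" "b \<noteq> 0" "c \<noteq> 0"
    using assms(1-3) inverse_unique by auto
  show ?thesis
    by (rule cyclic_rootI_seq) (use assms(4-6) in \<open>simp_all add: inv divide_inverse algebra_simps\<close>)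
qed

text \<open>Parametrisation of the remaining roots \<open>(1, a, b, c, c, b, a)\<close>: \<open>p, q, r\<close> stand for \<open>a + 1/a\<close>,
  \<open>b + 1/b\<close>, \<open>c + 1/c\<close>, the three conjugate roots of a cyclic cubic over \<open>\<rat>(s)\<close>, and \<open>\<rho>, \<sigma>, \<tau>\<close> for
  \<open>a - 1/a\<close>, \<open>b - 1/b\<close>, \<open>c - 1/c\<close>. The choice \<open>s = sqrt 21\<close> leads to unimodular and \<open>s = - sqrt 21\<close> to real
  roots. The cofactors in the proof come from dividing by the cubic \<open>C\<close> and by \<open>S\<close>.\<close>

lemma index3_identities:
  fixes s p q r :: complex
  assumes s: "s\<^sup>2 = 21" and p: "2 * p ^ 3 - 2 * (6 - s) * p\<^sup>2 + (3 - s) * p + (61 - 13 * s) = 0"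
    and q: "6 * q = 21 - 5 * s - 2 * s * p + (3 + s) * p\<^sup>2"
    and r: "6 * r = 15 - s + (2 * s - 6) * p - (3 + s) * p\<^sup>2"
  shows "(p * q - (q - p - r - 1))\<^sup>2 = (p\<^sup>2 - 4) * (q\<^sup>2 - 4)"
    and "(p * r - (p - q - r - 1))\<^sup>2 = (p\<^sup>2 - 4) * (r\<^sup>2 - 4)"
    and "(p * q - (q - p - r - 1)) * (p * r - (p - q - r - 1)) = (q * r - (r - p - q - 1)) * (p\<^sup>2 - 4)"
proof -
  define C where "C = 2 * p ^ 3 - 2 * (6 - s) * p\<^sup>2 + (3 - s) * p + (61 - 13 * s)"
  define S where "S = s\<^sup>2 - 21"
  have q': "q = (21 - 5 * s - 2 * s * p + (3 + s) * p\<^sup>2) / 6"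
    and r': "r = (15 - s + (2 * s - 6) * p - (3 + s) * p\<^sup>2) / 6"
    using q r by (metis nonzero_mult_div_cancel_left zero_neq_numeral)+
  have CS: "C = 0" "S = 0" using s p by (simp_all add: C_def S_def)
  have "36 * ((p * q - (q - p - r - 1))\<^sup>2 - (p\<^sup>2 - 4) * (q\<^sup>2 - 4))
      = (-48 - 24 * s + 180 * p + 36 * p * s - 60 * p ^ 2 - 12 * p ^ 2 * s) * C
        + (-196 + 516 * p - 152 * p ^ 2 - 104 * p ^ 3 + 48 * p ^ 4 - 4 * p ^ 5) * S"
    unfolding q' r' C_def S_def by (simp add: power_numeral_reduce algebra_simps add_divide_distrib diff_divide_distrib)
  then show "(p * q - (q - p - r - 1))\<^sup>2 = (p\<^sup>2 - 4) * (q\<^sup>2 - 4)" by (simp add: CS)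
  have "36 * ((p * r - (p - q - r - 1))\<^sup>2 - (p\<^sup>2 - 4) * (r\<^sup>2 - 4))
      = (48 + 96 * p + 24 * p * s) * C
        + (40 + 308 * p + 24 * p ^ 2 - 52 * p ^ 3 + 4 * p ^ 4) * S"
    unfolding q' r' C_def S_def by (simp add: power_numeral_reduce algebra_simps add_divide_distrib diff_divide_distrib)
  then show "(p * r - (p - q - r - 1))\<^sup>2 = (p\<^sup>2 - 4) * (r\<^sup>2 - 4)" by (simp add: CS)
  have "36 * ((p * q - (q - p - r - 1)) * (p * r - (p - q - r - 1)) - (q * r - (r - p - q - 1)) * (p\<^sup>2 - 4))
      = (24 - 108 * p - 24 * p * s + 30 * p ^ 2 + 6 * p ^ 2 * s) * C
        + (-4 - 342 * p + 82 * p ^ 2 + 70 * p ^ 3 - 24 * p ^ 4 + 2 * p ^ 5) * S"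
    unfolding q' r' C_def S_def by (simp add: power_numeral_reduce algebra_simps add_divide_distrib diff_divide_distrib)
  then show "(p * q - (q - p - r - 1)) * (p * r - (p - q - r - 1)) = (q * r - (r - p - q - 1)) * (p\<^sup>2 - 4)" by (simp add: CS)
qed

text \<open>The equations of \<open>cyclic_root_index3\<close> are linear in the mixed sums and give
  \<open>a/b + b/a = (q - p - r - 1) / 2\<close> and its analogues. As
  \<open>a/b + b/a = (p * q - \<rho> * \<sigma>) / 2\<close>, they prescribe the products of
  \<open>\<rho>\<close>, \<open>\<sigma>\<close>, \<open>\<tau>\<close>; the identities make these
  compatible with the squares \<open>p^2 - 4\<close>, \<open>q^2 - 4\<close>,
  \<open>r^2 - 4\<close>.\<close>

lemma cyclic_root_index3_param:
  fixes s p \<rho> :: complex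
  assumes s: "s\<^sup>2 = 21" and p: "2 * p ^ 3 - 2 * (6 - s) * p\<^sup>2 + (3 - s) * p + (61 - 13 * s) = 0"
    and q: "6 * q = 21 - 5 * s - 2 * s * p + (3 + s) * p\<^sup>2"
    and r: "6 * r = 15 - s + (2 * s - 6) * p - (3 + s) * p\<^sup>2"
    and \<rho>: "\<rho>\<^sup>2 = p\<^sup>2 - 4" "\<rho> \<noteq> 0"
    and \<sigma>: "\<sigma> * \<rho> = p * q - (q - p - r - 1)" and \<tau>: "\<tau> * \<rho> = p * r - (p - q - r - 1)"
  shows "\<sigma>\<^sup>2 = q\<^sup>2 - 4" "\<tau>\<^sup>2 = r\<^sup>2 - 4"
    "cyclic_root (seq [1, (p + \<rho>) / 2, (q + \<sigma>) / 2, (r + \<tau>) / 2, (r + \<tau>) / 2, (q + \<sigma>) / 2, (p + \<rho>) / 2])"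
    "inverse ((p + \<rho>) / 2) = (p - \<rho>) / 2" "inverse ((q + \<sigma>) / 2) = (q - \<sigma>) / 2"
    "inverse ((r + \<tau>) / 2) = (r - \<tau>) / 2"
proof -
  note id = index3_identities[OF s p q r]
  have "(\<sigma> * \<rho>)\<^sup>2 = \<rho>\<^sup>2 * (q\<^sup>2 - 4)" using id(1) \<sigma> \<rho>(1) by simp
  then show \<sigma>2: "\<sigma>\<^sup>2 = q\<^sup>2 - 4" using \<rho>(2) by (simp add: power_mult_distrib)
  have "(\<tau> * \<rho>)\<^sup>2 = \<rho>\<^sup>2 * (r\<^sup>2 - 4)" using id(2) \<tau> \<rho>(1) by simp
  then show \<tau>2: "\<tau>\<^sup>2 = r\<^sup>2 - 4" using \<rho>(2) by (simp add: power_mult_distrib)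
  have "\<sigma> * \<tau> * \<rho>\<^sup>2 = (\<sigma> * \<rho>) * (\<tau> * \<rho>)" by (simp add: power2_eq_square)
  also have "\<dots> = (q * r - (r - p - q - 1)) * \<rho>\<^sup>2" using id(3) \<sigma> \<tau> \<rho>(1) by simp
  finally have \<sigma>\<tau>: "\<sigma> * \<tau> = q * r - (r - p - q - 1)" using \<rho>(2) by simp
  have \<tau>\<sigma>: "\<tau> * \<sigma> = q * r - (r - p - q - 1)" using \<sigma>\<tau> by (simp add: mult.commute)
  have pair: "(x + y) / 2 * ((u - v) / 2) + (u + v) / 2 * ((x - y) / 2) = (x * u - v * y) / 2"
    and half: "(x + y) / 2 + (x - y) / 2 = x" for x y u v :: complex
    by (simp_all add: field_simps)
  have m: "(x + y) / 2 * ((x - y) / 2) = 1" if "y\<^sup>2 = x\<^sup>2 - 4" for x y :: complex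
    using that by (simp add: field_simps power2_eq_square)
  show "cyclic_root (seq [1, (p + \<rho>) / 2, (q + \<sigma>) / 2, (r + \<tau>) / 2, (r + \<tau>) / 2, (q + \<sigma>) / 2, (p + \<rho>) / 2])"
    by (rule cyclic_root_index3[OF m[OF \<rho>(1)] m[OF \<sigma>2] m[OF \<tau>2]])
      (unfold pair half \<sigma> \<tau> \<tau>\<sigma>, simp_all add: field_simps)
  show "inverse ((p + \<rho>) / 2) = (p - \<rho>) / 2" "inverse ((q + \<sigma>) / 2) = (q - \<sigma>) / 2"
    "inverse ((r + \<tau>) / 2) = (r - \<tau>) / 2"
    by (rule inverse_unique, rule m, rule \<rho>(1))
      (rule inverse_unique, rule m, rule \<sigma>2, rule inverse_unique, rule m, rule \<tau>2)
qed

section \<open>Rounded characters and roots, and certificates for the tangent systems\<close>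

definition chi_approx :: "(int \<times> int) list" where
  "chi_approx = [(1000, 0), (623, 782), (-223, 975), (-901, 434), (-901, -434), (-223, -975), (623, -782)]"

lemma all_7_rep: "(\<forall>k. P k (rep k)) \<longleftrightarrow> P 0 0 \<and> P 1 1 \<and> P 2 2 \<and> P 3 3 \<and> P 4 4 \<and> P 5 5 \<and> P 6 6"
  unfolding all_7 by simp

lemma gval_close:
  assumes "\<bar>1000 * Re z - of_int a\<bar> + \<bar>1000 * Im z - of_int b\<bar> \<le> 1"
  shows "cmod (z - gval (a, b) / 1000) \<le> 0.001"
proof -
  have "cmod (z - gval (a, b) / 1000) \<le> \<bar>Re z - of_int a / 1000\<bar> + \<bar>Im z - of_int b / 1000\<bar>"
    using cmod_le[of "z - gval (a, b) / 1000"] by (simp add: gval_def)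
  with assms show ?thesis by (simp add: abs_if split: if_splits)
qed

lemma chi_close: "cmod (chi k - gval (chi_approx ! rep k) / 1000) \<le> 0.001"
proof -
  define c s where "c = heptic_re" and "s = heptic_im"
  have c: "0.62348 < c" "c < 0.62349" and s: "0.78183 < s" "s < 0.78184"
    using heptic_re heptic_im by (simp_all add: c_def s_def)
  define c2 s2 where "c2 = c * c - s * s" and "s2 = 2 * c * s"
  define c3 s3 where "c3 = c * c2 - s * s2" and "s3 = c * s2 + s * c2"
  have pr: "l * l' \<le> x * y" "x * y \<le> u * u'" if "l < x" "x < u" "l' < y" "y < u'" "0 \<le> l" "0 \<le> l'"
    for l u x l' u' y :: real
    using that by (auto intro!: mult_mono)
  have sq: "c * c \<ge> 0.62348 * 0.62348" "c * c \<le> 0.62349 * 0.62349"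
    "s * s \<ge> 0.78183 * 0.78183" "s * s \<le> 0.78184 * 0.78184"
    "c * s \<ge> 0.62348 * 0.78183" "c * s \<le> 0.62349 * 0.78184"
    using pr[OF c c] pr[OF s s] pr[OF c s] by simp_all
  have c2: "- 0.22256 < c2" "c2 < - 0.22249" and s2: "0.97490 < s2" "s2 < 0.97496"
    using sq by (simp_all add: c2_def s2_def)
  \<comment> \<open>The product bounds \<open>pr\<close> need nonnegative factors, so the sign of
    \<open>c2\<close> is reversed.\<close>
  have c2': "0.22249 < - c2" "- c2 < 0.22256" using c2 by simp_all
  have c3: "\<bar>1000 * c3 + 901\<bar> \<le> 0.2" and s3: "\<bar>1000 * s3 - 434\<bar> \<le> 0.3"
    using pr[OF c c2'] pr[OF s s2] pr[OF c s2] pr[OF s c2'] unfolding abs_le_iff by (simp_all add: c3_def s3_def)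
  have chi1: "chi 1 = Complex c s"
    using chi_of_nat[of 1] by (simp add: \<omega>_def c_def s_def)
  have chi2: "chi 2 = Complex c2 s2"
    using chi_add[of 1 1] by (simp add: chi1 complex_eq_iff c2_def s2_def)
  have chi3: "chi 3 = Complex c3 s3"
    using chi_add[of 1 2] by (simp add: chi1 chi2 complex_eq_iff c3_def s3_def)
  have neg: "(4::7) = - 3" "(5::7) = - 2" "(6::7) = - 1" by simp_all
  have chi4: "chi 4 = Complex c3 (- s3)" "chi 5 = Complex c2 (- s2)" "chi 6 = Complex c (- s)"
    unfolding neg cnj_chi[symmetric] chi1 chi2 chi3 by (simp_all add: complex_eq_iff)
  have nth: "chi_approx ! 0 = (1000, 0)" "chi_approx ! 1 = (623, 782)" "chi_approx ! 2 = (-223, 975)"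
    "chi_approx ! 3 = (-901, 434)" "chi_approx ! 4 = (-901, -434)" "chi_approx ! 5 = (-223, -975)"
    "chi_approx ! 6 = (623, -782)"
    by (simp_all add: chi_approx_def)
  show ?thesis
    by (rule all_7_rep[of "\<lambda>k n. cmod (chi k - gval (chi_approx ! n) / 1000) \<le> 0.001", THEN iffD2, THEN spec],
        unfold nth chi1 chi2 chi3 chi4 chi_0, intro conjI gval_close)
      (use c s c2 s2 c3 s3 in \<open>simp_all add: abs_if split: if_splits\<close>)
qed

lemma cnj_gval: "gval (a, - b) = cnj (gval (a, b))"
  by (simp add: gval_def complex_eq_iff)

definition conj_approx :: "(int \<times> int) list \<Rightarrow> (int \<times> int) list" where
  "conj_approx = map (\<lambda>(a, b). (a, - b))"

definition index2_approx :: "(int \<times> int) list" where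
  "index2_approx = [(1000, 0), (1000, 0), (1000, 0), (-750, 661), (1000, 0), (-750, 661), (-750, 661)]"

definition index3_approx :: "(int \<times> int) list" where
  "index3_approx = [(1000, 0), (817, -576), (280, 960), (-389, -921), (-389, -921), (280, 960), (817, -576)]"

definition index3_real_approx :: "(int \<times> int) list" where
  "index3_real_approx = [(1000, 0), (365, 0), (106, 0), (-818, 0), (-818, 0), (106, 0), (365, 0)]"

definition index3_real_inverse_approx :: "(int \<times> int) list" where
  "index3_real_inverse_approx = [(1000, 0), (2739, 0), (9413, 0), (-1222, 0), (-1222, 0), (9413, 0), (2739, 0)]"

text \<open>The witness is a rounded left inverse, one row per free column and one entry per nonzero
  \<open>d\<close>. The empty lists hold the places of the normalised columns: 0, and also 1 when
  \<open>m\<close> is nonzero.\<close>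

lemma index2_certificate_0:
  "\<exists>C. inverse_ok 5010000 0 C (approx_cols index2_approx (conj_approx index2_approx) chi_approx 0)"
proof
  show "inverse_ok 5010000 0
    [[],
     [(14, -38), (14, 38), (0, 0), (0, 0), (-14, 38), (-14, -38)],
     [(0, 0), (14, -38), (-14, 38), (14, 38), (-14, -38), (0, 0)],
     [(7, 19), (-7, -19), (-21, -19), (21, -19), (7, -19), (-7, 19)],
     [(14, 38), (0, 0), (-14, -38), (14, -38), (0, 0), (-14, 38)],
     [(-7, -19), (21, -19), (-7, 19), (7, 19), (-21, -19), (7, -19)],
     [(21, -19), (7, 19), (7, -19), (-7, -19), (-7, 19), (-21, -19)]]
    (approx_cols index2_approx (conj_approx index2_approx) chi_approx 0)"
    by code_simp
qed

lemma index2_certificate_1: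
  "\<exists>C. inverse_ok 5010000 1 C (approx_cols index2_approx (conj_approx index2_approx) chi_approx 1)"
proof
  show "inverse_ok 5010000 1
    [[],
     [],
     [(16, 67), (-63, -67), (74, -55), (-49, 109), (54, -59), (-31, 4)],
     [(-37, 58), (-41, -110), (112, -18), (-89, 104), (93, -24), (-22, -14)],
     [(-73, 68), (20, -148), (140, 45), (-152, 48), (100, 2), (-34, -15)],
     [(-103, 24), (72, -128), (90, 95), (-172, -24), (85, 37), (-10, -33)],
     [(-42, -19), (44, -50), (18, 62), (-61, -54), (26, 28), (-14, -28)]]
    (approx_cols index2_approx (conj_approx index2_approx) chi_approx 1)"
    by code_simp
qed

lemma index2_certificate_3:
  "\<exists>C. inverse_ok 5010000 3 C (approx_cols index2_approx (conj_approx index2_approx) chi_approx 3)"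
proof
  show "inverse_ok 5010000 3
    [[],
     [],
     [(-6, -65), (4, -16), (37, 55), (-44, 1), (-16, -41), (26, 66)],
     [(9, -10), (2, -14), (-26, 13), (3, -14), (17, -20), (-38, 25)],
     [(-18, -20), (10, -3), (23, 15), (-2, -3), (-16, 0), (2, 10)],
     [(-5, -2), (16, 0), (-18, -10), (7, 3), (-11, -6), (4, 14)],
     [(-29, -16), (3, -21), (33, -2), (-16, -6), (-27, -21), (27, -7)]]
    (approx_cols index2_approx (conj_approx index2_approx) chi_approx 3)"
    by code_simp
qed

lemma index3_certificate_0:
  "\<exists>C. inverse_ok 5010000 0 C (approx_cols index3_approx (conj_approx index3_approx) chi_approx 0)"
proof
  show "inverse_ok 5010000 0
    [[],
     [(13, 7), (49, -15), (54, 7), (-54, 7), (-49, -15), (-13, 7)],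
     [(-3, -16), (-28, -26), (-48, 11), (48, 11), (28, -26), (3, -16)],
     [(-6, -8), (19, -13), (15, 19), (-15, 19), (-19, -13), (6, -8)],
     [(6, -8), (-19, -13), (-15, 19), (15, 19), (19, -13), (-6, -8)],
     [(3, -16), (28, -26), (48, 11), (-48, 11), (-28, -26), (-3, -16)],
     [(-13, 7), (-49, -15), (-54, 7), (54, 7), (49, -15), (13, 7)]]
    (approx_cols index3_approx (conj_approx index3_approx) chi_approx 0)"
    by code_simp
qed

lemma index3_certificate_1:
  "\<exists>C. inverse_ok 5010000 1 C (approx_cols index3_approx (conj_approx index3_approx) chi_approx 1)"
proof
  show "inverse_ok 5010000 1
    [[],
     [],
     [(-2, -36), (14, 10), (34, -44), (11, 1), (-3, -11), (19, -27)],
     [(14, -28), (-19, 24), (-5, -35), (-21, 12), (-30, 15), (36, 26)],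
     [(55, -26), (-45, 27), (19, -49), (-24, -5), (-25, 19), (17, 35)],
     [(42, -8), (-51, 26), (66, 11), (10, -7), (11, -1), (36, 23)],
     [(31, 25), (-35, -8), (38, -9), (1, -1), (2, -3), (0, 34)]]
    (approx_cols index3_approx (conj_approx index3_approx) chi_approx 1)"
    by code_simp
qed

lemma index3_certificate_2:
  "\<exists>C. inverse_ok 5010000 2 C (approx_cols index3_approx (conj_approx index3_approx) chi_approx 2)"
proof
  show "inverse_ok 5010000 2
    [[],
     [],
     [(-14, -13), (-3, -27), (4, 3), (5, -10), (-23, 6), (19, 28)],
     [(-9, -4), (15, -5), (-11, 20), (12, 5), (-12, -17), (-1, 34)],
     [(-3, -1), (-7, -7), (2, 13), (-3, 14), (-16, 12), (-9, -12)],
     [(-23, 4), (-13, -21), (25, 6), (-14, -1), (-18, -8), (21, 10)],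
     [(-12, 3), (18, -37), (11, 22), (-3, -1), (-4, 3), (0, 45)]]
    (approx_cols index3_approx (conj_approx index3_approx) chi_approx 2)"
    by code_simp
qed

lemma index3_certificate_3:
  "\<exists>C. inverse_ok 5010000 3 C (approx_cols index3_approx (conj_approx index3_approx) chi_approx 3)"
proof
  show "inverse_ok 5010000 3
    [[],
     [],
     [(5, -17), (-3, -2), (25, 10), (15, -10), (-11, 2), (-23, 19)],
     [(48, 128), (-38, 28), (8, 133), (126, 35), (-18, 50), (-99, -76)],
     [(41, -49), (-13, 16), (81, -10), (-6, -54), (25, 11), (-29, 55)],
     [(29, 43), (-11, 13), (27, 48), (54, -22), (8, 7), (-63, -15)],
     [(-40, 82), (-34, -27), (-50, 40), (41, 85), (-32, 7), (0, -79)]]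
    (approx_cols index3_approx (conj_approx index3_approx) chi_approx 3)"
    by code_simp
qed

text \<open>A root that is not unimodular only has to be counted, so \<open>m = 0\<close>
  suffices.\<close>

lemma index3_real_certificate_0:
  "\<exists>C. inverse_ok 127000000 0 C (approx_cols index3_real_approx index3_real_inverse_approx chi_approx 0)"
proof
  show "inverse_ok 127000000 0
    [[],
     [(6, 0), (-7, 0), (20, 0), (3, 0), (-5, 0), (6, 0)],
     [(10, 0), (-5, 0), (0, 0), (3, 0), (-10, 0), (8, 0)],
     [(-4, 0), (-2, 0), (0, 0), (4, 0), (-8, 0), (3, 0)],
     [(3, 0), (-8, 0), (4, 0), (0, 0), (-2, 0), (-4, 0)],
     [(8, 0), (-10, 0), (3, 0), (0, 0), (-5, 0), (10, 0)],
     [(6, 0), (-5, 0), (3, 0), (20, 0), (-7, 0), (6, 0)]]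
    (approx_cols index3_real_approx index3_real_inverse_approx chi_approx 0)"
    by code_simp
qed

lemma numerals_7: "8 = (1::7)" "10 = (3::7)" "12 = (5::7)" "15 = (1::7)" "16 = (2::7)" "18 = (4::7)" "20 = (6::7)"
    "24 = (3::7)" "30 = (2::7)" "36 = (1::7)"
  by simp_all

lemma nondegI_unimodular:
  assumes x: "cyclic_root x" and uni: "\<And>k. cmod (x k) = 1"
    and X: "length X = 7" "\<And>k. cmod (x k - gval (X ! rep k) / 1000) \<le> 0.001"
    and ok: "\<exists>C. inverse_ok 5010000 (rep m) C (approx_cols X (conj_approx X) chi_approx (rep m))"
  shows "nondeg m x"
proof -
  from ok obtain C where C: "inverse_ok 5010000 (rep m) C (approx_cols X (conj_approx X) chi_approx (rep m))" ..
  have inv: "inverse (x k) = cnj (x k)" for k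
    using uni[of k] complex_norm_square[of "x k"] by (intro inverse_unique) simp
  have gv: "gval (conj_approx X ! rep k) = cnj (gval (X ! rep k))" for k
    using X(1) rep_less[of k] by (cases "X ! rep k") (simp add: conj_approx_def cnj_gval)
  have "cmod (inverse (x k) - gval (conj_approx X ! rep k) / 1000) \<le> 0.001" for k
  proof -
    have "inverse (x k) - gval (conj_approx X ! rep k) / 1000 = cnj (x k - gval (X ! rep k) / 1000)"
      by (simp add: inv gv)
    then show ?thesis using X(2)[of k] by (simp only: complex_mod_cnj)
  qed
  then show ?thesis
    \<comment> \<open>For \<open>B = 1\<close> the error is (1.001^2 - 1) + (1.001^3 - 1) =
      0.005004001, just below 0.00501.\<close>
    by (rule nondegI_certificate[OF x X(2) _ chi_close, where B = 1 and e = 5010000 and C = C])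
      (use C uni in \<open>simp_all add: norm_inverse power2_eq_square\<close>)
qed

lemma all_seq_rep: "(\<forall>k. P (seq [a0,a1,a2,a3,a4,a5,a6] k) ([b0,b1,b2,b3,b4,b5,b6] ! rep k)) \<longleftrightarrow>
    P a0 b0 \<and> P a1 b1 \<and> P a2 b2 \<and> P a3 b3 \<and> P a4 b4 \<and> P a5 b5 \<and> P a6 b6"
  using all_7_rep[of "\<lambda>k n. P (seq [a0,a1,a2,a3,a4,a5,a6] k) ([b0,b1,b2,b3,b4,b5,b6] ! n)"]
  by simp

lemma nondeg_index2:
  assumes root: "cyclic_root (seq [1,1,1,d,1,d,d])" and uni: "cmod d = 1"
    and d: "cmod (d - gval (-750, 661) / 1000) \<le> 0.001"
  shows "nondeg m (seq [1,1,1,d,1,d,d])"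
proof -
  let ?x = "seq [1,1,1,d,1,d,d]"
  have 1: "cmod (1 - gval (1000, 0) / 1000) \<le> 0.001" by (simp add: gval_int)
  have close: "cmod (?x k - gval (index2_approx ! rep k) / 1000) \<le> 0.001" for k
    using all_seq_rep[of "\<lambda>a b. cmod (a - gval b / 1000) \<le> 0.001"] 1 d
    unfolding index2_approx_def by blast
  have mod: "cmod (?x k) = 1" for k
    using all_7[of "\<lambda>k. cmod (?x k) = 1"] uni by simp
  have base: "nondeg m ?x" if "rep m \<in> {0, 1, 3}" for m
    by (rule nondegI_unimodular[OF root mod _ close])
      (use that index2_certificate_0 index2_certificate_1 index2_certificate_3 in \<open>auto simp: index2_approx_def\<close>)
  have b: "nondeg 0 ?x" "nondeg 1 ?x" "nondeg 3 ?x" using base by simp_all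
  \<comment> \<open>Multiplication by the squares 2 and 4 fixes the root, so 0, 1 and 3 represent
    the orbits {0}, {1, 2, 4} and {3, 5, 6} of characters.\<close>
  have inv: "(\<lambda>k. ?x (2 * k)) = ?x" "(\<lambda>k. ?x (4 * k)) = ?x"
    unfolding fun_eq_iff all_7 by (simp_all add: numerals_7)
  have "nondeg 2 ?x" "nondeg 4 ?x" "nondeg 5 ?x" "nondeg 6 ?x"
    using nondeg_unit[of 2 4 ?x 2] nondeg_unit[of 4 2 ?x 4] nondeg_unit[of 5 2 ?x 4] nondeg_unit[of 6 4 ?x 2] b
    by (simp_all add: inv numerals_7)
  with b have "\<forall>m. nondeg m ?x" unfolding all_7 by simp
  then show ?thesis by blast
qed

lemma nondeg_index3:
  assumes root: "cyclic_root (seq [1,a,b,c,c,b,a])" and uni: "cmod a = 1" "cmod b = 1" "cmod c = 1"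
    and a: "cmod (a - gval (817, -576) / 1000) \<le> 0.001"
    and b: "cmod (b - gval (280, 960) / 1000) \<le> 0.001"
    and c: "cmod (c - gval (-389, -921) / 1000) \<le> 0.001"
  shows "nondeg m (seq [1,a,b,c,c,b,a])"
proof -
  let ?x = "seq [1,a,b,c,c,b,a]"
  have 1: "cmod (1 - gval (1000, 0) / 1000) \<le> 0.001" by (simp add: gval_int)
  have close: "cmod (?x k - gval (index3_approx ! rep k) / 1000) \<le> 0.001" for k
    using all_seq_rep[of "\<lambda>a b. cmod (a - gval b / 1000) \<le> 0.001"] 1 a b c
    unfolding index3_approx_def by blast
  have mod: "cmod (?x k) = 1" for k
    using all_7[of "\<lambda>k. cmod (?x k) = 1"] uni by simp
  have base: "nondeg m ?x" if "rep m \<in> {0, 1, 2, 3}" for m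
    by (rule nondegI_unimodular[OF root mod _ close])
      (use that index3_certificate_0 index3_certificate_1 index3_certificate_2 index3_certificate_3
        in \<open>auto simp: index3_approx_def\<close>)
  have b: "nondeg 0 ?x" "nondeg 1 ?x" "nondeg 2 ?x" "nondeg 3 ?x" using base by simp_all
  \<comment> \<open>The root is even, so \<open>m\<close> and \<open>- m\<close> are
    equivalent.\<close>
  have inv: "(\<lambda>k. ?x (6 * k)) = ?x"
    unfolding fun_eq_iff all_7 by (simp add: numerals_7)
  have "nondeg 4 ?x" "nondeg 5 ?x" "nondeg 6 ?x"
    using nondeg_unit[of 4 6 ?x 6] nondeg_unit[of 5 6 ?x 6] nondeg_unit[of 6 6 ?x 6] b
    by (simp_all add: inv numerals_7)
  with b have "\<forall>m. nondeg m ?x" unfolding all_7 by simp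
  then show ?thesis by blast
qed

lemma nondeg_index3_real:
  assumes root: "cyclic_root (seq [1,a,b,c,c,b,a])"
    and a: "cmod (a - gval (365, 0) / 1000) \<le> 0.001" "cmod (inverse a - gval (2739, 0) / 1000) \<le> 0.001"
    and b: "cmod (b - gval (106, 0) / 1000) \<le> 0.001" "cmod (inverse b - gval (9413, 0) / 1000) \<le> 0.001"
    and c: "cmod (c - gval (-818, 0) / 1000) \<le> 0.001" "cmod (inverse c - gval (-1222, 0) / 1000) \<le> 0.001"
  shows "nondeg 0 (seq [1,a,b,c,c,b,a])"
proof -
  let ?x = "seq [1,a,b,c,c,b,a]"
  have 1: "cmod (1 - gval (1000, 0) / 1000) \<le> 0.001" "cmod (inverse 1 - gval (1000, 0) / 1000) \<le> 0.001"
    by (simp_all add: gval_int)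
  have close: "cmod (?x k - gval (index3_real_approx ! rep k) / 1000) \<le> 0.001" for k
    using all_seq_rep[of "\<lambda>a b. cmod (a - gval b / 1000) \<le> 0.001"] 1(1) a(1) b(1) c(1)
    unfolding index3_real_approx_def by blast
  have close': "cmod (inverse (?x k) - gval (index3_real_inverse_approx ! rep k) / 1000) \<le> 0.001" for k
    using all_seq_rep[of "\<lambda>a b. cmod (inverse a - gval b / 1000) \<le> 0.001"] 1(2) a(2) b(2) c(2)
    unfolding index3_real_inverse_approx_def by blast
  have bd: "cmod z \<le> (\<bar>of_int r\<bar> + 1) / 1000" if "cmod (z - gval (r, 0) / 1000) \<le> 0.001" for z r
  proof -
    have "cmod z \<le> cmod (z - gval (r, 0) / 1000) + cmod (gval (r, 0) / 1000)"
      by (metis diff_add_cancel norm_triangle_ineq)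
    also have "cmod (gval (r, 0) / 1000) = \<bar>of_int r\<bar> / 1000" by (simp add: gval_int norm_divide)
    finally show ?thesis using that by simp
  qed
  \<comment> \<open>The largest modulus, that of \<open>1 / b\<close>, is at most 9.414. With this
    bound the entry errors stay below 0.127, which is the parameter \<open>e\<close> chosen at the
    end.\<close>
  have B: "cmod (?x k) \<le> 9.42" for k
    using all_7[of "\<lambda>k. cmod (?x k) \<le> 9.42"] bd[OF a(1)] bd[OF b(1)] bd[OF c(1)] by simp
  have B': "cmod (inverse (?x k)) \<le> 9.42" for k
    using all_7[of "\<lambda>k. cmod (inverse (?x k)) \<le> 9.42"] bd[OF a(2)] bd[OF b(2)] bd[OF c(2)] by simp
  obtain C where "inverse_ok 127000000 0 C (approx_cols index3_real_approx index3_real_inverse_approx chi_approx 0)"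
    using index3_real_certificate_0 ..
  then show ?thesis
    by (intro nondegI_certificate[OF root close close' chi_close B B', where e = 127000000])
      (simp_all add: power2_eq_square)
qed

section \<open>Existence of the base roots, with enclosures\<close>

lemma sq_bounds:
  fixes y :: real
  assumes "0 \<le> y" "0 \<le> u" "l * l < y * y" "y * y < u * u"
  shows "l < y" "y < u"
  using assms power_less_imp_less_base[of l 2 y] power_less_imp_less_base[of y 2 u]
  by (simp_all add: power2_eq_square)

lemma sqrt_21_bounds: "4.5825756 < sqrt 21" "sqrt 21 < 4.5825757"
  by (rule real_less_rsqrt real_less_lsqrt; simp add: power2_eq_square)+

lemma mult_bounds:
  fixes x y :: real
  assumes "l \<le> x" "x \<le> u" "l' \<le> y" "y \<le> u'" "0 \<le> l" "0 \<le> l'"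
  shows "l * l' \<le> x * y" "x * y \<le> u * u'"
  using assms by (auto intro!: mult_mono)

lemma index2_exists:
  obtains d where "cyclic_root (seq [1,1,1,d,1,d,d])" "cmod d = 1"
    "cmod (d - gval (-750, 661) / 1000) \<le> 0.001"
proof
  \<comment> \<open>For unimodular \<open>d\<close> the equation
    \<open>2 * d + 2 / d + 3 = 0\<close> says that the real part is -3/4.\<close>
  let ?d = "Complex (- 3 / 4) (sqrt 7 / 4)"
  have 7: "sqrt 7 * sqrt 7 = 7" by simp
  show "cyclic_root (seq [1,1,1,?d,1,?d,?d])"
    by (rule cyclic_root_index2[of _ "cnj ?d"]) (simp_all add: complex_eq_iff)
  show "cmod ?d = 1" by (simp add: cmod_def power2_eq_square)
  have "2.6457 < sqrt 7" "sqrt 7 < 2.6458"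
    by (rule real_less_rsqrt real_less_lsqrt; simp add: power2_eq_square)+
  then show "cmod (?d - gval (-750, 661) / 1000) \<le> 0.001"
    by (intro gval_close) (simp add: abs_if)
qed

lemma index3_exists:
  obtains a b c where "cyclic_root (seq [1,a,b,c,c,b,a])" "cmod a = 1" "cmod b = 1" "cmod c = 1"
    "cmod (a - gval (817, -576) / 1000) \<le> 0.001"
    "cmod (b - gval (280, 960) / 1000) \<le> 0.001"
    "cmod (c - gval (-389, -921) / 1000) \<le> 0.001"
proof -
  define s where "s = sqrt 21"
  have s: "4.5825756 \<le> s" "s \<le> 4.5825757" and s2: "s * s = 21"
    using sqrt_21_bounds by (simp_all add: s_def)
  let ?f = "\<lambda>x. 2 * x ^ 3 - 2 * (6 - s) * x\<^sup>2 + (3 - s) * x + (61 - 13 * s)"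
  have "\<exists>x\<ge>1.63456. x \<le> 1.63457 \<and> ?f x = 0"
  proof (rule IVT')
    show "?f 1.63456 \<le> 0" "0 \<le> ?f 1.63457"
      using s by (simp_all add: power_numeral_reduce field_simps)
  qed (auto intro!: continuous_intros)
  then obtain p where p: "1.63456 \<le> p" "p \<le> 1.63457" and fp: "?f p = 0" by blast
  define q where "q = (21 - 5 * s - 2 * s * p + (3 + s) * p\<^sup>2) / 6"
  define r where "r = (15 - s + (2 * s - 6) * p - (3 + s) * p\<^sup>2) / 6"
  note pp = mult_bounds[OF p p] and sp = mult_bounds[OF s p]
  note spp = mult_bounds[OF s pp]
  have "6 * q = 21 - 5 * s - 2 * (s * p) + 3 * (p * p) + s * (p * p)"
    "6 * r = 15 - s + 2 * (s * p) - 6 * p - 3 * (p * p) - s * (p * p)"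
    by (simp_all add: q_def r_def power2_eq_square field_simps)
  then have q: "0.5607 \<le> q" "q \<le> 0.561" and r: "0.7778 \<le> - r" "- r \<le> 0.7782"
    using s p pp sp spp by simp_all
  note qq = mult_bounds[OF q q] and rr = mult_bounds[OF r r] and pq = mult_bounds[OF p q] and pr = mult_bounds[OF p r]
  \<comment> \<open>Here \<open>p\<close>, \<open>q\<close>, \<open>r\<close> lie between -2 and 2,
    so \<open>a - 1/a\<close> and its analogues are imaginary. The real \<open>\<rho>\<close>,
    \<open>\<sigma>\<close>, \<open>\<tau>\<close> are their moduli; once the sign
    \<open>- \<i>\<close> is chosen for \<open>a\<close>, the prescribed products fix the signs for
    \<open>b\<close> and \<open>c\<close>.\<close>
  define \<rho> where "\<rho> = sqrt (4 - p * p)"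
  have \<rho>2: "\<rho> * \<rho> = 4 - p * p" using pp by (simp add: \<rho>_def)
  have \<rho>: "1.1524 < \<rho>" "\<rho> < 1.1526"
    by (rule sq_bounds[of \<rho> "1.1526" "1.1524"]; use pp \<rho>2 in \<open>simp add: \<rho>_def\<close>)+
  define \<sigma> where "\<sigma> = (p * q - (q - p - r - 1)) / \<rho>"
  define \<tau> where "\<tau> = - (p * r - (p - q - r - 1)) / \<rho>"
  have pos: "\<sigma> \<ge> 0" "\<tau> \<ge> 0"
    using \<rho> p q r pq pr unfolding \<sigma>_def \<tau>_def by (auto intro!: divide_nonneg_pos)
  have "(complex_of_real s)\<^sup>2 = 21" using s2 by (simp add: power2_eq_square flip: of_real_mult)
  moreover have "complex_of_real (?f p) = 0" by (simp only: fp of_real_0)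
  moreover have "complex_of_real (6 * q) = complex_of_real (21 - 5 * s - 2 * s * p + (3 + s) * p\<^sup>2)"
    "complex_of_real (6 * r) = complex_of_real (15 - s + (2 * s - 6) * p - (3 + s) * p\<^sup>2)"
    by (simp_all only: q_def r_def) simp_all
  moreover have "(- \<i> * complex_of_real \<rho>)\<^sup>2 = (complex_of_real p)\<^sup>2 - 4"
    using \<rho>2 by (simp add: complex_eq_iff power2_eq_square)
  moreover have "- \<i> * complex_of_real \<rho> \<noteq> 0" using \<rho> by simp
  moreover have "\<i> * complex_of_real \<sigma> * (- \<i> * complex_of_real \<rho>) = complex_of_real (p * q - (q - p - r - 1))"
    "- \<i> * complex_of_real \<tau> * (- \<i> * complex_of_real \<rho>) = complex_of_real (p * r - (p - q - r - 1))"
    using \<rho> by (simp_all add: \<sigma>_def \<tau>_def complex_eq_iff)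
  ultimately have par: "(\<i> * complex_of_real \<sigma>)\<^sup>2 = (complex_of_real q)\<^sup>2 - 4"
    "(- \<i> * complex_of_real \<tau>)\<^sup>2 = (complex_of_real r)\<^sup>2 - 4"
    "cyclic_root (seq [1, (p + - \<i> * \<rho>) / 2, (q + \<i> * \<sigma>) / 2, (r + - \<i> * \<tau>) / 2, (r + - \<i> * \<tau>) / 2, (q + \<i> * \<sigma>) / 2, (p + - \<i> * \<rho>) / 2])"
    using cyclic_root_index3_param[of "complex_of_real s" "complex_of_real p" "complex_of_real q" "complex_of_real r"
      "- \<i> * complex_of_real \<rho>" "\<i> * complex_of_real \<sigma>" "- \<i> * complex_of_real \<tau>"]
    by simp_all
  have \<sigma>2: "\<sigma> * \<sigma> = 4 - q * q" and \<tau>2: "\<tau> * \<tau> = 4 - r * r"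
    using par(1,2) by (simp_all add: complex_eq_iff power2_eq_square)
  have \<sigma>: "1.9197 < \<sigma>" "\<sigma> < 1.92"
    by (rule sq_bounds[of \<sigma> "1.92" "1.9197"]; use qq \<sigma>2 pos in simp)+
  have \<tau>: "1.8423 < \<tau>" "\<tau> < 1.8427"
    by (rule sq_bounds[of \<tau> "1.8427" "1.8423"]; use rr \<tau>2 pos in simp)+
  have norm: "cmod ((of_real x + \<i> * of_real y) / 2) = 1" if "y * y = 4 - x * x" for x y
    using that by (simp add: cmod_def power2_eq_square field_simps)
  show ?thesis
  proof (rule that[OF par(3)])
    show "cmod ((p + - \<i> * \<rho>) / 2) = 1" using norm[of "- \<rho>" p] \<rho>2 by simp
    show "cmod ((q + \<i> * \<sigma>) / 2) = 1" by (rule norm) (rule \<sigma>2)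
    show "cmod ((r + - \<i> * \<tau>) / 2) = 1" using norm[of "- \<tau>" r] \<tau>2 by simp
    show "cmod ((p + - \<i> * \<rho>) / 2 - gval (817, -576) / 1000) \<le> 0.001"
      using p \<rho> by (intro gval_close) (simp add: abs_if)
    show "cmod ((q + \<i> * \<sigma>) / 2 - gval (280, 960) / 1000) \<le> 0.001"
      using q \<sigma> by (intro gval_close) (simp add: abs_if)
    show "cmod ((r + - \<i> * \<tau>) / 2 - gval (-389, -921) / 1000) \<le> 0.001"
      using r \<tau> by (intro gval_close) (simp add: abs_if)
  qed
qed

lemma index3_real_exists:
  obtains a b c where "cyclic_root (seq [1,of_real a,of_real b,of_real c,of_real c,of_real b,of_real a])"
    "\<bar>1000 * a - 365\<bar> \<le> 1" "\<bar>1000 * inverse a - 2739\<bar> \<le> 1"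
    "\<bar>1000 * b - 106\<bar> \<le> 1" "\<bar>1000 * inverse b - 9413\<bar> \<le> 1"
    "\<bar>1000 * c + 818\<bar> \<le> 1" "\<bar>1000 * inverse c + 1222\<bar> \<le> 1"
proof -
  define t where "t = sqrt 21"
  have t: "4.5825756 \<le> t" "t \<le> 4.5825757" and t2: "t * t = 21"
    using sqrt_21_bounds by (simp_all add: t_def)
  let ?f = "\<lambda>x. 2 * x ^ 3 - 2 * (6 - (- t)) * x\<^sup>2 + (3 - (- t)) * x + (61 - 13 * (- t))"
  have "\<exists>x\<ge>3.104. x \<le> 3.10401 \<and> ?f x = 0"
  proof (rule IVT2')
    show "?f 3.10401 \<le> 0" "0 \<le> ?f 3.104"
      using t by (simp_all add: power_numeral_reduce field_simps)
  qed (auto intro!: continuous_intros)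
  then obtain p where p: "3.104 \<le> p" "p \<le> 3.10401" and fp: "?f p = 0" by blast
  define q where "q = (21 - 5 * (- t) - 2 * (- t) * p + (3 + (- t)) * p\<^sup>2) / 6"
  define r where "r = (15 - (- t) + (2 * (- t) - 6) * p - (3 + (- t)) * p\<^sup>2) / 6"
  note pp = mult_bounds[OF p p] and sp = mult_bounds[OF t p]
  note spp = mult_bounds[OF t pp]
  have "6 * q = 21 + 5 * t + 2 * (t * p) + 3 * (p * p) - t * (p * p)"
    "6 * r = 15 + t - 2 * (t * p) - 6 * p - 3 * (p * p) + t * (p * p)"
    by (simp_all add: q_def r_def power2_eq_square field_simps)
  then have q: "9.5187 \<le> q" "q \<le> 9.5191" and r: "2.0403 \<le> - r" "- r \<le> 2.0405"
    using t p pp sp spp by simp_all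
  note qq = mult_bounds[OF q q] and rr = mult_bounds[OF r r] and pq = mult_bounds[OF p q] and pr = mult_bounds[OF p r]
  \<comment> \<open>Now \<open>p\<close>, \<open>q\<close> and \<open>- r\<close> exceed 2, so
    \<open>a\<close>, \<open>b\<close>, \<open>c\<close> are real; the sign \<open>- \<rho>\<close>
    selects the solution with \<open>a < 1\<close>.\<close>
  define \<rho> where "\<rho> = sqrt (p * p - 4)"
  have \<rho>2: "\<rho> * \<rho> = p * p - 4" using pp by (simp add: \<rho>_def)
  have \<rho>: "2.3737 < \<rho>" "\<rho> < 2.3739"
    by (rule sq_bounds[of \<rho> "2.3739" "2.3737"]; use pp \<rho>2 in \<open>simp add: \<rho>_def\<close>)+
  define \<sigma> where "\<sigma> = (p * q - (q - p - r - 1)) / \<rho>"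
  define \<tau> where "\<tau> = - (p * r - (p - q - r - 1)) / \<rho>"
  have pos: "\<sigma> \<ge> 0" "\<tau> \<ge> 0"
    using \<rho> p q r pq pr unfolding \<sigma>_def \<tau>_def by (auto intro!: divide_nonneg_pos)
  have "(complex_of_real (- t))\<^sup>2 = 21" using t2 by (simp add: power2_eq_square flip: of_real_mult)
  moreover have "complex_of_real (?f p) = 0" by (simp only: fp of_real_0)
  moreover have "complex_of_real (6 * q) = complex_of_real (21 - 5 * (- t) - 2 * (- t) * p + (3 + (- t)) * p\<^sup>2)"
    "complex_of_real (6 * r) = complex_of_real (15 - (- t) + (2 * (- t) - 6) * p - (3 + (- t)) * p\<^sup>2)"
    by (simp_all only: q_def r_def) simp_all
  moreover have "(complex_of_real (- \<rho>))\<^sup>2 = (complex_of_real p)\<^sup>2 - 4"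
    using \<rho>2 by (simp add: power2_eq_square flip: of_real_mult)
  moreover have "complex_of_real (- \<rho>) \<noteq> 0" using \<rho> by simp
  moreover have "complex_of_real (- \<sigma>) * complex_of_real (- \<rho>) = complex_of_real (p * q - (q - p - r - 1))"
    "complex_of_real \<tau> * complex_of_real (- \<rho>) = complex_of_real (p * r - (p - q - r - 1))"
    using \<rho> by (simp_all only: of_real_mult[symmetric] of_real_eq_iff) (simp_all add: \<sigma>_def \<tau>_def)
  ultimately have par: "(complex_of_real (- \<sigma>))\<^sup>2 = (complex_of_real q)\<^sup>2 - 4"
    "(complex_of_real \<tau>)\<^sup>2 = (complex_of_real r)\<^sup>2 - 4"
    "cyclic_root (seq [1, complex_of_real ((p - \<rho>) / 2), complex_of_real ((q - \<sigma>) / 2), complex_of_real ((r + \<tau>) / 2),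
        complex_of_real ((r + \<tau>) / 2), complex_of_real ((q - \<sigma>) / 2), complex_of_real ((p - \<rho>) / 2)])"
    using cyclic_root_index3_param[of "complex_of_real (- t)" "complex_of_real p" "complex_of_real q" "complex_of_real r"
      "complex_of_real (- \<rho>)" "complex_of_real (- \<sigma>)" "complex_of_real \<tau>"]
    by simp_all
  have \<sigma>2: "\<sigma> * \<sigma> = q * q - 4" and \<tau>2: "\<tau> * \<tau> = r * r - 4"
    using par(1,2) by (simp_all add: complex_eq_iff power2_eq_square)
  have \<sigma>: "9.306 < \<sigma>" "\<sigma> < 9.3068"
    by (rule sq_bounds[of \<sigma> "9.3068" "9.306"]; use qq \<sigma>2 pos in simp)+
  have \<tau>: "0.4034 < \<tau>" "\<tau> < 0.4047"
    by (rule sq_bounds[of \<tau> "0.4047" "0.4034"]; use rr \<tau>2 pos in simp)+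
  have inv: "inverse ((x - y) / 2) = (x + y) / 2" "inverse ((x + y) / 2) = (x - y) / 2" if "y * y = x * x - 4" for x y :: real
    by (rule inverse_unique; use that in \<open>simp add: field_simps\<close>)+
  show ?thesis
    by (rule that[OF par(3)]; (unfold inv[OF \<rho>2] inv[OF \<sigma>2] inv[OF \<tau>2])?)
      (use p q r \<rho> \<sigma> \<tau> in \<open>simp_all add: abs_le_iff field_simps\<close>)
qed

lemma index1_exists:
  obtains a :: real where "cyclic_root (seq [1,of_real a,of_real a,of_real a,of_real a,of_real a,of_real a])"
    "\<bar>1000 * a + 209\<bar> \<le> 1" "\<bar>1000 * inverse a + 4791\<bar> \<le> 1"
proof -
  define t where "t = sqrt 21"
  have t: "4.5825756 \<le> t" "t \<le> 4.5825757" and t2: "t * t = 21"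
    using sqrt_21_bounds by (simp_all add: t_def)
  have m: "(t - 5) / 2 * ((- t - 5) / 2) = 1" using t2 by (simp add: field_simps)
  have "inverse ((t - 5) / 2) = (- t - 5) / 2" by (rule inverse_unique) (rule m)
  moreover have "cyclic_root (seq [1,of_real ((t - 5) / 2),of_real ((t - 5) / 2),of_real ((t - 5) / 2),
      of_real ((t - 5) / 2),of_real ((t - 5) / 2),of_real ((t - 5) / 2)])"
  proof (rule cyclic_root_index1)
    show "of_real ((t - 5) / 2) * of_real ((- t - 5) / 2) = (1 :: complex)"
      unfolding of_real_mult[symmetric] m by simp
    show "of_real ((t - 5) / 2) + of_real ((- t - 5) / 2) + 5 = (0 :: complex)"
      by (simp add: field_simps)
  qed
  ultimately show ?thesis using t by (intro that[of "(t - 5) / 2"]) (simp_all add: abs_le_iff field_simps)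
qed

section \<open>Classification of the cyclic roots\<close>

text \<open>Quadratic phases: expanding \<open>a * (j - i)^2\<close> shows that their circulant
  matrix is, up to row and column phases, the matrix \<open>chi (- 2 * a * i * j)\<close>, a Fourier
  matrix when \<open>a\<close> is nonzero.\<close>

definition fourier :: "7 \<Rightarrow> 7 \<Rightarrow> 7 \<Rightarrow> complex" where
  "fourier a b k = chi (a * k * k + b * k)"

lemma fourier_ratio: "fourier a b k / fourier a b (k - d) = chi (b * d - a * d * d) * chi (k * (2 * a * d))"
  unfolding fourier_def chi_diff[symmetric] chi_add[symmetric] by (simp add: algebra_simps)

lemma mult_7_eq_0: "a * b = 0 \<longleftrightarrow> a = 0 \<or> b = 0" for a b :: 7
proof
  assume ab: "a * b = 0"
  show "a = 0 \<or> b = 0"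
  proof (cases "a = 0")
    case False
    then obtain u where "u * a = 1" using unit_7 by blast
    then have "b = u * (a * b)" by (simp add: mult.assoc[symmetric])
    then show ?thesis by (simp add: ab)
  qed simp
qed auto

lemma cyclic_root_fourier:
  assumes "a \<noteq> 0"
  shows "cyclic_root (fourier a b)"
  unfolding cyclic_root_def
proof (intro conjI allI impI)
  show "fourier a b k \<noteq> 0" for k by (simp add: fourier_def)
  fix d :: 7 assume "d \<noteq> 0"
  then have "2 * a * d \<noteq> 0" using assms by (simp add: mult_7_eq_0)
  then show "(\<Sum>k\<in>UNIV. fourier a b k / fourier a b (k - d)) = 0"
    by (simp only: fourier_ratio sum_distrib_left[symmetric] sum_chi) simp
qed

text \<open>For fixed \<open>d\<close> the ratio of entries is a multiple of a character of
  \<open>k\<close>, so the equation at \<open>d\<close> concerns the single Fourier coefficient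
  \<open>G t\<close> with \<open>t = 2 * a * d\<close> and multiplies it by
  \<open>1 - chi (d * (m + t))\<close>. Only the frequencies 0 and \<open>- m\<close>
  escape.\<close>

lemma nondeg_fourier:
  assumes a: "a \<noteq> 0"
  shows "nondeg m (fourier a b)"
  unfolding nondeg_def
proof (intro allI impI)
  fix g assume g: "tangent m (fourier a b) g"
  define G where "G = (\<lambda>t. \<Sum>k\<in>UNIV. chi (k * t) * g k)"
  have G0: "G t = 0" if "t \<noteq> 0" "t \<noteq> - m" for t
  proof -
    obtain v where v: "v * (2 * a) = 1" using unit_7[of "2 * a"] a by (auto simp: mult_7_eq_0)
    define d where "d = v * t"
    have "2 * a * d = (v * (2 * a)) * t" unfolding d_def by (simp only: mult_ac)
    then have t: "t = 2 * a * d" unfolding v by simp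
    have d: "d \<noteq> 0" using t that by auto
    have "(\<Sum>k\<in>UNIV. chi (k * t) * g (k - d)) = (\<Sum>k\<in>UNIV. chi ((k + d) * t) * g (k + d - d))"
      by (rule sum_shift[symmetric])
    also have "\<dots> = chi (d * t) * G t"
      unfolding G_def sum_distrib_left by (intro sum.cong refl) (simp add: distrib_right chi_add)
    finally have sh: "(\<Sum>k\<in>UNIV. chi (k * t) * g (k - d)) = chi (d * t) * G t" .
    have gt: "(\<Sum>k\<in>UNIV. chi (k * t) * g k) = G t" by (simp add: G_def)
    have "0 = (\<Sum>k\<in>UNIV. chi (b * d - a * d * d) * chi (k * t) * (g k - chi (m * d) * g (k - d)))"
      using g by (simp add: tangent_def fourier_ratio t)
    also have "\<dots> = chi (b * d - a * d * d) * ((\<Sum>k\<in>UNIV. chi (k * t) * g k) - chi (m * d) * (\<Sum>k\<in>UNIV. chi (k * t) * g (k - d)))"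
      by (simp add: sum_distrib_left sum_subtractf[symmetric] algebra_simps)
    also have "\<dots> = chi (b * d - a * d * d) * ((1 - chi (d * (m + t))) * G t)"
      unfolding sh gt by (simp add: algebra_simps chi_add)
    finally have "chi (d * (m + t)) = 1 \<or> G t = 0" by simp
    moreover have "d * (m + t) \<noteq> 0"
      using d that by (auto simp: mult_7_eq_0 add_eq_0_iff2)
    ultimately show ?thesis by (simp add: chi_eq_1_iff)
  qed
  have inv: "7 * g k = (\<Sum>t\<in>UNIV. chi (- (t * k)) * G t)" for k
  proof -
    have "(\<Sum>t\<in>UNIV. chi (- (t * k)) * G t) = (\<Sum>j\<in>UNIV. (\<Sum>t\<in>UNIV. chi (t * (j - k))) * g j)"
    proof -
      have c: "chi (t * (j - k)) = chi (- (t * k)) * chi (j * t)" for t j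
        unfolding chi_add[symmetric] by (simp add: algebra_simps)
      show ?thesis
        unfolding G_def sum_distrib_left sum_distrib_right c mult.assoc by (rule sum.swap)
    qed
    also have "\<dots> = (\<Sum>j\<in>UNIV. if j = k then 7 * g j else 0)"
      unfolding sum_chi by (intro sum.cong refl) simp
    also have "\<dots> = 7 * g k" by simp
    finally show ?thesis by simp
  qed
  \<comment> \<open>For \<open>m = 0\<close> the two surviving frequencies coincide and must be
    counted once.\<close>
  have "g k = G 0 / 7 + (if m = 0 then 0 else G (- m) / 7) * chi (m * k)" for k
  proof -
    have "7 * g k = (\<Sum>t\<in>{0, - m}. chi (- (t * k)) * G t)"
      unfolding inv by (rule sum.mono_neutral_right) (use G0 in auto)
    then show ?thesis by (cases "m = 0") (simp_all add: field_simps)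
  qed
  then show "\<exists>\<alpha> \<beta>. \<forall>k. g k = \<alpha> + \<beta> * chi (m * k)" by blast
qed

lemma fourier_inj: "inj_on (\<lambda>(a, b). fourier a b) UNIV"
proof (rule inj_onI, clarify)
  fix a b a' b' assume e: "fourier a b = fourier a' b'"
  have 1: "a + b = a' + b'" using fun_cong[OF e, of 1] by (simp add: fourier_def chi_eq_iff)
  have 2: "a - b = a' - b'" using fun_cong[OF e, of "- 1"] by (simp add: fourier_def chi_eq_iff)
  have "2 * (a - a') = ((a + b) - (a' + b')) + ((a - b) - (a' - b'))" by simp
  then have "2 * (a - a') = 0" unfolding 1 2 by simp
  from this[unfolded mult_7_eq_0] have "a = a'" by simp
  with 1 show "a = a' \<and> b = b'" by simp
qed

text \<open>Modulations and, up to a scalar, the quadratic phases are invisible on 7th powers.\<close>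
definition admissible :: "(7 \<Rightarrow> complex) \<Rightarrow> bool" where
  "admissible y \<longleftrightarrow> cyclic_root y \<and> y 0 = 1 \<and> nondeg 0 y
     \<and> ((\<forall>k. cmod (y k) = 1) \<longrightarrow> (\<forall>m. nondeg m y))
     \<and> (\<exists>k. y k ^ 7 \<noteq> 1)
     \<and> ((\<forall>k. y (- k) = y k) \<or> (\<forall>k. y (2 * k) = y k) \<and> (\<exists>k. y (- k) ^ 7 \<noteq> y k ^ 7))"

section \<open>Distinctness of the translates of admissible roots\<close>

lemma admissible_inverse:
  assumes "admissible y"
  shows "admissible (\<lambda>k. inverse (y k))"
proof -
  have y: "\<And>k. y k \<noteq> 0" using assms by (simp add: admissible_def cyclic_root_def)
  then show ?thesis
    using assms unfolding admissible_def
    by (auto simp: cyclic_root_inverse nondeg_inverse norm_inverse power_inverse)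
qed

lemma admissible_unit:
  assumes "admissible y" and u: "v * u = 1"
  shows "admissible (\<lambda>k. y (u * k))"
proof -
  have k: "u * (v * k) = k" for k using u by (metis mult.assoc mult.commute mult_1)
  have "(\<exists>k. y (u * k) ^ 7 \<noteq> 1)" using assms(1) k unfolding admissible_def by metis
  moreover have "(\<forall>k. y (- (u * k)) = y (u * k)) \<or> (\<forall>k. y (u * (2 * k)) = y (u * k)) \<and> (\<exists>k. y (- (u * k)) ^ 7 \<noteq> y (u * k) ^ 7)"
    using assms(1) k unfolding admissible_def by (metis mult.left_commute)
  moreover have "\<forall>m. nondeg m (\<lambda>k. y (u * k))" if "\<forall>k. cmod (y (u * k)) = 1"
  proof -
    have "\<forall>k. cmod (y k) = 1" using that k by metis
    then show ?thesis using assms(1) nondeg_unit[OF _ u] unfolding admissible_def by blast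
  qed
  moreover have "nondeg 0 (\<lambda>k. y (u * k))"
    using nondeg_unit[OF _ u, of 0 y] assms(1) by (simp add: admissible_def)
  ultimately show ?thesis
    using assms(1) cyclic_root_unit[OF _ u] unfolding admissible_def by auto
qed

lemma periodic_const:
  fixes z :: "7 \<Rightarrow> complex"
  assumes "\<And>k. z (k + h) = z k" "h \<noteq> 0"
  shows "z k = z 0"
proof -
  obtain u where u: "u * h = 1" using unit_7 assms(2) by blast
  have "z (of_nat n * h) = z 0" for n
    by (induction n) (simp_all add: distrib_right assms(1) add.commute[of h])
  from this[of "rep (k * u)"] show ?thesis using u by (simp add: mult.assoc)
qed

text \<open>Seventh powers remove the modulation, leaving a shift by \<open>t\<close> up to a
  scalar. If both functions are even, or both invariant under doubling, the symmetries about 0 and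
  about the shifted point compose to a translation by \<open>2 * t\<close> or \<open>t\<close>; a
  nonconstant function on a group of prime order has no period, so \<open>t = 0\<close>. Once
  \<open>t\<close> is 0, comparing values at 1 and -1, or at 1 and 2, gives
  \<open>e = 0\<close>.\<close>

lemma admissible_rigid:
  assumes y: "admissible y" and y': "admissible y'"
    and rel: "\<And>k. y' k = c * chi (e * k) * y (k - t)"
  shows "t = 0" "e = 0" "y' = y"
proof -
  define z z' where "z = (\<lambda>k. y k ^ 7)" and "z' = (\<lambda>k. y' k ^ 7)"
  have zz: "z' k = c ^ 7 * z (k - t)" for k
    by (simp add: z_def z'_def rel power_mult_distrib chi_power_7)
  have c: "c ^ 7 \<noteq> 0" using rel[of 0] y' by (auto simp: admissible_def)
  have z0: "z 0 = 1" "z' 0 = 1" using y y' by (simp_all add: z_def z'_def admissible_def)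
  have nc: "\<exists>k. z k \<noteq> z 0" "\<exists>k. z' k \<noteq> z' 0"
    using y y' z0 by (auto simp: z_def z'_def admissible_def)
  have zz': "z k = z' (k + t) / c ^ 7" for k using zz[of "k + t"] c by simp
  have cases: "(\<forall>k. y (- k) = y k) \<or> (\<forall>k. y (2 * k) = y k) \<and> (\<exists>k. z (- k) \<noteq> z k)"
    "(\<forall>k. y' (- k) = y' k) \<or> (\<forall>k. y' (2 * k) = y' k) \<and> (\<exists>k. z' (- k) \<noteq> z' k)"
    using y y' unfolding z_def z'_def admissible_def by simp_all
  \<comment> \<open>Doubling carries the reflection centre \<open>h\<close> to \<open>2 * h\<close>;
    the two reflections compose to a translation by \<open>2 * h\<close>, whence
    \<open>h = 0\<close>. But then \<open>w'\<close> would be even.\<close>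
  have mixed: False
    if w: "\<forall>k. w (- k) = w k" and w': "\<forall>k. w' (2 * k) = w' k" "\<exists>k. w' (- k) \<noteq> w' k" "\<exists>k. w' k \<noteq> w' 0"
      and r: "\<And>k. w' (k + h) = C * w k" for w w' :: "7 \<Rightarrow> complex" and h C
  proof -
    have s: "w' (h + k) = w' (h - k)" for k using r[of k] r[of "- k"] w by (simp add: add.commute)
    have s1: "w' k = w' (2 * h - k)" for k using s[of "k - h"] by (simp add: algebra_simps)
    have s2: "w' k = w' (4 * h - k)" for k
    proof -
      have i: "2 * (4 * k) = k" for k :: 7
      proof -
        have "2 * (4 * k) = (2 * 4) * k" by (simp only: mult.assoc)
        also have "(2 * 4 :: 7) = 1" by simp
        finally show ?thesis by simp
      qed
      have "w' k = w' (4 * k)" using w'(1) i by metis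
      also have "\<dots> = w' (2 * h - 4 * k)" by (rule s1)
      also have "\<dots> = w' (2 * (2 * h - 4 * k))" by (simp only: w'(1)[rule_format])
      also have "2 * (2 * h - 4 * k) = 4 * h - k" using i[of k] by (simp add: right_diff_distrib mult.assoc[symmetric])
      finally show ?thesis .
    qed
    have "w' (k + 2 * h) = w' k" for k
    proof -
      have "w' (k + 2 * h) = w' (4 * h - (k + 2 * h))" by (rule s2)
      also have "4 * h - (k + 2 * h) = 2 * h - k" by (simp add: algebra_simps)
      finally show ?thesis by (simp only: s1[symmetric])
    qed
    then have "2 * h = 0" using periodic_const[of w' "2 * h"] w'(3) by blast
    then have "h = 0" by (simp add: mult_7_eq_0)
    then show False using s w'(2) by simp
  qed
  have sym: "(\<forall>k. y (- k) = y k) \<and> (\<forall>k. y' (- k) = y' k) \<or> (\<forall>k. y (2 * k) = y k) \<and> (\<forall>k. y' (2 * k) = y' k)"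
  proof -
    have r1: "z' (k + t) = c ^ 7 * z k" for k by (simp add: zz)
    have r2: "z (k + - t) = 1 / c ^ 7 * z' k" for k by (simp add: zz')
    note m1 = mixed[of z z' t "c ^ 7", OF _ _ _ _ r1] and m2 = mixed[of z' z "- t" "1 / c ^ 7", OF _ _ _ _ r2]
    from cases show ?thesis
    proof (elim disjE)
      assume e: "\<forall>k. y (- k) = y k" "(\<forall>k. y' (2 * k) = y' k) \<and> (\<exists>k. z' (- k) \<noteq> z' k)"
      have "\<forall>k. z (- k) = z k" "\<forall>k. z' (2 * k) = z' k" using e by (simp_all add: z_def z'_def)
      then show ?thesis using m1 nc e by blast
    next
      assume e: "(\<forall>k. y (2 * k) = y k) \<and> (\<exists>k. z (- k) \<noteq> z k)" "\<forall>k. y' (- k) = y' k"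
      have "\<forall>k. z (2 * k) = z k" "\<forall>k. z' (- k) = z' k" using e by (simp_all add: z_def z'_def)
      then show ?thesis using m2 nc e by blast
    qed simp_all
  qed
  show t: "t = 0"
  proof (rule ccontr)
    assume "t \<noteq> 0"
    from sym show False
    proof (elim disjE conjE)
      assume "\<forall>k. y (- k) = y k" "\<forall>k. y' (- k) = y' k"
      then have e: "\<forall>k. z (- k) = z k" "\<forall>k. z' (- k) = z' k" by (simp_all add: z_def z'_def)
      have "z (k + 2 * t) = z k" for k
      proof -
        have "z' (k + t) = z' (- (k + t))" by (rule e(2)[rule_format, symmetric])
        then have "z k = z (- (k + 2 * t))" using c by (simp add: zz algebra_simps)
        also have "\<dots> = z (k + 2 * t)" by (rule e(1)[rule_format])
        finally show ?thesis ..
      qed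
      moreover have "2 * t \<noteq> 0" using \<open>t \<noteq> 0\<close> by (simp add: mult_7_eq_0)
      ultimately show False using periodic_const[of z "2 * t"] nc by blast
    next
      assume "\<forall>k. y (2 * k) = y k" "\<forall>k. y' (2 * k) = y' k"
      then have e: "\<forall>k. z (2 * k) = z k" "\<forall>k. z' (2 * k) = z' k" by (simp_all add: z_def z'_def)
      have i: "2 * (4 * k) = k" for k :: 7
      proof -
        have "2 * (4 * k) = (2 * 4) * k" by (simp only: mult.assoc)
        also have "(2 * 4 :: 7) = 1" by simp
        finally show ?thesis by simp
      qed
      have "z (k + t) = z k" for k
      proof -
        \<comment> \<open>As 4 inverts 2 modulo 7, \<open>2 * j - t = k + t\<close> and
          \<open>2 * (j - t) = k\<close>.\<close>
        define j where "j = 4 * (k + 2 * t)"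
        have "z' (2 * j) = z' j" using e by simp
        then have "z (2 * j - t) = z (j - t)" using c by (simp add: zz)
        also have "\<dots> = z (2 * (j - t))" by (rule e(1)[rule_format, symmetric])
        finally show ?thesis unfolding j_def right_diff_distrib i by (simp add: algebra_simps)
      qed
      then show False using periodic_const[of z t] nc \<open>t \<noteq> 0\<close> by blast
    qed
  qed
  have r: "y' k = chi (e * k) * y k" for k
    using rel[of 0] rel[of k] y y' t by (simp add: admissible_def)
  show "e = 0"
  proof -
    have y0: "y k \<noteq> 0" for k using y by (simp add: admissible_def cyclic_root_def)
    from sym show ?thesis
    proof (elim disjE conjE)
      assume 1: "\<forall>k. y (- k) = y k" "\<forall>k. y' (- k) = y' k"
      have "chi (e * (- 1)) * y (- 1) = chi (e * 1) * y 1"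
        unfolding r[symmetric] by (rule 1(2)[rule_format])
      then have "chi (- e) = chi e" using y0[of 1] 1(1)[rule_format, of 1] by simp
      then have "2 * e = 0" unfolding chi_eq_iff by (metis add.right_inverse mult_2)
      then show ?thesis by (simp add: mult_7_eq_0)
    next
      assume 2: "\<forall>k. y (2 * k) = y k" "\<forall>k. y' (2 * k) = y' k"
      have "chi (e * (2 * 1)) * y (2 * 1) = chi (e * 1) * y 1"
        unfolding r[symmetric] by (rule 2(2)[rule_format])
      then have "chi (e * 2) = chi e" using y0[of 1] 2(1)[rule_format, of 1] by simp
      then show ?thesis unfolding chi_eq_iff by (metis add_cancel_right_left mult.commute mult_2)
    qed
  qed
  then show "y' = y" using r by auto
qed

lemma translate_inj: "inj_on (\<lambda>(y, a, b). translate a b y) ({y. admissible y} \<times> UNIV)"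
proof (rule inj_onI)
  fix p p' :: "(7 \<Rightarrow> complex) \<times> 7 \<times> 7"
  assume pp: "p \<in> {y. admissible y} \<times> UNIV" "p' \<in> {y. admissible y} \<times> UNIV"
    "(case p of (y, a, b) \<Rightarrow> translate a b y) = (case p' of (y, a, b) \<Rightarrow> translate a b y)"
  obtain y a b y' a' b' where p: "p = (y, a, b)" "p' = (y', a', b')" by (metis surj_pair)
  have y: "admissible y" and y': "admissible y'" and e: "translate a b y = translate a' b' y'"
    using pp p by simp_all
  have nz: "y k \<noteq> 0" "y' k \<noteq> 0" for k using y y' by (auto simp: admissible_def cyclic_root_def)
  have "y' k = (y' (- a') / y (- a) * chi (b * a') / chi (b' * a')) * chi ((b - b') * k) * y (k - (a - a'))" for k
  proof -
    have "chi (b' * (k + a')) * y' k / y' (- a') = chi (b * (k + a')) * y (k + a' - a) / y (- a)"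
      using fun_cong[OF e, of "k + a'"] by (simp add: translate_def)
    moreover have "k + a' - a = k - (a - a')" by simp
    ultimately show ?thesis
      using nz[of "- a"] nz[of "- a'"] nz[of k] by (simp add: distrib_left chi_add left_diff_distrib chi_diff field_simps)
  qed
  from admissible_rigid[OF y y' this] show "p = p'" unfolding p by auto
qed

lemma translate_not_fourier:
  assumes "admissible y"
  shows "translate a b y \<noteq> fourier a' b'"
proof
  assume e: "translate a b y = fourier a' b'"
  have nz: "y k \<noteq> 0" for k using assms by (auto simp: admissible_def cyclic_root_def)
  have "y k ^ 7 = y (- a) ^ 7" for k
  proof -
    have "translate a b y (k + a) ^ 7 = 1" by (simp add: e fourier_def chi_power_7)
    then show ?thesis using nz[of "- a"] by (simp add: translate_def power_mult_distrib power_divide chi_power_7)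
  qed
  moreover from this[of 0] have "y (- a) ^ 7 = 1" using assms by (simp add: admissible_def)
  ultimately have "y k ^ 7 = 1" for k by metis
  then show False using assms by (auto simp: admissible_def)
qed

lemma unimodular_roots_nondeg:
  assumes Y: "finite Y" "card Y = 18" "\<And>y. y \<in> Y \<Longrightarrow> admissible y"
    and z: "cyclic_root z" "z 0 = 1" "\<And>k. cmod (z k) = 1"
  shows "nondeg m z"
proof -
  define K1 where "K1 = (\<lambda>(y, a, b). translate a b y) ` (Y \<times> (UNIV :: (7 \<times> 7) set))"
  define K2 where "K2 = (\<lambda>(a, b). fourier a b) ` ((UNIV - {0}) \<times> (UNIV :: 7 set))"
  have K1_iff: "x \<in> K1 \<longleftrightarrow> (\<exists>y a b. y \<in> Y \<and> x = translate a b y)" for x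
    unfolding K1_def image_iff Bex_def by auto
  have K2_iff: "x \<in> K2 \<longleftrightarrow> (\<exists>a b. a \<noteq> 0 \<and> x = fourier a b)" for x
    unfolding K2_def by force
  have "card K1 = card (Y \<times> (UNIV :: (7 \<times> 7) set))"
    unfolding K1_def by (rule card_image) (rule inj_on_subset[OF translate_inj], use Y in auto)
  then have c1: "card K1 = 882" using Y by (simp add: card_cartesian_product)
  have "card K2 = card ((UNIV - {0 :: 7}) \<times> (UNIV :: 7 set))"
    unfolding K2_def by (rule card_image) (rule inj_on_subset[OF fourier_inj], auto)
  then have c2: "card K2 = 42" by (simp add: card_cartesian_product)
  have "K1 \<inter> K2 = {}" using Y(3) translate_not_fourier by (auto simp: K1_iff K2_iff)
  moreover have fin: "finite K1" "finite K2" using Y(1) by (auto simp: K1_def K2_def)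
  ultimately have c: "card (K1 \<union> K2) = 924" by (simp add: card_Un_disjoint c1 c2)
  have nz: "y k \<noteq> 0" if "y \<in> Y" for y k using Y(3)[OF that] by (auto simp: admissible_def cyclic_root_def)
  have "z \<in> K1 \<union> K2"
  proof (rule cyclic_roots_complete[OF _ _ _ _ _ z(1,2)])
    show "finite (K1 \<union> K2)" "card (K1 \<union> K2) \<ge> 924" using fin c by simp_all
    fix x assume "x \<in> K1 \<union> K2"
    then consider y a b where "y \<in> Y" "x = translate a b y" | a b where "a \<noteq> 0" "x = fourier a b"
      unfolding K1_iff K2_iff Un_iff by blast
    then have "cyclic_root x \<and> x 0 = 1 \<and> nondeg 0 x"
    proof cases
      case 1
      then show ?thesis
        using Y(3)[OF 1(1)] nz[OF 1(1)] cyclic_root_translate[of y a b] nondeg_translate[of y 0 a b]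
        by (simp add: admissible_def) (simp add: translate_def)
    next
      case 2
      then show ?thesis using cyclic_root_fourier nondeg_fourier by (simp add: fourier_def)
    qed
    then show "cyclic_root x" "x 0 = 1" "nondeg 0 x" by simp_all
  qed
  then consider y a b where "y \<in> Y" "z = translate a b y" | a b where "a \<noteq> 0" "z = fourier a b"
    unfolding K1_iff K2_iff Un_iff by blast
  then show ?thesis
  proof cases
    case 1
    have ad: "admissible y" by (rule Y(3)) fact
    \<comment> \<open>A translate of \<open>y\<close> can only be unimodular if \<open>y\<close> has
      constant modulus, and \<open>y 0 = 1\<close> makes that constant 1; so admissibility gives all
      characters for \<open>y\<close>.\<close>
    have "cmod (y k) = cmod (y (- a))" for k
      using z(3)[of "k + a"] nz[OF 1(1), of "- a"] by (simp add: 1(2) translate_def norm_mult norm_divide)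
    moreover from this[of 0] have "cmod (y (- a)) = 1" using ad by (simp add: admissible_def)
    ultimately have "\<forall>k. cmod (y k) = 1" by metis
    then show ?thesis using ad 1 nz[OF 1(1)] nondeg_translate[of y m a b] by (simp add: admissible_def)
  next
    case 2
    then show ?thesis by (simp add: nondeg_fourier)
  qed
qed

section \<open>The eighteen roots are admissible and distinct\<close>

text \<open>With \<open>p = z + 1/z\<close>, the cubic times \<open>z^3\<close> is
  \<open>(z^7 - 1) / (z - 1)\<close>. A rough enclosure of the real part is then enough to refute
  that an entry is a seventh root of unity.\<close>

lemma seventh_root_unimodular:
  assumes "cmod z = 1" "z ^ 7 = 1" "z \<noteq> 1" and p: "p = 2 * Re z"
  shows "p ^ 3 + p\<^sup>2 - 2 * p - 1 = 0"
proof -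
  define P where "P = complex_of_real p"
  have zz: "z * cnj z = 1" using assms(1) complex_norm_square[of z] by simp
  have "z + cnj z = P" by (simp add: P_def p complex_eq_iff)
  then have "P * z = z\<^sup>2 + z * cnj z" by (auto simp: algebra_simps power2_eq_square)
  then have "z\<^sup>2 + 1 = P * z" using zz by simp
  then have "(z - 1) * z ^ 3 * (P ^ 3 + P\<^sup>2 - 2 * P - 1) = z ^ 7 - 1" by algebra
  moreover have "z \<noteq> 0" using assms(1) by auto
  ultimately have "P ^ 3 + P\<^sup>2 - 2 * P - 1 = 0" using assms(2,3) by simp
  then have "complex_of_real (p ^ 3 + p\<^sup>2 - 2 * p - 1) = 0" by (simp add: P_def)
  then show ?thesis by (simp only: of_real_eq_0_iff)
qed

lemma close_bounds:
  assumes "cmod (z - gval (a, b) / 1000) \<le> 0.001"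
  shows "\<bar>1000 * Re z - of_int a\<bar> \<le> 1" "\<bar>1000 * Im z - of_int b\<bar> \<le> 1"
proof -
  have "\<bar>Re z - of_int a / 1000\<bar> \<le> 0.001" "\<bar>Im z - of_int b / 1000\<bar> \<le> 0.001"
    using assms abs_Re_le_cmod[of "z - gval (a, b) / 1000"] abs_Im_le_cmod[of "z - gval (a, b) / 1000"]
    by (simp_all add: gval_def)
  then show "\<bar>1000 * Re z - of_int a\<bar> \<le> 1" "\<bar>1000 * Im z - of_int b\<bar> \<le> 1"
    by (simp_all add: abs_le_iff field_simps)
qed

lemma admissible_index2:
  assumes root: "cyclic_root (seq [1,1,1,d,1,d,d])" and uni: "cmod d = 1"
    and d: "cmod (d - gval (-750, 661) / 1000) \<le> 0.001"
  shows "admissible (seq [1,1,1,d,1,d,d])"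
proof -
  let ?x = "seq [1,1,1,d,1,d,d]"
  have n: "1.498 \<le> - (2 * Re d)" "- (2 * Re d) \<le> 1.502" using close_bounds(1)[OF d] by (simp_all add: abs_le_iff)
  have "d ^ 7 \<noteq> 1"
  proof
    assume "d ^ 7 = 1"
    moreover have "d \<noteq> 1" using n by auto
    ultimately have "(2 * Re d) ^ 3 + (2 * Re d)\<^sup>2 - 2 * (2 * Re d) - 1 = 0"
      using seventh_root_unimodular[OF uni] by blast
    moreover define t where "t = - (2 * Re d)"
    ultimately have e: "- (t * (t * t)) + t * t + 2 * t - 1 = 0"
      by (simp add: power2_eq_square power3_eq_cube)
    have t: "1.498 \<le> t" "t \<le> 1.502" using n by (simp_all add: t_def)
    from mult_bounds[OF t mult_bounds[OF t t]] mult_bounds[OF t t] t e show False by simp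
  qed
  moreover have "\<forall>k. ?x (2 * k) = ?x k" unfolding all_7 by (simp add: numerals_7)
  \<comment> \<open>The residue 1 is a square and -1 is not, so position 1 witnesses that the
    seventh powers are not even.\<close>
  moreover have "?x (- 1) = d"
  proof -
    have m: "- 1 = (6::7)" by simp
    show ?thesis unfolding m by simp
  qed
  ultimately show ?thesis
    using nondeg_index2[OF root uni d] root unfolding admissible_def
    by (metis power_one seq_simps(1) seq_simps(2))
qed

lemma admissible_even:
  assumes root: "cyclic_root (seq [1,a,b,c,c,b,a])" and nd: "nondeg 0 (seq [1,a,b,c,c,b,a])"
    and uni: "(\<forall>k. cmod (seq [1,a,b,c,c,b,a] k) = 1) \<longrightarrow> (\<forall>m. nondeg m (seq [1,a,b,c,c,b,a]))"
    and "a ^ 7 \<noteq> 1"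
  shows "admissible (seq [1,a,b,c,c,b,a])"
proof -
  have m: "- 1 = (6::7)" "- 2 = (5::7)" "- 3 = (4::7)" "- 4 = (3::7)" "- 5 = (2::7)" "- 6 = (1::7)" by simp_all
  have "\<forall>k. seq [1,a,b,c,c,b,a] (- k) = seq [1,a,b,c,c,b,a] k" unfolding all_7 by (simp add: m)
  moreover have "seq [1,a,b,c,c,b,a] 1 ^ 7 \<noteq> 1" using assms(4) by simp
  moreover have "seq [1,a,b,c,c,b,a] 0 = 1" by simp
  ultimately show ?thesis using root nd uni unfolding admissible_def by blast
qed

lemma admissible_index3:
  assumes root: "cyclic_root (seq [1,a,b,c,c,b,a])" and uni: "cmod a = 1" "cmod b = 1" "cmod c = 1"
    and a: "cmod (a - gval (817, -576) / 1000) \<le> 0.001"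
    and b: "cmod (b - gval (280, 960) / 1000) \<le> 0.001"
    and c: "cmod (c - gval (-389, -921) / 1000) \<le> 0.001"
  shows "admissible (seq [1,a,b,c,c,b,a])"
proof (rule admissible_even[OF root])
  show "a ^ 7 \<noteq> 1"
  proof
    assume "a ^ 7 = 1"
    have t: "1.632 \<le> 2 * Re a" "2 * Re a \<le> 1.636" using close_bounds(1)[OF a] by (simp_all add: abs_le_iff)
    define t where "t = 2 * Re a"
    have "a \<noteq> 1" using t by auto
    then have "t ^ 3 + t\<^sup>2 - 2 * t - 1 = 0"
      using seventh_root_unimodular[OF uni(1) \<open>a ^ 7 = 1\<close>] t_def by blast
    then have e: "t * (t * t) + t * t - 2 * t - 1 = 0"
      by (simp add: power2_eq_square power3_eq_cube)
    have t: "1.632 \<le> t" "t \<le> 1.636" using t by (simp_all add: t_def)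
    from mult_bounds[OF t mult_bounds[OF t t]] mult_bounds[OF t t] t e show False by simp
  qed
qed (use nondeg_index3[OF root uni a b c] in simp_all)

lemma real_not_seventh_root:
  assumes "\<bar>a\<bar> < 1"
  shows "complex_of_real a ^ 7 \<noteq> 1"
proof
  assume "complex_of_real a ^ 7 = 1"
  then have "\<bar>a\<bar> ^ 7 = 1" by (metis norm_of_real norm_one norm_power)
  then show False using power_less_one_iff[of "\<bar>a\<bar>" 7] assms by simp
qed

lemma admissible_index3_real:
  assumes root: "cyclic_root (seq [1,of_real a,of_real b,of_real c,of_real c,of_real b,of_real a])"
    and a: "\<bar>1000 * a - 365\<bar> \<le> 1" "\<bar>1000 * inverse a - 2739\<bar> \<le> 1"
    and b: "\<bar>1000 * b - 106\<bar> \<le> 1" "\<bar>1000 * inverse b - 9413\<bar> \<le> 1"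
    and c: "\<bar>1000 * c + 818\<bar> \<le> 1" "\<bar>1000 * inverse c + 1222\<bar> \<le> 1"
  shows "admissible (seq [1,of_real a,of_real b,of_real c,of_real c,of_real b,of_real a])"
proof (rule admissible_even[OF root])
  have 1: "\<bar>a\<bar> < 1" using a(1) by (simp add: abs_if split: if_splits)
  then show "complex_of_real a ^ 7 \<noteq> 1" by (rule real_not_seventh_root)
  have "cmod (seq [1,of_real a,of_real b,of_real c,of_real c,of_real b,of_real a] 1) \<noteq> 1" using 1 by simp
  then show "(\<forall>k. cmod (seq [1,of_real a,of_real b,of_real c,of_real c,of_real b,of_real a] k) = 1)
    \<longrightarrow> (\<forall>m. nondeg m (seq [1,of_real a,of_real b,of_real c,of_real c,of_real b,of_real a]))" by blast
  have "cmod (complex_of_real x - gval (n, 0) / 1000) \<le> 0.001" if "\<bar>1000 * x - of_int n\<bar> \<le> 1" for x n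
    by (rule gval_close) (use that in simp)
  then show "nondeg 0 (seq [1,of_real a,of_real b,of_real c,of_real c,of_real b,of_real a])"
    by (intro nondeg_index3_real root) (use a b c in \<open>simp_all flip: of_real_inverse\<close>)
qed

text \<open>All ratios are 1 except at \<open>k = 0\<close> and \<open>k = d\<close>, and the
  differences \<open>g k - g (k - d)\<close> sum to zero. What remains couples only
  \<open>h d\<close> and \<open>h (- d)\<close>, with determinant \<open>a^2 - 1\<close>, so no
  numerical inverse is needed.\<close>

lemma nondeg_index1:
  assumes a: "a \<noteq> 0" "a\<^sup>2 \<noteq> 1"
  shows "nondeg 0 (seq [1,a,a,a,a,a,a])"
  unfolding nondeg_def
proof (intro allI impI)
  let ?x = "seq [1,a,a,a,a,a,a]"
  fix g assume g: "tangent 0 ?x g"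
  define h where "h = (\<lambda>k. g k - g 0)"
  have x: "?x k = (if k = 0 then 1 else a)" for k
    using all_7[of "\<lambda>k. ?x k = (if k = 0 then 1 else a)"] by simp
  have eq: "a * h d + h (- d) = 0" if d: "d \<noteq> 0" for d
  proof -
    have "0 = (\<Sum>k\<in>UNIV. ?x k / ?x (k - d) * (g k - g (k - d)))"
      using g by (simp add: tangent_def)
    also have "\<dots> = (\<Sum>k\<in>UNIV. (g k - g (k - d)) + ((if k = 0 then (1 / a - 1) * (g 0 - g (- d)) else 0)
        + (if k = d then (a - 1) * (g d - g 0) else 0)))"
      using d a by (intro sum.cong refl) (auto simp: x field_simps)
    also have "\<dots> = (\<Sum>k\<in>UNIV. g k) - (\<Sum>k\<in>UNIV. g (k + - d)) + ((1 / a - 1) * (g 0 - g (- d)) + (a - 1) * (g d - g 0))"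
      by (simp add: sum.distrib sum_subtractf)
    also have "(\<Sum>k\<in>UNIV. g (k + - d)) = (\<Sum>k\<in>UNIV. g k)" by (rule sum_shift)
    finally have "0 = (1 / a - 1) * (- h (- d)) + (a - 1) * h d" by (simp add: h_def)
    moreover have "(a - 1) * (a * h d + h (- d)) = a * ((1 / a - 1) * (- h (- d)) + (a - 1) * h d)"
      using a by (simp add: field_simps)
    ultimately have "(a - 1) * (a * h d + h (- d)) = 0" by simp
    then show ?thesis using a by auto
  qed
  have "h d = 0" for d
  proof (cases "d = 0")
    case False
    then have "a * h d + h (- d) = 0" "a * h (- d) + h d = 0" using eq[of d] eq[of "- d"] by simp_all
    then have "(a\<^sup>2 - 1) * h d = 0" by algebra
    then show ?thesis using a by simp
  qed (simp add: h_def)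
  then have "g k = g 0 + 0 * chi (0 * k)" for k by (simp add: h_def)
  then show "\<exists>\<alpha> \<beta>. \<forall>k. g k = \<alpha> + \<beta> * chi (0 * k)" by blast
qed

lemma admissible_index1:
  assumes root: "cyclic_root (seq [1,of_real a,of_real a,of_real a,of_real a,of_real a,of_real a])"
    and a: "\<bar>1000 * a + 209\<bar> \<le> 1"
  shows "admissible (seq [1,of_real a,of_real a,of_real a,of_real a,of_real a,of_real a])"
proof (rule admissible_even[OF root])
  have 1: "\<bar>a\<bar> < 1" "a \<noteq> 0" using a by (auto simp: abs_if split: if_splits)
  then show "complex_of_real a ^ 7 \<noteq> 1" by (intro real_not_seventh_root)
  have "cmod (seq [1,of_real a,of_real a,of_real a,of_real a,of_real a,of_real a] 1) \<noteq> 1" using 1 by simp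
  then show "(\<forall>k. cmod (seq [1,of_real a,of_real a,of_real a,of_real a,of_real a,of_real a] k) = 1)
    \<longrightarrow> (\<forall>m. nondeg m (seq [1,of_real a,of_real a,of_real a,of_real a,of_real a,of_real a]))" by blast
  have "a\<^sup>2 \<noteq> 1" using 1 by (auto simp: power2_eq_1_iff)
  then have "(complex_of_real a)\<^sup>2 \<noteq> 1" by (metis of_real_1 of_real_eq_iff of_real_power)
  then show "nondeg 0 (seq [1,of_real a,of_real a,of_real a,of_real a,of_real a,of_real a])"
    using 1 by (intro nondeg_index1) auto
qed

lemma admissible_family:
  obtains Y where "finite Y" "card Y = 18" "\<And>y. y \<in> Y \<Longrightarrow> admissible y"
proof -
  obtain d where d: "cyclic_root (seq [1,1,1,d,1,d,d])" "cmod d = 1"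
    "cmod (d - gval (-750, 661) / 1000) \<le> 0.001" by (rule index2_exists)
  obtain a b c where abc: "cyclic_root (seq [1,a,b,c,c,b,a])" "cmod a = 1" "cmod b = 1" "cmod c = 1"
    "cmod (a - gval (817, -576) / 1000) \<le> 0.001"
    "cmod (b - gval (280, 960) / 1000) \<le> 0.001"
    "cmod (c - gval (-389, -921) / 1000) \<le> 0.001" by (rule index3_exists)
  obtain p q r where pqr: "cyclic_root (seq [1,of_real p,of_real q,of_real r,of_real r,of_real q,of_real p])"
    "\<bar>1000 * p - 365\<bar> \<le> 1" "\<bar>1000 * inverse p - 2739\<bar> \<le> 1"
    "\<bar>1000 * q - 106\<bar> \<le> 1" "\<bar>1000 * inverse q - 9413\<bar> \<le> 1"
    "\<bar>1000 * r + 818\<bar> \<le> 1" "\<bar>1000 * inverse r + 1222\<bar> \<le> 1" by (rule index3_real_exists)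
  obtain t where t: "cyclic_root (seq [1,of_real t,of_real t,of_real t,of_real t,of_real t,of_real t])"
    "\<bar>1000 * t + 209\<bar> \<le> 1" "\<bar>1000 * inverse t + 4791\<bar> \<le> 1" by (rule index1_exists)
  define x y w v where "x = seq [1,1,1,d,1,d,d]" and "y = seq [1,a,b,c,c,b,a]"
    and "w = seq [1,of_real p,of_real q,of_real r,of_real r,of_real q,of_real p]"
    and "v = seq [1,of_real t,of_real t,of_real t,of_real t,of_real t,of_real t]"
  \<comment> \<open>Together with inversion, the multipliers 1 and 6 give four roots from
    \<open>x\<close>, the multipliers 1, 2, 4 give six each from the even \<open>y\<close> and
    \<open>w\<close>, and \<open>v\<close> gives two: 18 in all.\<close>
  define ys where "ys = [
    \<lambda>k. inverse (w (2 * k)), \<lambda>k. inverse (w k), \<lambda>k. y (2 * k), \<lambda>k. inverse (x k),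
    \<lambda>k. inverse (y (4 * k)), y, \<lambda>k. inverse (y k), x, w, \<lambda>k. w (2 * k), \<lambda>k. x (6 * k), v,
    \<lambda>k. w (4 * k), \<lambda>k. inverse (y (2 * k)), \<lambda>k. inverse (w (4 * k)), \<lambda>k. inverse (x (6 * k)),
    \<lambda>k. y (4 * k), \<lambda>k. inverse (v k)]"
  have ad: "admissible x" "admissible y" "admissible w" "admissible v"
    unfolding x_def y_def w_def v_def
    using admissible_index2[OF d] admissible_index3[OF abc] admissible_index3_real[OF pqr] admissible_index1[OF t(1,2)]
    by simp_all
  have unit: "4 * 2 = (1::7)" "2 * 4 = (1::7)" "6 * 6 = (1::7)" by simp_all
  have all: "\<forall>z\<in>set ys. admissible z"
    unfolding ys_def by (auto intro!: ad ad[THEN admissible_inverse] ad[THEN admissible_unit, OF unit(1)]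
        ad[THEN admissible_unit, OF unit(2)] ad[THEN admissible_unit, OF unit(3)]
        ad[THEN admissible_unit, THEN admissible_inverse, OF unit(1)]
        ad[THEN admissible_unit, THEN admissible_inverse, OF unit(2)]
        ad[THEN admissible_unit, THEN admissible_inverse, OF unit(3)])
  \<comment> \<open>The weights are chosen so that the values of \<open>L\<close> are well separated; \<open>ys\<close> lists them in increasing order.\<close>
  define L where "L = (\<lambda>z :: 7 \<Rightarrow> complex. 2 * Im (z 3) - 3 * Re (z 1) - 3 * Im (z 1))"
  have inv: "inverse z = cnj z" if "cmod z = 1" for z
    using that complex_norm_square[of z] by (intro inverse_unique) simp
  note bd = close_bounds[OF d(3)] close_bounds[OF abc(5)] close_bounds[OF abc(6)] close_bounds[OF abc(7)] pqr(2-7) t(2,3)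
  have "sorted_wrt (<) (map L ys)"
    unfolding ys_def x_def y_def w_def v_def L_def
    using bd by (simp add: sorted_wrt2_simps numerals_7 inv d(2) abc(2-4) abs_le_iff flip: of_real_inverse)
  then have "distinct (map L ys)" by (simp add: strict_sorted_iff)
  then have "distinct ys" by (simp add: distinct_map)
  then have "card (set ys) = 18" by (simp add: distinct_card) (simp add: ys_def)
  then show ?thesis using all by (intro that[of "set ys"]) auto
qed

lemma cyclic_root_scale: "cyclic_root (\<lambda>k. c * x k) \<longleftrightarrow> cyclic_root x" if "c \<noteq> 0"
  using that by (simp add: cyclic_root_def)

lemma nondeg_scale: "nondeg m (\<lambda>k. c * x k) \<longleftrightarrow> nondeg m x" if "c \<noteq> 0"
  using that by (simp add: nondeg_def tangent_def)

theorem proposition6p1: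
  fixes U :: "complex^7^7"
  assumes "biunitary U" and "circulant U"
  shows "\<exists>\<epsilon>>0. \<forall>V :: complex^7^7.
           biunitary V \<and> operator_norm (V - U) < \<epsilon> \<longrightarrow> biunitary_equivalent V U"
proof -
  obtain s where s: "\<And>i j. U $ i $ j = s (j - i)"
    using assms(2) unfolding circulant_def by blast
  have root: "cyclic_root s" and cnj: "\<And>k. cnj (s k) = (1 / 7) / s k"
    using circulant_biunitary_cyclic_root[OF assms(1) s] by simp_all
  obtain Y where Y: "finite Y" "card Y = 18" "\<And>y. y \<in> Y \<Longrightarrow> admissible y"
    by (rule admissible_family) blast
  have s0: "s k \<noteq> 0" for k using root by (rule cyclic_root_nonzero)
  \<comment> \<open>The classification concerns roots with value 1 at 0; dividing by
    \<open>s 0\<close> also makes the entries unimodular, and tangent equations do not see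
    scalars.\<close>
  define z where "z = (\<lambda>k. inverse (s 0) * s k)"
  have "cmod (s k) = 1 / sqrt 7" for k
    using biunitary_cmod[OF assms(1), of 0 k] by (simp add: s)
  then have mod: "cmod (z k) = 1" for k by (simp add: z_def norm_mult norm_inverse)
  have "cyclic_root z" "z 0 = 1" using root s0 by (simp_all add: z_def cyclic_root_scale)
  from unimodular_roots_nondeg[OF Y this mod] have "nondeg m z" for m .
  then have "nondeg m s" for m using s0 by (simp add: z_def nondeg_scale)
  then have "infinitesimally_rigid U" by (intro circulant_rigid[OF s cnj]) simp_all
  then show ?thesis by (rule rigid_imp_isolated[OF assms(1)])
qed

end
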